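(* Let $d\ge1$ be an integer and $1<p<1+\frac2d$. The limit $$e(d,p):=\lim_{N\to\infty}\frac{J(N)}{N}=\inf_{N\ge1}\frac{J(N)}{N}$$ (over integers $N\geq 1$) exists and satisfies $$e_{\rm LT}(d,p)\le e(d,p)\le\min\{e_{\rm sc}(d,p),\,I(1)\}<0,$$ where $$e_{\rm LT}(d,p):=-\Big(1+\frac2d-p\Big)\frac{d}{2p}\left(\frac{d(p-1)}{2p\,c_{\rm LT}(d)}\right)^{\frac{p-1}{1+\frac2d-p}},\qquad e_{\rm sc}(d,p):=-\Big(1+\frac2d-p\Big)\frac{d}{2p}\left(\frac{d(p-1)}{2p\,c_{\rm sc}(d)}\right)^{\frac{p-1}{1+\frac2d-p}},$$ $c_{\rm LT}(d)$ is the Lieb–Thirring constant and $$c_{\rm sc}(d)=\frac{4\pi^2d}{d+2}\left(\frac{d}{|\mathbb{S}^{d-1}|}\right)^{\frac2d}.$$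
   Context: For $d\ge1$, $1<p<1+\frac2d$ and $u_1,\dots,u_N\in H^1(\mathbb{R}^d,\mathbb{C})$ set $$\mathcal{E}(u_1,\dots,u_N)=\sum_{i=1}^N\int_{\mathbb{R}^d}|\nabla u_i|^2\,dx-\frac1p\int_{\mathbb{R}^d}\Big(\sum_{i=1}^N|u_i|^2\Big)^p dx,$$ and for every integer $N\ge1$ $$J(N)=\inf\{\mathcal{E}(u_1,\dots,u_N):\ u_1,\dots,u_N\in H^1(\mathbb{R}^d,\mathbb{C}),\ \langle u_j,u_k\rangle_{L^2}=\delta_{jk}\}.$$ Moreover $I(1)=\min\{\int|\nabla u|^2-\frac1p\int|u|^{2p}:\ u\in H^1(\mathbb{R}^d),\ \int|u|^2=1\}$, so $I(1)=J(1)$. The Lieb–Thirring constant $c_{\rm LT}(d)>0$ is the best (largest) constant, independent of $N$, such that $$\sum_{n=1}^N\int_{\mathbb{R}^d}|\nabla u_n|^2\,dx\ge c_{\rm LT}(d)\int_{\mathbb{R}^d}\Big(\sum_{n=1}^N|u_n|^2\Big)^{1+\frac2d}dx$$ for all $N\ge1$ and all $L^2$-orthonormal families $u_1,\dots,u_N\in H^1(\mathbb{R}^d)$. $|\mathbb{S}^{d-1}|$ is the surface measure of the unit sphere ($|\mathbb{S}^0|=2$). *)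

theory Defs
  imports "HOL-Analysis.Analysis"
begin

text \<open>
  The dimension \<open>d\<close> is \<open>CARD('d)\<close> for a finite type \<open>'d\<close>. Elements of \<open>L\<^sup>2\<close> and \<open>H\<^sup>1\<close> are
  represented by functions; all quantities below only depend on classes modulo null sets.
  Every class of Lebesgue measurable functions has a Borel representative, so measurability
  is taken with respect to \<^const>\<open>lborel\<close>.
\<close>

definition partial_deriv :: "'d \<Rightarrow> (real^'d \<Rightarrow> real) \<Rightarrow> real^'d \<Rightarrow> real" where
  "partial_deriv i f x = frechet_derivative f (at x) (axis i 1)"

primrec C_k :: "nat \<Rightarrow> (real^'d \<Rightarrow> real) \<Rightarrow> bool" where
  "C_k 0 f \<longleftrightarrow> continuous_on UNIV f"
| "C_k (Suc k) f \<longleftrightarrow> (\<forall>x. f differentiable (at x)) \<and> (\<forall>i. C_k k (partial_deriv i f))"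

definition test_function :: "(real^'d \<Rightarrow> real) \<Rightarrow> bool" where
  "test_function \<phi> \<longleftrightarrow> (\<forall>k. C_k k \<phi>) \<and> compact (closure {x. \<phi> x \<noteq> 0})"

definition L2_fun :: "(real^'d \<Rightarrow> 'b::euclidean_space) \<Rightarrow> bool" where
  "L2_fun f \<longleftrightarrow> f \<in> borel_measurable lborel \<and> integrable lborel (\<lambda>x. (norm (f x))\<^sup>2)"

definition L2_inner :: "(real^'d \<Rightarrow> complex) \<Rightarrow> (real^'d \<Rightarrow> complex) \<Rightarrow> complex" where
  "L2_inner u v = (LINT x|lborel. cnj (u x) * v x)"

text \<open>Real-valued test functions suffice, since the defining identity is linear in \<open>\<phi>\<close>.\<close>

definition has_weak_gradient :: "(real^'d \<Rightarrow> complex) \<Rightarrow> (real^'d \<Rightarrow> complex^'d) \<Rightarrow> bool" where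
  "has_weak_gradient u g \<longleftrightarrow>
     (\<forall>\<phi> i. test_function \<phi> \<longrightarrow>
        (LINT x|lborel. partial_deriv i \<phi> x *\<^sub>R u x) = - (LINT x|lborel. \<phi> x *\<^sub>R (g x $ i)))"

definition H1 :: "(real^'d \<Rightarrow> complex) set" where
  "H1 = {u. L2_fun u \<and> (\<exists>g. L2_fun g \<and> has_weak_gradient u g)}"

text \<open>The weak gradient is unique up to null sets, so the choice does not affect integrals.\<close>

definition weak_gradient :: "(real^'d \<Rightarrow> complex) \<Rightarrow> real^'d \<Rightarrow> complex^'d" where
  "weak_gradient u = (SOME g. L2_fun g \<and> has_weak_gradient u g)"

definition kinetic :: "(real^'d \<Rightarrow> complex) \<Rightarrow> real" where
  "kinetic u = (LINT x|lborel. (norm (weak_gradient u x))\<^sup>2)"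

definition density :: "nat \<Rightarrow> (nat \<Rightarrow> real^'d \<Rightarrow> complex) \<Rightarrow> real^'d \<Rightarrow> real" where
  "density N u x = (\<Sum>i=1..N. (norm (u i x))\<^sup>2)"

definition orthonormal_H1 :: "nat \<Rightarrow> (nat \<Rightarrow> real^'d \<Rightarrow> complex) \<Rightarrow> bool" where
  "orthonormal_H1 N u \<longleftrightarrow> (\<forall>i\<in>{1..N}. u i \<in> H1) \<and>
     (\<forall>j\<in>{1..N}. \<forall>k\<in>{1..N}. L2_inner (u j) (u k) = (if j = k then 1 else 0))"

text \<open>
  For \<open>H\<^sup>1\<close> families the densities raised to a power \<open>p\<close> with \<open>1 \<le> p \<le> 1 + 2/d\<close> are integrable
  by the Gagliardo--Nirenberg inequality, so the Bochner integrals below are the usual ones.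
\<close>

definition energy :: "real \<Rightarrow> nat \<Rightarrow> (nat \<Rightarrow> real^'d \<Rightarrow> complex) \<Rightarrow> real" where
  "energy p N u = (\<Sum>i=1..N. kinetic (u i)) - 1 / p * (LINT x|lborel. density N u x powr p)"

definition J :: "'d::finite itself \<Rightarrow> real \<Rightarrow> nat \<Rightarrow> real" where
  "J _ p N = Inf {energy p N u | u :: nat \<Rightarrow> real^'d \<Rightarrow> complex. orthonormal_H1 N u}"

definition I_one :: "'d::finite itself \<Rightarrow> real \<Rightarrow> real" where
  "I_one _ p = Inf {kinetic u - 1 / p * (LINT x|lborel. norm (u x) powr (2 * p)) | u :: real^'d \<Rightarrow> complex.
     u \<in> H1 \<and> (LINT x|lborel. (norm (u x))\<^sup>2) = 1}"

definition c_LT :: "'d::finite itself \<Rightarrow> real" where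
  "c_LT _ = Sup {c. \<forall>N\<ge>1. \<forall>u :: nat \<Rightarrow> real^'d \<Rightarrow> complex. orthonormal_H1 N u \<longrightarrow>
     (\<Sum>n=1..N. kinetic (u n)) \<ge> c * (LINT x|lborel. density N u x powr (1 + 2 / real CARD('d)))}"

text \<open>
  Surface measure on the unit sphere of \<open>\<real>\<^sup>d\<close>, as induced by polar coordinates:
  \<open>d\<close> times the volume of the cone over the set.
\<close>

definition sphere_measure :: "(real^'d) set \<Rightarrow> real" where
  "sphere_measure A = real CARD('d) * measure lborel {t *\<^sub>R x | t x. x \<in> A \<and> 0 < t \<and> t \<le> 1}"

definition c_sc :: "'d::finite itself \<Rightarrow> real" where
  "c_sc _ = (let d = real CARD('d) in
     4 * pi\<^sup>2 * d / (d + 2) * (d / sphere_measure (sphere (0 :: real^'d) 1)) powr (2 / d))"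

definition e_of_constant :: "real \<Rightarrow> real \<Rightarrow> real \<Rightarrow> real" where
  "e_of_constant c d p =
     - (1 + 2 / d - p) * (d / (2 * p)) * (d * (p - 1) / (2 * p * c)) powr ((p - 1) / (1 + 2 / d - p))"

definition e_LT :: "'d::finite itself \<Rightarrow> real \<Rightarrow> real" where
  "e_LT T p = e_of_constant (c_LT T) (real CARD('d)) p"

definition e_sc :: "'d::finite itself \<Rightarrow> real \<Rightarrow> real" where
  "e_sc T p = e_of_constant (c_sc T) (real CARD('d)) p"

definition e_lim :: "'d::finite itself \<Rightarrow> real \<Rightarrow> real" where
  "e_lim T p = lim (\<lambda>N. J T p N / real N)"

end

theory Submission
  imports Defs
begin

text \<open>
  Two finite families are made compactly supported at the cost of a small energy error: cut off,
  and restore orthonormality by adding combinations of far away copies of a fixed state at a large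
  scale, whose coefficients come from the small defect of the Gram matrix. Translating one family
  away from the other gives \<open>J(N + M) \<le> J(N) + J(M)\<close>, so that the limit exists and equals the
  infimum by Fekete's lemma.

  For the lower bound a positive Lieb--Thirring constant is needed, since otherwise the supremum
  defining it would carry no information. Averaging \<open>u\<^sub>i\<close> at scale \<open>l\<close> against a
  smooth kernel, Bessel's inequality bounds the density of the averages by a multiple of \<open>l\<^bsup>-d\<^esup>\<close>,
  while the remainder is at most \<open>l\<close> times the Hardy--Littlewood maximal function of the length of
  the gradients, which is bounded in \<open>L\<^sup>2\<close>; optimizing \<open>l\<close> at each point gives the inequality.
  Minimizing \<open>c \<rho>\<^bsup>2/d\<^esup> - \<rho>\<^bsup>p-1\<^esup> / p\<close> over the density \<open>\<rho>\<close> at each point then yields \<open>e\<^sub>L\<^sub>T\<close>.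

  The semiclassical upper bound uses the Dirichlet sine modes of a cube with frequencies in a ball
  as trial states: Jensen's inequality bounds the interaction by that of a constant density, and
  lattice point counts give the kinetic energy asymptotically.
\<close>

subsection \<open>Smooth functions\<close>

text \<open>The estimate for a whole orthonormal family is reduced to one function by freezing
  coefficients: for fixed \<open>x\<close>, the combination
  \<open>U y = (\<Sum>k. cnj (u k x) * u k y)\<close> takes the density as its value at
  \<open>x\<close>, and both the Bessel bound and the gradient bound are applied to
  \<open>U\<close>. A maximal function is never formed: a number \<open>\<mu>\<close> dominating all
  normalized ball averages at \<open>x\<close> takes its place, and the strong bound speaks of any
  measurable function lying below all such numbers. The obstacle in localizing is that a cutoff
  destroys orthonormality. The discarded part \<open>sqrt (1 - c\<^sup>2) * u\<close> has exactly
  the missing Gram matrix and tends to 0 in the square norm, so it suffices to reproduce that matrix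
  by states placed elsewhere; their density only lowers the interaction term. In the semiclassical
  bound convexity has the favourable sign, because the interaction is subtracted: the mean density
  already gives an upper bound, and no local information on the trial density enters. The modes
  vanish on the faces of the cube, which is why they extend by zero to \<open>H1\<close> functions
  on the whole space.\<close>

lemma partial_deriv_eq:
  "(f has_derivative f') (at x) \<Longrightarrow> partial_deriv i f x = f' (axis i 1)"
  unfolding partial_deriv_def by (metis frechet_derivative_at)

lemma C_k_Suc_imp: "C_k (Suc k) f \<Longrightarrow> C_k k f"
proof (induction k arbitrary: f)
  case 0
  then show ?case
    by (simp add: differentiable_imp_continuous_on differentiable_on_def differentiable_at_withinI)
next
  case (Suc k)
  then show ?case by (meson C_k.simps(2))
qed

lemma C_k_const: "C_k k (\<lambda>x::real^'d. c)"
proof (induction k arbitrary: c)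
  case (Suc k)
  have "partial_deriv i (\<lambda>x::real^'d. c) = (\<lambda>x. 0)" for i
    by (rule ext, subst partial_deriv_eq[OF has_derivative_const]) simp
  then show ?case using Suc by simp
qed simp

lemma C_k_add:
  assumes "C_k k f" "C_k k g" shows "C_k k (\<lambda>x. f x + g x)"
  using assms
proof (induction k arbitrary: f g)
  case 0
  then show ?case by (auto intro: continuous_on_add)
next
  case (Suc k)
  have *: "((\<lambda>x. f x + g x) has_derivative (\<lambda>h. frechet_derivative f (at x) h + frechet_derivative g (at x) h)) (at x)" for x
    using Suc.prems by (intro has_derivative_add) (auto simp: frechet_derivative_works[symmetric])
  have "partial_deriv i (\<lambda>x. f x + g x) = (\<lambda>x. partial_deriv i f x + partial_deriv i g x)" for i
    by (rule ext, subst partial_deriv_eq[OF *]) (simp add: partial_deriv_def)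
  moreover have "(\<lambda>x. f x + g x) differentiable (at x)" for x
    using * differentiable_def by blast
  ultimately show ?case using Suc.prems by (auto intro!: Suc.IH)
qed

lemma C_k_mult:
  assumes "C_k k f" "C_k k g" shows "C_k k (\<lambda>x. f x * g x)"
  using assms
proof (induction k arbitrary: f g)
  case 0
  then show ?case by (auto intro: continuous_on_mult)
next
  case (Suc k)
  have *: "((\<lambda>x. f x * g x) has_derivative (\<lambda>h. f x * frechet_derivative g (at x) h + frechet_derivative f (at x) h * g x)) (at x)" for x
    using Suc.prems by (intro has_derivative_mult) (auto simp: frechet_derivative_works[symmetric])
  have "partial_deriv i (\<lambda>x. f x * g x) = (\<lambda>x. f x * partial_deriv i g x + partial_deriv i f x * g x)" for i
    by (rule ext, subst partial_deriv_eq[OF *]) (simp add: partial_deriv_def)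
  moreover have "(\<lambda>x. f x * g x) differentiable (at x)" for x
    using * differentiable_def by blast
  ultimately show ?case using Suc.prems C_k_Suc_imp[OF Suc.prems(1)] C_k_Suc_imp[OF Suc.prems(2)]
    by (auto intro!: C_k_add Suc.IH)
qed

lemma C_k_prod:
  assumes "finite S" "\<And>j. j \<in> S \<Longrightarrow> C_k k (f j)" shows "C_k k (\<lambda>x. \<Prod>j\<in>S. f j x)"
  using assms by (induction S rule: finite_induct) (auto intro: C_k_const C_k_mult)

lemma C_k_component: "C_k k (\<lambda>x::real^'d. x $ j)"
proof (cases k)
  case 0
  then show ?thesis by (simp add: continuous_on_component)
next
  case (Suc n)
  have *: "((\<lambda>x::real^'d. x $ j) has_derivative (\<lambda>h. h $ j)) (at x)" for x
    using bounded_linear_imp_has_derivative[OF bounded_linear_vec_nth] .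
  have "partial_deriv i (\<lambda>x::real^'d. x $ j) = (\<lambda>x. (axis i 1 :: real^'d) $ j)" for i
    by (rule ext, subst partial_deriv_eq[OF *]) simp
  then show ?thesis using Suc * by (auto simp: differentiable_def intro: C_k_const)
qed

text \<open>The family is closed under differentiation up to linear combinations, so each member is smooth.\<close>

definition flat_exp :: "nat \<Rightarrow> real \<Rightarrow> real" where
  "flat_exp n t = (if t > 0 then exp (- (1 / t)) / t ^ n else 0)"

lemma flat_exp_nonneg: "0 \<le> flat_exp n t"
  by (simp add: flat_exp_def)

lemma flat_exp_tendsto_0: "(flat_exp n \<longlongrightarrow> 0) (at 0)"
proof -
  have "((\<lambda>t::real. t ^ n / exp t) \<longlongrightarrow> 0) at_top" by (rule tendsto_power_div_exp_0)
  then have "((\<lambda>t::real. (inverse t) ^ n / exp (inverse t)) \<longlongrightarrow> 0) (at_right 0)"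
    by (rule filterlim_compose[OF _ filterlim_inverse_at_top_right])
  then have right: "(flat_exp n \<longlongrightarrow> 0) (at_right 0)"
    by (rule Lim_transform_eventually)
      (auto simp: flat_exp_def eventually_at_right_field exp_minus field_simps intro!: exI[of _ 1])
  have left: "(flat_exp n \<longlongrightarrow> 0) (at_left 0)"
    by (rule tendsto_eventually) (auto simp: flat_exp_def eventually_at_left_field intro!: exI[of _ "-1"])
  show ?thesis using left right by (simp add: filterlim_split_at)
qed

text \<open>The delicate point is 0: there the difference quotient of \<open>flat_exp n\<close> is
  exactly \<open>flat_exp (n + 1)\<close>, which tends to 0.\<close>

lemma flat_exp_deriv:
  "(flat_exp n has_real_derivative (flat_exp (n + 2) t - real n * flat_exp (n + 1) t)) (at t)"
proof -
  consider "t > 0" | "t < 0" | "t = 0" by linarith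
  then show ?thesis
  proof cases
    case 1
    have "((\<lambda>t. exp (- inverse t) * inverse t ^ n) has_real_derivative
        (exp (- inverse t) * inverse t ^ (n + 2) - real n * (exp (- inverse t) * inverse t ^ (n + 1)))) (at t)"
      using 1 by (cases n) (auto intro!: derivative_eq_intros simp: algebra_simps power2_eq_square,
        metis One_nat_def power_eq_if)
    then have "((\<lambda>t. exp (- (1 / t)) / t ^ n) has_real_derivative
        (flat_exp (n + 2) t - real n * flat_exp (n + 1) t)) (at t)"
      using 1 by (simp add: flat_exp_def divide_inverse power_inverse)
    then show ?thesis
      by (rule DERIV_cong_ev[OF refl _ refl, THEN iffD1, rotated])
        (use 1 in \<open>auto simp: flat_exp_def intro!: eventually_nhds_in_open[of "{0<..}", THEN eventually_mono]\<close>)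
  next
    case 2
    have "((\<lambda>t. 0) has_real_derivative (flat_exp (n + 2) t - real n * flat_exp (n + 1) t)) (at t)"
      using 2 by (simp add: flat_exp_def)
    then show ?thesis
      by (rule DERIV_cong_ev[OF refl _ refl, THEN iffD1, rotated])
        (use 2 in \<open>auto simp: flat_exp_def intro!: eventually_nhds_in_open[of "{..<0}", THEN eventually_mono]\<close>)
  next
    case 3
    have "(flat_exp (n + 1) \<longlongrightarrow> 0) (at 0)" by (rule flat_exp_tendsto_0)
    moreover have "flat_exp (n + 1) = (\<lambda>h. (flat_exp n (0 + h) - flat_exp n 0) / h)"
      by (auto simp: flat_exp_def)
    ultimately have "(flat_exp n has_real_derivative 0) (at 0)"
      by (simp only: DERIV_def)
    then show ?thesis using 3 by (simp add: flat_exp_def)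
  qed
qed

lemma C_k_flat_exp: "C_k k (\<lambda>x::real^'d. flat_exp n (a + b * x $ j))"
proof (induction k arbitrary: n)
  case 0
  have "continuous_on UNIV (flat_exp n)"
    using flat_exp_deriv by (meson DERIV_isCont continuous_at_imp_continuous_on)
  then show ?case
    by (auto intro!: continuous_on_compose2[where f="\<lambda>x::real^'d. a + b * x $ j"] continuous_intros)
next
  case (Suc k)
  let ?D = "\<lambda>x::real^'d. b * (flat_exp (n + 2) (a + b * x $ j) + (- real n) * flat_exp (n + 1) (a + b * x $ j))"
  have *: "((\<lambda>x::real^'d. flat_exp n (a + b * x $ j)) has_derivative
      (\<lambda>h. (flat_exp (n + 2) (a + b * x $ j) - real n * flat_exp (n + 1) (a + b * x $ j)) * (b * h $ j))) (at x)" for x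
    by (rule has_derivative_compose[where f="\<lambda>x::real^'d. a + b * x $ j", OF _ flat_exp_deriv[unfolded has_field_derivative_def]])
      (auto intro!: derivative_eq_intros bounded_linear_imp_has_derivative bounded_linear_vec_nth)
  have "partial_deriv i (\<lambda>x::real^'d. flat_exp n (a + b * x $ j)) = (\<lambda>x. (axis i 1 :: real^'d) $ j * ?D x)" for i
    by (rule ext, subst partial_deriv_eq[OF *]) (simp add: algebra_simps)
  moreover have "C_k k ?D"
    by (intro C_k_mult C_k_const C_k_add Suc.IH)
  ultimately show ?case using *
    by (auto simp: differentiable_def simp del: add_uminus_conv_diff intro!: C_k_const C_k_mult)
qed

section \<open>Smooth bumps on boxes and bounds for test functions\<close>

definition bump :: "real^'d \<Rightarrow> real^'d \<Rightarrow> real \<Rightarrow> real^'d \<Rightarrow> real" where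
  "bump a b s x = (\<Prod>i\<in>UNIV. flat_exp 0 (s * (x $ i - a $ i)) * flat_exp 0 (s * (b $ i - x $ i)))"

lemma C_k_bump: "C_k k (bump a b s)"
proof -
  have "bump a b s = (\<lambda>x. \<Prod>i\<in>UNIV. flat_exp 0 (- s * a $ i + s * x $ i) * flat_exp 0 (s * b $ i + (- s) * x $ i))"
    by (auto simp: bump_def fun_eq_iff algebra_simps)
  then show ?thesis by (simp only:) (intro C_k_prod C_k_mult C_k_flat_exp finite)
qed

lemma flat_exp_le_1: "flat_exp 0 t \<le> 1"
  by (simp add: flat_exp_def)

lemma bump_nonneg: "0 \<le> bump a b s x"
  by (simp add: bump_def prod_nonneg flat_exp_nonneg)

lemma bump_le_1: "bump a b s x \<le> 1"
  unfolding bump_def by (intro prod_le_1) (auto simp: flat_exp_nonneg intro!: mult_le_one flat_exp_le_1)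

lemma bump_eq_0:
  assumes "s > 0" "x \<notin> box a b" shows "bump a b s x = 0"
proof -
  have "\<exists>i. x $ i \<le> a $ i \<or> b $ i \<le> x $ i" using assms(2) by (auto simp: mem_box_cart not_less)
  then obtain i where "x $ i \<le> a $ i \<or> b $ i \<le> x $ i" by blast
  then show ?thesis using assms(1)
    unfolding bump_def by (intro prod_zero) (auto intro!: exI[of _ i] simp: flat_exp_def zero_less_mult_iff not_less)
qed

lemma bump_pos: "s > 0 \<Longrightarrow> x \<in> box a b \<Longrightarrow> bump a b s x > 0"
  unfolding bump_def by (intro prod_pos) (auto simp: mem_box_cart flat_exp_def)

lemma test_functionI:
  assumes "\<And>k. C_k k \<phi>" "\<And>x. x \<notin> cbox a b \<Longrightarrow> \<phi> x = 0"
  shows "test_function \<phi>"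
proof -
  have "closure {x. \<phi> x \<noteq> 0} \<subseteq> cbox a b"
    using assms(2) by (intro closure_minimal) (auto simp: closed_cbox)
  then have "compact (closure {x. \<phi> x \<noteq> 0})"
    using bounded_subset[OF bounded_cbox] by (simp add: compact_eq_bounded_closed)
  then show ?thesis using assms(1) by (simp add: test_function_def)
qed

lemma test_function_bump: "s > 0 \<Longrightarrow> test_function (bump a b s)"
  by (rule test_functionI[of _ a b]) (use box_subset_cbox[of a b] in \<open>auto intro: C_k_bump bump_eq_0\<close>)

lemma test_function_C_k: "test_function \<phi> \<Longrightarrow> C_k k \<phi>"
  by (simp add: test_function_def)

lemma test_function_support:
  assumes "test_function \<phi>"
  obtains a b where "\<And>x. x \<notin> cbox a b \<Longrightarrow> \<phi> x = 0"
proof -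
  have "bounded {x. \<phi> x \<noteq> 0}"
    using assms bounded_subset[OF compact_imp_bounded closure_subset] by (simp add: test_function_def)
  then obtain a where a: "{x. \<phi> x \<noteq> 0} \<subseteq> cbox (-a) a"
    using bounded_subset_cbox_symmetric by blast
  show ?thesis by (rule that[of "-a" a]) (use a in blast)
qed

lemma test_function_mult:
  assumes "test_function \<phi>" "\<And>k. C_k k \<psi>" shows "test_function (\<lambda>x. \<psi> x * \<phi> x)"
proof -
  obtain a b where s: "\<And>x. x \<notin> cbox a b \<Longrightarrow> \<phi> x = 0"
    by (rule test_function_support[OF assms(1)]) blast
  show ?thesis
    by (rule test_functionI[of _ a b], intro C_k_mult assms(2) test_function_C_k[OF assms(1)]) (simp add: s)
qed

lemma test_function_has_derivative:
  assumes "test_function \<phi>"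
  shows "(\<phi> has_derivative (\<lambda>h. \<Sum>i\<in>UNIV. h $ i * partial_deriv i \<phi> x)) (at x)"
proof -
  have d: "(\<phi> has_derivative frechet_derivative \<phi> (at x)) (at x)"
    using test_function_C_k[OF assms, of "Suc 0"] frechet_derivative_works by auto
  have "frechet_derivative \<phi> (at x) h = (\<Sum>i\<in>UNIV. h $ i * partial_deriv i \<phi> x)" for h
  proof -
    have "linear (frechet_derivative \<phi> (at x))" using d has_derivative_linear by blast
    then have "frechet_derivative \<phi> (at x) (\<Sum>i\<in>UNIV. h $ i *\<^sub>R axis i 1)
        = (\<Sum>i\<in>UNIV. h $ i * partial_deriv i \<phi> x)"
      by (simp add: linear_sum linear_scale partial_deriv_def)
    moreover have "(\<Sum>i\<in>UNIV. h $ i *\<^sub>R axis i 1) = h"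
      using basis_expansion[of h] by (simp add: scalar_mult_eq_scaleR)
    ultimately show ?thesis by simp
  qed
  then have "frechet_derivative \<phi> (at x) = (\<lambda>h. \<Sum>i\<in>UNIV. h $ i * partial_deriv i \<phi> x)" by blast
  then show ?thesis using d by simp
qed

lemma test_function_continuous: "test_function \<phi> \<Longrightarrow> continuous_on UNIV \<phi>"
  using test_function_C_k[of _ 0] by simp

lemma partial_deriv_continuous: "test_function \<phi> \<Longrightarrow> continuous_on UNIV (partial_deriv i \<phi>)"
  using test_function_C_k[of _ "Suc 0"] by auto

lemma partial_deriv_support:
  assumes "\<And>x. x \<notin> cbox a b \<Longrightarrow> \<phi> x = 0" "x \<notin> cbox a b"
  shows "partial_deriv i \<phi> x = 0"
proof -
  have "(\<phi> has_derivative (\<lambda>h. 0)) (at x)"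
    by (rule has_derivative_transform_within_open[of "\<lambda>x. 0" _ _ _ "- cbox a b"])
      (use assms in auto)
  then show ?thesis using partial_deriv_eq by metis
qed

lemma bounded_of_cbox_support:
  fixes f :: "real^'d \<Rightarrow> real"
  assumes "continuous_on UNIV f" "\<And>x. x \<notin> cbox a b \<Longrightarrow> f x = 0"
  obtains B where "B > 0" "\<And>x. \<bar>f x\<bar> \<le> B"
proof -
  have "bounded (f ` cbox a b)"
    by (meson assms(1) compact_cbox compact_continuous_image compact_imp_bounded continuous_on_subset top_greatest)
  then obtain B where "B > 0" "\<And>x. x \<in> cbox a b \<Longrightarrow> \<bar>f x\<bar> \<le> B"
    unfolding bounded_pos by auto
  then show ?thesis using that[of B] assms(2) by (metis abs_zero less_imp_le)
qed

lemma test_function_bounds: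
  assumes "test_function \<phi>"
  obtains a b B where "B > 0" "\<And>x. \<bar>\<phi> x\<bar> \<le> B" "\<And>i x. \<bar>partial_deriv i \<phi> x\<bar> \<le> B"
    "\<And>x. x \<notin> cbox a b \<Longrightarrow> \<phi> x = 0" "\<And>i x. x \<notin> cbox a b \<Longrightarrow> partial_deriv i \<phi> x = 0"
proof -
  obtain a b where s: "\<And>x. x \<notin> cbox a b \<Longrightarrow> \<phi> x = 0"
    by (rule test_function_support[OF assms]) blast
  note ps = partial_deriv_support[OF s]
  obtain B0 where B0: "B0 > 0" "\<And>x. \<bar>\<phi> x\<bar> \<le> B0"
    by (rule bounded_of_cbox_support[OF test_function_continuous[OF assms] s]) blast+
  have "\<forall>i. \<exists>B>0. \<forall>x. \<bar>partial_deriv i \<phi> x\<bar> \<le> B"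
  proof
    fix i
    obtain B where "B > 0" "\<And>x. \<bar>partial_deriv i \<phi> x\<bar> \<le> B"
      by (rule bounded_of_cbox_support[OF partial_deriv_continuous[OF assms] ps]) blast+
    then show "\<exists>B>0. \<forall>x. \<bar>partial_deriv i \<phi> x\<bar> \<le> B" by blast
  qed
  then obtain Bi where "\<forall>i. Bi i > 0 \<and> (\<forall>x. \<bar>partial_deriv i \<phi> x\<bar> \<le> Bi i)"
    using choice[of "\<lambda>i B. B > 0 \<and> (\<forall>x. \<bar>partial_deriv i \<phi> x\<bar> \<le> B)"] by blast
  then have Bi: "\<And>i. Bi i > 0" "\<And>i x. \<bar>partial_deriv i \<phi> x\<bar> \<le> Bi i" by blast+
  have le: "Bi i \<le> (\<Sum>i\<in>UNIV. Bi i)" for i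
    using Bi(1) by (intro member_le_sum) (auto simp: less_imp_le)
  show ?thesis
  proof (rule that[of "B0 + (\<Sum>i\<in>UNIV. Bi i)" a b])
    have "0 \<le> (\<Sum>i\<in>UNIV. Bi i)" using Bi(1) by (simp add: sum_nonneg less_imp_le)
    then show "B0 + (\<Sum>i\<in>UNIV. Bi i) > 0" "\<bar>\<phi> x\<bar> \<le> B0 + (\<Sum>i\<in>UNIV. Bi i)" for x
      using B0(1) B0(2)[of x] by auto
    show "\<bar>partial_deriv i \<phi> x\<bar> \<le> B0 + (\<Sum>i\<in>UNIV. Bi i)" for i x
      using Bi(2)[of i x] le[of i] B0(1) by linarith
    show "\<phi> x = 0" "partial_deriv i \<phi> x = 0" if "x \<notin> cbox a b" for i x
      using s ps that by auto
  qed
qed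

subsection \<open>Square-integrable functions\<close>

lemma borel_measurable_nth [measurable (raw)]:
  fixes g :: "'a \<Rightarrow> 'b::euclidean_space^'d"
  assumes "g \<in> borel_measurable M" shows "(\<lambda>x. g x $ i) \<in> borel_measurable M"
proof -
  have "(\<lambda>v::'b^'d. v $ i) \<in> borel_measurable borel"
    by (intro borel_measurable_continuous_onI continuous_on_component continuous_on_id)
  then show ?thesis using assms by (rule measurable_compose[rotated])
qed

lemma borel_measurable_vec_lambda [measurable (raw)]:
  fixes g :: "'d::finite \<Rightarrow> 'a \<Rightarrow> complex"
  assumes "\<And>i. g i \<in> borel_measurable M" shows "(\<lambda>x. \<chi> i. g i x) \<in> borel_measurable M"
proof -
  have "linear (\<lambda>z::complex. axis i z)" for i :: 'd
    by (auto simp: linear_iff vec_eq_iff axis_def)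
  then have "(\<lambda>z::complex. axis i z :: complex^'d) \<in> borel_measurable borel" for i
    by (intro borel_measurable_continuous_onI linear_continuous_on) (simp add: linear_linear)
  then have "(\<lambda>x. \<Sum>i\<in>UNIV. axis i (g i x) :: complex^'d) \<in> borel_measurable M"
    using assms by (intro borel_measurable_sum) (rule measurable_compose)
  moreover have "(\<Sum>i\<in>UNIV. axis i (g i x) :: complex^'d) = (\<chi> i. g i x)" for x
    by (simp add: vec_eq_iff axis_def if_distrib cong: if_cong)
  ultimately show ?thesis by simp
qed

lemma integral_translate:
  fixes f :: "'a::euclidean_space \<Rightarrow> 'b::{banach, second_countable_topology}"
  assumes "f \<in> borel_measurable borel"
  shows "(LINT x|lborel. f (t + x)) = (LINT x|lborel. f x)"
proof -
  have "(LINT x|lborel. f x) = (LINT x|distr lborel borel ((+) t). f x)"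
    by (simp add: lborel_distr_plus)
  also have "\<dots> = (LINT x|lborel. f (t + x))" using assms by (intro integral_distr) auto
  finally show ?thesis by simp
qed

lemma integrable_translate:
  fixes f :: "'a::euclidean_space \<Rightarrow> 'b::{banach, second_countable_topology}"
  assumes "f \<in> borel_measurable borel"
  shows "integrable lborel (\<lambda>x. f (t + x)) \<longleftrightarrow> integrable lborel f"
proof -
  have "integrable lborel f \<longleftrightarrow> integrable (distr lborel borel ((+) t)) f"
    by (simp add: lborel_distr_plus)
  also have "\<dots> \<longleftrightarrow> integrable lborel (\<lambda>x. f (t + x))" using assms by (intro integrable_distr_eq) auto
  finally show ?thesis by simp
qed

lemma L2_fun_measurable: "L2_fun f \<Longrightarrow> f \<in> borel_measurable borel"
  by (simp add: L2_fun_def)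

lemma L2_fun_integrable: "L2_fun f \<Longrightarrow> integrable lborel (\<lambda>x. (norm (f x))\<^sup>2)"
  by (simp add: L2_fun_def)

lemma L2_mult_integrable:
  fixes f :: "real^'d \<Rightarrow> 'a::euclidean_space" and g :: "real^'d \<Rightarrow> 'b::euclidean_space"
    and h :: "real^'d \<Rightarrow> 'c::euclidean_space"
  assumes "L2_fun f" "L2_fun g" "h \<in> borel_measurable borel" "\<And>x. norm (h x) \<le> norm (f x) * norm (g x)"
  shows "integrable lborel h"
proof (rule Bochner_Integration.integrable_bound[of _ "\<lambda>x. (norm (f x))\<^sup>2 + (norm (g x))\<^sup>2"])
  show "integrable lborel (\<lambda>x. (norm (f x))\<^sup>2 + (norm (g x))\<^sup>2)"
    using L2_fun_integrable[OF assms(1)] L2_fun_integrable[OF assms(2)] by simp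
  show "AE x in lborel. norm (h x) \<le> norm ((norm (f x))\<^sup>2 + (norm (g x))\<^sup>2)"
  proof (rule AE_I2)
    fix x
    have "2 * (norm (f x) * norm (g x)) \<le> (norm (f x))\<^sup>2 + (norm (g x))\<^sup>2"
      using sum_squares_bound[of "norm (f x)" "norm (g x)"] by simp
    moreover have "0 \<le> norm (f x) * norm (g x)" by simp
    ultimately have "norm (f x) * norm (g x) \<le> (norm (f x))\<^sup>2 + (norm (g x))\<^sup>2" by linarith
    then show "norm (h x) \<le> norm ((norm (f x))\<^sup>2 + (norm (g x))\<^sup>2)" using assms(4)[of x] by simp
  qed
qed (use assms in simp)

lemma L2_fun_bound:
  assumes "L2_fun f" "h \<in> borel_measurable borel" "\<And>x. norm (h x) \<le> C * norm (f x)"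
  shows "L2_fun h"
proof -
  have "integrable lborel (\<lambda>x. (norm (h x))\<^sup>2)"
  proof (rule Bochner_Integration.integrable_bound[of _ "\<lambda>x. C\<^sup>2 * (norm (f x))\<^sup>2"])
    show "integrable lborel (\<lambda>x. C\<^sup>2 * (norm (f x))\<^sup>2)" using L2_fun_integrable[OF assms(1)] by simp
    show "AE x in lborel. norm ((norm (h x))\<^sup>2) \<le> norm (C\<^sup>2 * (norm (f x))\<^sup>2)"
      using power_mono[OF assms(3) norm_ge_zero, where n=2] by (auto simp: power_mult_distrib)
  qed (use assms in simp)
  then show ?thesis using assms by (simp add: L2_fun_def)
qed

lemma L2_fun_add:
  assumes "L2_fun f" "L2_fun g" shows "L2_fun (\<lambda>x. f x + g x)"
proof -
  note [measurable] = L2_fun_measurable[OF assms(1)] L2_fun_measurable[OF assms(2)]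
  have "integrable lborel (\<lambda>x. (norm (f x + g x))\<^sup>2)"
  proof (rule Bochner_Integration.integrable_bound[of _ "\<lambda>x. 2 * (norm (f x))\<^sup>2 + 2 * (norm (g x))\<^sup>2"])
    show "integrable lborel (\<lambda>x. 2 * (norm (f x))\<^sup>2 + 2 * (norm (g x))\<^sup>2)"
      using L2_fun_integrable[OF assms(1)] L2_fun_integrable[OF assms(2)] by simp
    show "AE x in lborel. norm ((norm (f x + g x))\<^sup>2) \<le> norm (2 * (norm (f x))\<^sup>2 + 2 * (norm (g x))\<^sup>2)"
    proof (rule AE_I2)
      fix x
      have "(norm (f x + g x))\<^sup>2 \<le> (norm (f x) + norm (g x))\<^sup>2"
        by (intro power_mono norm_triangle_ineq) auto
      also have "\<dots> \<le> 2 * (norm (f x))\<^sup>2 + 2 * (norm (g x))\<^sup>2"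
        using sum_squares_bound[of "norm (f x)" "norm (g x)"] by (simp add: power2_sum)
      finally show "norm ((norm (f x + g x))\<^sup>2) \<le> norm (2 * (norm (f x))\<^sup>2 + 2 * (norm (g x))\<^sup>2)" by simp
    qed
  qed simp
  then show ?thesis by (simp add: L2_fun_def)
qed

lemma L2_fun_zero: "L2_fun (\<lambda>x. 0)"
  by (simp add: L2_fun_def)

lemma L2_fun_sum:
  assumes "\<And>k. k \<in> S \<Longrightarrow> L2_fun (f k)" shows "L2_fun (\<lambda>x. \<Sum>k\<in>S. f k x)"
  using assms by (induction S rule: infinite_finite_induct) (auto intro: L2_fun_zero L2_fun_add)

lemma L2_fun_cmult: 
  fixes f :: "real^'d \<Rightarrow> complex"
  assumes "L2_fun f" shows "L2_fun (\<lambda>x. c * f x)"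
  using assms L2_fun_measurable[OF assms] by (intro L2_fun_bound[OF assms, of _ "norm c"]) (auto simp: norm_mult)

lemma norm_smult_vec: "norm (c *s (v::complex^'d)) = norm c * norm v"
  by (simp add: norm_vec_def norm_mult L2_set_right_distrib)

lemma L2_fun_smult:
  fixes f :: "real^'d \<Rightarrow> complex^'e"
  assumes "L2_fun f" shows "L2_fun (\<lambda>x. c *s f x)"
proof (rule L2_fun_bound[OF assms, of _ "norm c"])
  note [measurable] = L2_fun_measurable[OF assms]
  show "(\<lambda>x. c *s f x) \<in> borel_measurable borel" unfolding vector_scalar_mult_def by measurable
qed (simp add: norm_smult_vec)

lemma L2_fun_nth: "L2_fun g \<Longrightarrow> L2_fun (\<lambda>x. g x $ i)"
  for g :: "real^'d \<Rightarrow> complex^'e"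
  by (rule L2_fun_bound[where C=1]) (auto simp: L2_fun_measurable intro!: borel_measurable_nth Finite_Cartesian_Product.norm_nth_le)

lemma L2_fun_translate:
  assumes "L2_fun f" shows "L2_fun (\<lambda>x. f (t + x))"
proof -
  note [measurable] = L2_fun_measurable[OF assms]
  have "integrable lborel (\<lambda>x. (norm (f (t + x)))\<^sup>2)"
    using integrable_translate[of "\<lambda>x. (norm (f x))\<^sup>2" t] L2_fun_integrable[OF assms] by simp
  then show ?thesis by (simp add: L2_fun_def)
qed

lemma integrable_bounded_cbox_support:
  fixes f :: "real^'d \<Rightarrow> 'b::euclidean_space"
  assumes "f \<in> borel_measurable borel" "\<And>x. norm (f x) \<le> B" "\<And>x. x \<notin> cbox a b \<Longrightarrow> f x = 0"
  shows "integrable lborel f"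
proof (rule Bochner_Integration.integrable_bound[of _ "\<lambda>x. B * indicator (cbox a b) x"])
  show "integrable lborel (\<lambda>x. B * indicator (cbox a b) x :: real)"
    by (intro integrable_mult_right integrable_real_indicator emeasure_lborel_cbox_finite) simp
  show "AE x in lborel. norm (f x) \<le> norm (B * indicator (cbox a b) x :: real)"
    using assms(2,3) by (intro AE_I2) (auto simp: indicator_def intro: order_trans[OF _ abs_ge_self])
qed (use assms in simp)

lemma L2_fun_bounded_cbox_support:
  fixes f :: "real^'d \<Rightarrow> 'b::euclidean_space"
  assumes "f \<in> borel_measurable borel" "\<And>x. norm (f x) \<le> B" "\<And>x. x \<notin> cbox a b \<Longrightarrow> f x = 0"
  shows "L2_fun f"
proof -
  have "integrable lborel (\<lambda>x. (norm (f x))\<^sup>2)"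
    using assms power_mono[OF assms(2) norm_ge_zero, where n=2]
    by (intro integrable_bounded_cbox_support[of _ "B\<^sup>2" a b]) auto
  then show ?thesis using assms by (simp add: L2_fun_def)
qed

lemma test_function_measurable: "test_function \<phi> \<Longrightarrow> \<phi> \<in> borel_measurable borel"
  by (intro borel_measurable_continuous_onI test_function_continuous)

lemma partial_deriv_measurable: "test_function \<phi> \<Longrightarrow> partial_deriv i \<phi> \<in> borel_measurable borel"
  by (intro borel_measurable_continuous_onI partial_deriv_continuous)

lemma
  assumes "test_function \<phi>"
  shows L2_fun_test_function: "L2_fun \<phi>" and L2_fun_partial_deriv: "L2_fun (partial_deriv i \<phi>)"
    and integrable_test_function: "integrable lborel \<phi>"
proof -
  obtain a b B where B: "\<And>x. \<bar>\<phi> x\<bar> \<le> B" "\<And>i x. \<bar>partial_deriv i \<phi> x\<bar> \<le> B"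
    "\<And>x. x \<notin> cbox a b \<Longrightarrow> \<phi> x = 0" "\<And>i x. x \<notin> cbox a b \<Longrightarrow> partial_deriv i \<phi> x = 0"
    by (rule test_function_bounds[OF assms]) blast
  show "L2_fun \<phi>"
    by (rule L2_fun_bounded_cbox_support[of _ B a b]) (use B assms in \<open>auto intro: test_function_measurable\<close>)
  show "L2_fun (partial_deriv i \<phi>)"
    by (rule L2_fun_bounded_cbox_support[of _ B a b]) (use B assms in \<open>auto intro: partial_deriv_measurable\<close>)
  show "integrable lborel \<phi>"
    by (rule integrable_bounded_cbox_support[of _ B a b]) (use B assms in \<open>auto intro: test_function_measurable\<close>)
qed

lemma L2_scaleR_integrable:
  fixes f :: "real^'d \<Rightarrow> 'b::euclidean_space"
  assumes "L2_fun \<phi>" "L2_fun f" shows "integrable lborel (\<lambda>x. \<phi> x *\<^sub>R f x)"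
  using assms L2_fun_measurable[OF assms(1)] L2_fun_measurable[OF assms(2)]
  by (intro L2_mult_integrable[OF assms]) auto

lemma L2_integrable_cbox:
  fixes f :: "real^'d \<Rightarrow> 'b::euclidean_space"
  assumes "L2_fun f" shows "set_integrable lborel (cbox a b) f"
proof -
  have "L2_fun (indicator (cbox a b) :: real^'d \<Rightarrow> real)"
    by (rule L2_fun_bounded_cbox_support[of _ 1 a b]) auto
  then show ?thesis unfolding set_integrable_def using assms by (rule L2_scaleR_integrable)
qed

lemma negligible_imp_AE: "negligible N \<Longrightarrow> AE x in lborel. x \<notin> N"
  by (metis AE_completion_iff AE_not_in negligible_iff_null_sets)

text \<open>Lebesgue points of \<open>f\<close>, with the averages taken over cubes having \<open>x\<close> as a corner.\<close>

lemma AE_zero_of_bump_integrals: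
  fixes f :: "real^'d \<Rightarrow> complex"
  assumes f: "L2_fun f" and z: "\<And>a b s. s > 0 \<Longrightarrow> (LINT x|lborel. bump a b s x *\<^sub>R f x) = 0"
  shows "AE x in lborel. f x = 0"
proof -
  note [measurable] = L2_fun_measurable[OF f]
  have box: "(LINT x:box a b|lborel. f x) = 0" for a b
  proof -
    \<comment> \<open>As the slope \<open>s\<close> grows, the bumps converge to the indicator of
      the open box, so the hypothesis passes to integrals over boxes.\<close>
    have "(\<lambda>n. LINT x|lborel. bump a b (real (Suc n)) x *\<^sub>R f x) \<longlonglongrightarrow> (LINT x|lborel. indicator (box a b) x *\<^sub>R f x)"
    proof (rule integral_dominated_convergence)
      show "integrable lborel (\<lambda>x. norm (indicator (cbox a b) x *\<^sub>R f x))"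
        using L2_integrable_cbox[OF f] unfolding set_integrable_def by (rule integrable_norm)
      show "AE x in lborel. (\<lambda>n. bump a b (real (Suc n)) x *\<^sub>R f x) \<longlonglongrightarrow> indicator (box a b) x *\<^sub>R f x"
      proof (rule AE_I2)
        fix x
        have "(\<lambda>n. bump a b (real (Suc n)) x) \<longlonglongrightarrow> indicator (box a b) x"
        proof (cases "x \<in> box a b")
          case True
          have lim: "(\<lambda>n. flat_exp 0 (real (Suc n) * c)) \<longlonglongrightarrow> 1" if "c > 0" for c
          proof -
            have "(\<lambda>n. 1 / (c * real (Suc n))) \<longlonglongrightarrow> 0"
              using tendsto_mult_right_zero[OF LIMSEQ_inverse_real_of_nat, of "1/c"] by (simp add: inverse_eq_divide)
            then have "(\<lambda>n. exp (- (1 / (c * real (Suc n))))) \<longlonglongrightarrow> exp (- 0)"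
              by (intro tendsto_intros)
            moreover have "exp (- (1 / (c * real (Suc n)))) = flat_exp 0 (real (Suc n) * c)" for n
              using that by (simp add: flat_exp_def mult.commute zero_less_mult_iff)
            ultimately show ?thesis by simp
          qed
          have "(\<lambda>n. bump a b (real (Suc n)) x) \<longlonglongrightarrow> (\<Prod>i\<in>(UNIV::'d set). 1 * 1)"
            unfolding bump_def using True by (intro tendsto_prod tendsto_mult lim) (auto simp: mem_box_cart)
          then show ?thesis using True by simp
        next
          case False
          then show ?thesis by (simp add: bump_eq_0)
        qed
        then show "(\<lambda>n. bump a b (real (Suc n)) x *\<^sub>R f x) \<longlonglongrightarrow> indicator (box a b) x *\<^sub>R f x"
          by (intro tendsto_intros)
      qed
      show "AE x in lborel. norm (bump a b (real (Suc n)) x *\<^sub>R f x) \<le> norm (indicator (cbox a b) x *\<^sub>R f x)" for n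
      proof (rule AE_I2)
        fix x
        show "norm (bump a b (real (Suc n)) x *\<^sub>R f x) \<le> norm (indicator (cbox a b) x *\<^sub>R f x)"
          using bump_eq_0[of "real (Suc n)" x a b] bump_nonneg[of a b "real (Suc n)" x] bump_le_1[of a b "real (Suc n)" x]
            box_subset_cbox[of a b]
          by (cases "x \<in> cbox a b"; cases "x \<in> box a b") (auto intro!: mult_left_le_one_le)
      qed
      show "(\<lambda>x. bump a b (real (Suc n)) x *\<^sub>R f x) \<in> borel_measurable lborel" for n
        using test_function_measurable[OF test_function_bump, of "real (Suc n)" a b] by simp
    qed simp
    then have "(\<lambda>n. 0) \<longlonglongrightarrow> (LINT x|lborel. indicator (box a b) x *\<^sub>R f x)" by (simp add: z)
    then show ?thesis unfolding set_lebesgue_integral_def using LIMSEQ_unique tendsto_const by blast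
  qed
  have cb: "integral (cbox a b) f = 0" for a b
  proof -
    have "set_integrable lborel (box a b) f"
      by (rule set_integrable_subset[OF L2_integrable_cbox[OF f, of a b]]) (auto simp: box_subset_cbox)
    then have "(LINT x:box a b|lborel. f x) = integral (box a b) f"
      by (rule set_borel_integral_eq_integral)
    then show ?thesis using box integral_open_interval[of a b f] by simp
  qed
  have "f integrable_on cbox a b" for a b
    by (intro set_borel_integral_eq_integral L2_integrable_cbox f)
  then obtain N where N: "negligible N" and e: "\<And>x e. \<lbrakk>x \<notin> N; 0 < e\<rbrakk> \<Longrightarrow>
      \<exists>d>0. \<forall>h. 0 < h \<and> h < d \<longrightarrow> norm (integral (cbox x (x + h *\<^sub>R One)) f /\<^sub>R h ^ DIM(real^'d) - f x) < e"
    by (rule integrable_ccontinuous_explicit) blast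
  have "f x = 0" if nN: "x \<notin> N" for x
  proof (rule ccontr)
    assume "f x \<noteq> 0"
    then obtain d where "d > 0" "\<And>h. 0 < h \<and> h < d \<Longrightarrow> norm (integral (cbox x (x + h *\<^sub>R One)) f /\<^sub>R h ^ DIM(real^'d) - f x) < norm (f x)"
      using e[OF nN, of "norm (f x)"] by auto
    from this(2)[of "d / 2"] this(1) show False by (simp add: cb)
  qed
  then show ?thesis using negligible_imp_AE[OF N] by (auto elim: eventually_mono)
qed

subsection \<open>Weak gradients\<close>

text \<open>Carrying an explicit gradient along with the function allows linear combinations,
  translates and cutoffs to be computed without touching the choice operator in
  \<open>weak_gradient\<close>.\<close>

definition grad_pair :: "(real^'d \<Rightarrow> complex) \<Rightarrow> (real^'d \<Rightarrow> complex^'d) \<Rightarrow> bool" where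
  "grad_pair u g \<longleftrightarrow> L2_fun u \<and> L2_fun g \<and> has_weak_gradient u g"

lemma grad_pair_L2: "grad_pair u g \<Longrightarrow> L2_fun u" "grad_pair u g \<Longrightarrow> L2_fun g"
  by (auto simp: grad_pair_def)

lemma H1_iff: "u \<in> H1 \<longleftrightarrow> (\<exists>g. grad_pair u g)"
  by (auto simp: H1_def grad_pair_def)

lemma grad_pairD:
  assumes "grad_pair u g" "test_function \<phi>"
  shows "(LINT x|lborel. partial_deriv i \<phi> x *\<^sub>R u x) = - (LINT x|lborel. \<phi> x *\<^sub>R (g x $ i))"
  using assms by (auto simp: grad_pair_def has_weak_gradient_def)

lemma grad_pair_integrable:
  assumes "grad_pair u g" "test_function \<phi>"
  shows "integrable lborel (\<lambda>x. \<phi> x *\<^sub>R u x)" "integrable lborel (\<lambda>x. partial_deriv i \<phi> x *\<^sub>R u x)"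
    "integrable lborel (\<lambda>x. \<phi> x *\<^sub>R (g x $ i))"
  using grad_pair_L2[OF assms(1)] L2_fun_nth[OF grad_pair_L2(2)[OF assms(1)]]
    L2_fun_test_function[OF assms(2)] L2_fun_partial_deriv[OF assms(2)]
  by (auto intro: L2_scaleR_integrable)

text \<open>Two weak gradients have equal integrals against every bump, so the fundamental lemma
  \<open>AE_zero_of_bump_integrals\<close> applies to each component of their difference.\<close>

lemma grad_pair_unique:
  assumes "grad_pair u g" "grad_pair u g'"
  shows "AE x in lborel. g x = g' x"
proof -
  have "AE x in lborel. g x $ i - g' x $ i = 0" for i
  proof (rule AE_zero_of_bump_integrals)
    have "L2_fun (\<lambda>x. g x $ i + (-1) * (g' x $ i))"
      using grad_pair_L2 assms by (intro L2_fun_add L2_fun_cmult L2_fun_nth) auto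
    then show "L2_fun (\<lambda>x. g x $ i - g' x $ i)" by simp
  next
    fix a b :: "real^'a" and s :: real assume "s > 0"
    then have t: "test_function (bump a b s)" by (rule test_function_bump)
    show "(LINT x|lborel. bump a b s x *\<^sub>R (g x $ i - g' x $ i)) = 0"
      using grad_pairD[OF assms(1) t, of i] grad_pairD[OF assms(2) t, of i]
        grad_pair_integrable[OF assms(1) t] grad_pair_integrable[OF assms(2) t]
      by (simp add: scaleR_diff_right)
  qed
  then have "AE x in lborel. \<forall>i\<in>UNIV. g x $ i - g' x $ i = 0"
    by (intro AE_finite_allI) auto
  then show ?thesis by (rule AE_mp) (auto simp: vec_eq_iff)
qed

text \<open>This eliminates the choice operator: by uniqueness up to null sets, a kinetic energy may
  be computed from any explicit gradient.\<close>

lemma kinetic_eq: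
  assumes "grad_pair u g" shows "kinetic u = (LINT x|lborel. (norm (g x))\<^sup>2)"
proof -
  have "L2_fun (weak_gradient u) \<and> has_weak_gradient u (weak_gradient u)"
    unfolding weak_gradient_def by (rule someI[of _ g]) (use assms in \<open>auto simp: grad_pair_def\<close>)
  then have w: "grad_pair u (weak_gradient u)" using assms by (auto simp: grad_pair_def)
  note [measurable] = L2_fun_measurable[OF grad_pair_L2(2)[OF w]] L2_fun_measurable[OF grad_pair_L2(2)[OF assms]]
  show ?thesis unfolding kinetic_def
    by (rule integral_cong_AE) (use grad_pair_unique[OF w assms] in auto)
qed

lemma grad_pair_weak_gradient: "u \<in> H1 \<Longrightarrow> grad_pair u (weak_gradient u)"
  unfolding weak_gradient_def H1_def grad_pair_def by simp (metis (mono_tags, lifting) someI_ex)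

lemma kinetic_nonneg: "0 \<le> kinetic u"
  by (simp add: kinetic_def)

lemma grad_pair_zero: "grad_pair (\<lambda>x. 0) (\<lambda>x. 0)"
  by (auto simp: grad_pair_def has_weak_gradient_def L2_fun_zero)

lemma grad_pair_add:
  assumes "grad_pair u g" "grad_pair v h"
  shows "grad_pair (\<lambda>x. u x + v x) (\<lambda>x. g x + h x)"
proof -
  have "(LINT x|lborel. partial_deriv i \<phi> x *\<^sub>R (u x + v x)) = - (LINT x|lborel. \<phi> x *\<^sub>R ((g x + h x) $ i))"
    if t: "test_function \<phi>" for \<phi> i
    using grad_pairD[OF assms(1) t, of i] grad_pairD[OF assms(2) t, of i]
      grad_pair_integrable[OF assms(1) t] grad_pair_integrable[OF assms(2) t]
    by (simp add: scaleR_add_right)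
  then show ?thesis using assms by (auto simp: grad_pair_def has_weak_gradient_def intro: L2_fun_add)
qed

lemma grad_pair_cmult:
  assumes "grad_pair u g"
  shows "grad_pair (\<lambda>x. c * u x) (\<lambda>x. c *s g x)"
proof -
  have "(LINT x|lborel. partial_deriv i \<phi> x *\<^sub>R (c * u x)) = - (LINT x|lborel. \<phi> x *\<^sub>R ((c *s g x) $ i))"
    if t: "test_function \<phi>" for \<phi> i
  proof -
    have "(LINT x|lborel. c * (partial_deriv i \<phi> x *\<^sub>R u x)) = - (LINT x|lborel. c * (\<phi> x *\<^sub>R (g x $ i)))"
      using grad_pairD[OF assms(1) t, of i] by (simp only: integral_mult_right_zero) simp
    then show ?thesis by (simp only: mult_scaleR_right vector_smult_component)
  qed
  then show ?thesis using assms by (auto simp: grad_pair_def has_weak_gradient_def intro: L2_fun_cmult L2_fun_smult)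
qed

lemma grad_pair_sum:
  assumes "\<And>k. k \<in> S \<Longrightarrow> grad_pair (u k) (g k)"
  shows "grad_pair (\<lambda>x. \<Sum>k\<in>S. c k * u k x) (\<lambda>x. \<Sum>k\<in>S. c k *s g k x)"
  using assms
proof (induction S rule: infinite_finite_induct)
  case (insert k S)
  have "grad_pair (\<lambda>x. c k * u k x + (\<Sum>k\<in>S. c k * u k x)) (\<lambda>x. c k *s g k x + (\<Sum>k\<in>S. c k *s g k x))"
    by (rule grad_pair_add[OF grad_pair_cmult]) (use insert in auto)
  then show ?case using insert by simp
qed (auto intro: grad_pair_zero)

lemma has_derivative_translate:
  assumes "\<And>x. (f has_derivative f' x) (at x)"
  shows "((\<lambda>x. f (t + x)) has_derivative f' (t + x)) (at x)"
  by (rule has_derivative_compose[where f="\<lambda>x. t + x" and g=f and g'="f' (t + x)" and f'="\<lambda>h. h", OF _ assms])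
    (auto intro!: derivative_eq_intros)

lemma C_k_translate: "C_k k f \<Longrightarrow> C_k k (\<lambda>x. f (t + x))"
  and partial_deriv_translate: "(\<And>x. f differentiable (at x)) \<Longrightarrow> partial_deriv i (\<lambda>x. f (t + x)) = (\<lambda>x. partial_deriv i f (t + x))"
proof -
  have p: "(\<And>x. f differentiable (at x)) \<Longrightarrow> partial_deriv i (\<lambda>x. f (t + x)) = (\<lambda>x. partial_deriv i f (t + x))" for f i
  proof
    fix x assume "\<And>x. f differentiable (at x)"
    then have "\<And>x. (f has_derivative frechet_derivative f (at x)) (at x)" by (simp add: frechet_derivative_works)
    from partial_deriv_eq[OF has_derivative_translate[OF this]]
    show "partial_deriv i (\<lambda>x. f (t + x)) x = partial_deriv i f (t + x)" by (simp add: partial_deriv_def)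
  qed
  then show "(\<And>x. f differentiable (at x)) \<Longrightarrow> partial_deriv i (\<lambda>x. f (t + x)) = (\<lambda>x. partial_deriv i f (t + x))" by blast
  show "C_k k f \<Longrightarrow> C_k k (\<lambda>x. f (t + x))"
  proof (induction k arbitrary: f)
    case 0
    then show ?case by (auto intro!: continuous_on_compose2[of UNIV f] continuous_intros)
  next
    case (Suc k)
    then have d: "\<And>x. f differentiable (at x)" by simp
    then have "(\<lambda>x. f (t + x)) differentiable (at x)" for x
      using has_derivative_translate[of f "\<lambda>x. frechet_derivative f (at x)" t x] differentiable_def
      by (metis frechet_derivative_works)
    then show ?case using Suc p[OF d] by simp
  qed
qed

lemma test_function_translate:
  assumes "test_function \<phi>" shows "test_function (\<lambda>x. \<phi> (t + x))"
proof -
  obtain a b where s: "\<And>x. x \<notin> cbox a b \<Longrightarrow> \<phi> x = 0"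
    by (rule test_function_support[OF assms]) blast
  show ?thesis
    by (rule test_functionI[of _ "a - t" "b - t"], intro C_k_translate test_function_C_k[OF assms])
      (rule s, auto simp: mem_box_cart algebra_simps)
qed

lemma test_function_differentiable: "test_function \<phi> \<Longrightarrow> \<phi> differentiable (at x)"
  using test_function_C_k[of \<phi> "Suc 0"] by simp

lemma grad_pair_translate:
  assumes "grad_pair u g"
  shows "grad_pair (\<lambda>x. u (t + x)) (\<lambda>x. g (t + x))"
proof -
  note [measurable] = L2_fun_measurable[OF grad_pair_L2(1)[OF assms]] L2_fun_measurable[OF grad_pair_L2(2)[OF assms]]
  have "(LINT x|lborel. partial_deriv i \<phi> x *\<^sub>R u (t + x)) = - (LINT x|lborel. \<phi> x *\<^sub>R (g (t + x) $ i))"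
    if tf: "test_function \<phi>" for \<phi> i
  proof -
    define \<psi> where "\<psi> = (\<lambda>x. \<phi> (- t + x))"
    have \<psi>: "test_function \<psi>" "partial_deriv i \<psi> = (\<lambda>x. partial_deriv i \<phi> (- t + x))"
      unfolding \<psi>_def using tf
      by (simp_all only: test_function_translate partial_deriv_translate test_function_differentiable)
    note [measurable] = test_function_measurable[OF \<psi>(1)] partial_deriv_measurable[OF \<psi>(1)]
    show ?thesis
      using integral_translate[of "\<lambda>x. partial_deriv i \<psi> x *\<^sub>R u x" t, OF borel_measurable_scaleR]
        integral_translate[of "\<lambda>x. \<psi> x *\<^sub>R (g x $ i)" t, OF borel_measurable_scaleR]
        grad_pairD[OF assms \<psi>(1), of i] partial_deriv_measurable[OF \<psi>(1), of i]
      by (simp add: \<psi>(2)) (simp add: \<psi>_def)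
  qed
  then show ?thesis using assms by (auto simp: grad_pair_def has_weak_gradient_def intro: L2_fun_translate)
qed

lemma partial_deriv_mult:
  assumes "f differentiable (at x)" "g differentiable (at x)"
  shows "partial_deriv i (\<lambda>x. f x * g x) x = f x * partial_deriv i g x + partial_deriv i f x * g x"
proof -
  have "((\<lambda>x. f x * g x) has_derivative (\<lambda>h. f x * frechet_derivative g (at x) h + frechet_derivative f (at x) h * g x)) (at x)"
    using assms by (intro has_derivative_mult) (auto simp: frechet_derivative_works)
  from partial_deriv_eq[OF this] show ?thesis by (simp add: partial_deriv_def)
qed

lemma L2_fun_scaleR_bounded:
  fixes f :: "real^'d \<Rightarrow> 'b::euclidean_space"
  assumes "\<eta> \<in> borel_measurable borel" "\<And>x. \<bar>\<eta> x\<bar> \<le> B" "L2_fun f"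
  shows "L2_fun (\<lambda>x. \<eta> x *\<^sub>R f x)"
  using assms L2_fun_measurable[OF assms(3)]
  by (intro L2_fun_bound[OF assms(3), of _ B]) (auto intro: mult_right_mono)

definition cutoff_gradient ::
    "(real^'d \<Rightarrow> real) \<Rightarrow> (real^'d \<Rightarrow> complex) \<Rightarrow> (real^'d \<Rightarrow> complex^'d) \<Rightarrow> real^'d \<Rightarrow> complex^'d" where
  "cutoff_gradient \<eta> u g x = \<eta> x *\<^sub>R g x + (\<chi> i. partial_deriv i \<eta> x *\<^sub>R u x)"

text \<open>The product \<open>\<phi> * \<eta>\<close> of two test functions is again one; testing
  the gradient of \<open>u\<close> against it yields the product rule.\<close>

lemma grad_pair_cutoff:
  assumes "grad_pair u g" "test_function \<eta>"
  shows "grad_pair (\<lambda>x. \<eta> x *\<^sub>R u x) (cutoff_gradient \<eta> u g)"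
proof -
  obtain a b B where B: "B > 0" "\<And>x. \<bar>\<eta> x\<bar> \<le> B" "\<And>i x. \<bar>partial_deriv i \<eta> x\<bar> \<le> B"
    by (rule test_function_bounds[OF assms(2)]) blast
  note m = test_function_measurable[OF assms(2)] partial_deriv_measurable[OF assms(2)]
  note L = grad_pair_L2[OF assms(1)]
  note [measurable] = L2_fun_measurable[OF L(1)] L2_fun_measurable[OF L(2)] m
  have u: "L2_fun (\<lambda>x. \<eta> x *\<^sub>R u x)" by (rule L2_fun_scaleR_bounded[OF m(1) B(2) L(1)])
  have "L2_fun (\<lambda>x. (\<chi> i. partial_deriv i \<eta> x *\<^sub>R u x))"
  proof (rule L2_fun_bound[OF L(1), of _ "real CARD('a) * B"])
    fix x
    have "norm (\<chi> i. partial_deriv i \<eta> x *\<^sub>R u x) \<le> (\<Sum>i\<in>UNIV. norm (partial_deriv i \<eta> x *\<^sub>R u x))"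
      using L2_set_le_sum[of UNIV "\<lambda>i. norm (partial_deriv i \<eta> x *\<^sub>R u x)"] by (simp add: norm_vec_def)
    also have "\<dots> \<le> (\<Sum>i\<in>(UNIV::'a set). B * norm (u x))"
      using B(3) by (intro sum_mono) (auto intro: mult_right_mono)
    finally show "norm (\<chi> i. partial_deriv i \<eta> x *\<^sub>R u x) \<le> real CARD('a) * B * norm (u x)" by simp
  qed simp
  then have g: "L2_fun (cutoff_gradient \<eta> u g)"
    unfolding cutoff_gradient_def by (intro L2_fun_add L2_fun_scaleR_bounded[OF m(1) B(2) L(2)])
  have "(LINT x|lborel. partial_deriv i \<phi> x *\<^sub>R (\<eta> x *\<^sub>R u x)) = - (LINT x|lborel. \<phi> x *\<^sub>R (cutoff_gradient \<eta> u g x $ i))"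
    if t: "test_function \<phi>" for \<phi> i
  proof -
    define \<psi> where "\<psi> = (\<lambda>x. \<phi> x * \<eta> x)"
    have \<psi>: "test_function \<psi>" unfolding \<psi>_def
      by (rule test_function_mult[OF assms(2) test_function_C_k[OF t]])
    have p: "partial_deriv i \<psi> x = \<phi> x * partial_deriv i \<eta> x + partial_deriv i \<phi> x * \<eta> x" for x
      unfolding \<psi>_def by (intro partial_deriv_mult test_function_differentiable t assms)
    have "integrable lborel (\<lambda>x. \<phi> x *\<^sub>R (partial_deriv i \<eta> x *\<^sub>R u x))"
      by (intro L2_scaleR_integrable L2_fun_test_function t L2_fun_scaleR_bounded[OF m(2) B(3) L(1)])
    moreover have "integrable lborel (\<lambda>x. partial_deriv i \<phi> x *\<^sub>R (\<eta> x *\<^sub>R u x))"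
      by (intro L2_scaleR_integrable L2_fun_partial_deriv t u)
    moreover have "integrable lborel (\<lambda>x. \<phi> x *\<^sub>R (\<eta> x *\<^sub>R g x $ i))"
      by (intro L2_scaleR_integrable L2_fun_test_function t L2_fun_scaleR_bounded[OF m(1) B(2)] L2_fun_nth L(2))
    ultimately show ?thesis using grad_pairD[OF assms(1) \<psi>, of i]
      by (simp add: p cutoff_gradient_def scaleR_add_right scaleR_add_left) (simp add: \<psi>_def algebra_simps eq_diff_eq)
  qed
  then show ?thesis using u g by (auto simp: grad_pair_def has_weak_gradient_def)
qed

lemma test_function_line_deriv:
  assumes "test_function \<phi>"
  shows "((\<lambda>t. \<phi> (x + t *\<^sub>R axis i 1)) has_real_derivative partial_deriv i \<phi> (x + t *\<^sub>R axis i 1)) (at t)"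
proof -
  let ?l = "\<lambda>t. x + t *\<^sub>R axis i (1::real)"
  have "((\<lambda>t. \<phi> (?l t)) has_derivative (\<lambda>h. \<Sum>j\<in>UNIV. (h *\<^sub>R axis i 1 :: real^'a) $ j * partial_deriv j \<phi> (?l t))) (at t)"
    by (rule has_derivative_compose[OF _ test_function_has_derivative[OF assms]])
      (auto intro!: derivative_eq_intros)
  moreover have "(\<Sum>j\<in>UNIV. (h *\<^sub>R axis i 1 :: real^'a) $ j * partial_deriv j \<phi> y) = partial_deriv i \<phi> y * h" for h y
  proof -
    have "(\<Sum>j\<in>UNIV. (h *\<^sub>R axis i 1 :: real^'a) $ j * partial_deriv j \<phi> y) = (\<Sum>j\<in>UNIV. if j = i then h * partial_deriv i \<phi> y else 0)"
      by (intro sum.cong) (auto simp: axis_def)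
    then show ?thesis by (simp add: mult.commute)
  qed
  ultimately show ?thesis by (simp add: has_field_derivative_def)
qed

text \<open>Difference quotients are moved between the factors by translation invariance, which
  avoids integrating by parts along lines.\<close>

lemma grad_pair_lipschitz:
  assumes u: "L2_fun u" "integrable lborel u" and g: "L2_fun g"
    and lip: "\<And>i x h. norm (u (x + h *\<^sub>R axis i 1) - u x) \<le> C * \<bar>h\<bar>"
    and deriv: "\<And>i. AE x in lborel. ((\<lambda>h. (u (x + h *\<^sub>R axis i 1) - u x) /\<^sub>R h) \<longlongrightarrow> g x $ i) (at 0)"
  shows "grad_pair u g"
proof -
  note [measurable] = L2_fun_measurable[OF u(1)] L2_fun_measurable[OF g]
  have "(LINT x|lborel. partial_deriv i \<phi> x *\<^sub>R u x) = - (LINT x|lborel. \<phi> x *\<^sub>R (g x $ i))"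
    if t: "test_function \<phi>" for \<phi> i
  proof -
    note [measurable] = test_function_measurable[OF t] partial_deriv_measurable[OF t]
    define e where "e = (axis i 1 :: real^'a)"
    define h where "h n = inverse (real (Suc n))" for n
    have h: "h n > 0" "h n \<noteq> 0" for n by (auto simp: h_def)
    have hlim: "h \<longlonglongrightarrow> 0" unfolding h_def by (rule LIMSEQ_inverse_real_of_nat)
    then have hat: "filterlim h (at 0) sequentially" using h(2) by (auto simp: filterlim_at)
    have mhat: "filterlim (\<lambda>n. - h n) (at 0) sequentially"
      using h(2) tendsto_minus[OF hlim] by (auto simp: filterlim_at)
    obtain a b B where B: "B > 0" "\<And>x. \<bar>\<phi> x\<bar> \<le> B" "\<And>i x. \<bar>partial_deriv i \<phi> x\<bar> \<le> B"
      by (rule test_function_bounds[OF t]) blast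
    have lhs: "(\<lambda>n. LINT x|lborel. ((\<phi> (x + h n *\<^sub>R e) - \<phi> x) / h n) *\<^sub>R u x) \<longlonglongrightarrow> (LINT x|lborel. partial_deriv i \<phi> x *\<^sub>R u x)"
    proof (rule integral_dominated_convergence[where w="\<lambda>x. B * norm (u x)"])
      show "AE x in lborel. (\<lambda>n. ((\<phi> (x + h n *\<^sub>R e) - \<phi> x) / h n) *\<^sub>R u x) \<longlonglongrightarrow> partial_deriv i \<phi> x *\<^sub>R u x"
      proof (rule AE_I2)
        fix x
        have "((\<lambda>k. (\<phi> (x + k *\<^sub>R e) - \<phi> x) / k) \<longlongrightarrow> partial_deriv i \<phi> x) (at 0)"
          using test_function_line_deriv[OF t, of x i 0] by (simp add: DERIV_def e_def)
        from filterlim_compose[OF this hat]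
        show "(\<lambda>n. ((\<phi> (x + h n *\<^sub>R e) - \<phi> x) / h n) *\<^sub>R u x) \<longlonglongrightarrow> partial_deriv i \<phi> x *\<^sub>R u x"
          by (intro tendsto_scaleR tendsto_const)
      qed
      show "AE x in lborel. norm (((\<phi> (x + h n *\<^sub>R e) - \<phi> x) / h n) *\<^sub>R u x) \<le> B * norm (u x)" for n
      proof (rule AE_I2)
        fix x
        have "norm (\<phi> (x + h n *\<^sub>R e) - \<phi> (x + 0 *\<^sub>R e)) \<le> B * norm (h n - 0)"
          unfolding e_def
          by (rule field_differentiable_bound[of UNIV "\<lambda>k. \<phi> (x + k *\<^sub>R axis i 1)" "\<lambda>k. partial_deriv i \<phi> (x + k *\<^sub>R axis i 1)"])
            (auto simp: B(3) test_function_line_deriv[OF t])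
        then have "\<bar>(\<phi> (x + h n *\<^sub>R e) - \<phi> x) / h n\<bar> \<le> B" using h(1)[of n] by (simp add: field_simps)
        then show "norm (((\<phi> (x + h n *\<^sub>R e) - \<phi> x) / h n) *\<^sub>R u x) \<le> B * norm (u x)"
          by (simp only: norm_scaleR) (intro mult_right_mono norm_ge_zero)
      qed
    qed (use u in auto)
    \<comment> \<open>A forward quotient of \<open>\<phi>\<close> becomes a backward quotient of
      \<open>u\<close> after the change of variable, hence the increments \<open>- h n\<close>. The
      Lipschitz bound on \<open>u\<close> and the integrability of \<open>\<phi>\<close> give the
      dominating function.\<close>
    have rhs: "(\<lambda>n. LINT x|lborel. \<phi> x *\<^sub>R ((u (x + (- h n) *\<^sub>R e) - u x) /\<^sub>R h n)) \<longlonglongrightarrow> (LINT x|lborel. - (\<phi> x *\<^sub>R (g x $ i)))"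
    proof (rule integral_dominated_convergence[where w="\<lambda>x. \<bar>\<phi> x\<bar> * C"])
      show "AE x in lborel. (\<lambda>n. \<phi> x *\<^sub>R ((u (x + (- h n) *\<^sub>R e) - u x) /\<^sub>R h n)) \<longlonglongrightarrow> - (\<phi> x *\<^sub>R (g x $ i))"
        using deriv[of i]
      proof (rule AE_mp, intro AE_I2 impI)
        fix x assume "((\<lambda>k. (u (x + k *\<^sub>R axis i 1) - u x) /\<^sub>R k) \<longlongrightarrow> g x $ i) (at 0)"
        then have "((\<lambda>k. (u (x + k *\<^sub>R e) - u x) /\<^sub>R k) \<longlongrightarrow> g x $ i) (at 0)"
          by (simp add: e_def)
        from filterlim_compose[OF this mhat]
        have "(\<lambda>n. \<phi> x *\<^sub>R (- ((u (x + (- h n) *\<^sub>R e) - u x) /\<^sub>R (- h n)))) \<longlonglongrightarrow> \<phi> x *\<^sub>R (- (g x $ i))"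
          by (intro tendsto_scaleR tendsto_const tendsto_minus)
        then show "(\<lambda>n. \<phi> x *\<^sub>R ((u (x + (- h n) *\<^sub>R e) - u x) /\<^sub>R h n)) \<longlonglongrightarrow> - (\<phi> x *\<^sub>R (g x $ i))"
          by simp
      qed
      show "AE x in lborel. norm (\<phi> x *\<^sub>R ((u (x + (- h n) *\<^sub>R e) - u x) /\<^sub>R h n)) \<le> \<bar>\<phi> x\<bar> * C" for n
      proof (rule AE_I2)
        fix x
        have "norm (u (x + (- h n) *\<^sub>R e) - u x) \<le> C * h n"
          using lip[of x "- h n" i] h(1)[of n] by (simp add: e_def)
        then have "norm ((u (x + (- h n) *\<^sub>R e) - u x) /\<^sub>R h n) \<le> C"
          unfolding norm_scaleR using h(1)[of n] by (simp add: field_simps)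
        then show "norm (\<phi> x *\<^sub>R ((u (x + (- h n) *\<^sub>R e) - u x) /\<^sub>R h n)) \<le> \<bar>\<phi> x\<bar> * C"
          by (simp only: norm_scaleR real_norm_def) (intro mult_left_mono, simp_all)
      qed
      show "integrable lborel (\<lambda>x. \<bar>\<phi> x\<bar> * C)" using integrable_test_function[OF t] by simp
    qed auto
    have eq: "(LINT x|lborel. ((\<phi> (x + h n *\<^sub>R e) - \<phi> x) / h n) *\<^sub>R u x) = (LINT x|lborel. \<phi> x *\<^sub>R ((u (x + (- h n) *\<^sub>R e) - u x) /\<^sub>R h n))" for n
    proof -
      have ti: "test_function (\<lambda>x. \<phi> (h n *\<^sub>R e + x))" by (rule test_function_translate[OF t])
      have i1: "integrable lborel (\<lambda>x. \<phi> (h n *\<^sub>R e + x) *\<^sub>R u x)" "integrable lborel (\<lambda>x. \<phi> x *\<^sub>R u x)"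
        by (intro L2_scaleR_integrable L2_fun_test_function u ti t)+
      have i2: "integrable lborel (\<lambda>x. \<phi> x *\<^sub>R u (- h n *\<^sub>R e + x))"
        by (intro L2_scaleR_integrable L2_fun_test_function L2_fun_translate u t)
      have m: "(LINT x|lborel. \<phi> x *\<^sub>R u (- h n *\<^sub>R e + x)) = (LINT x|lborel. \<phi> (h n *\<^sub>R e + x) *\<^sub>R u x)"
        using integral_translate[of "\<lambda>x. \<phi> x *\<^sub>R u (- h n *\<^sub>R e + x)" "h n *\<^sub>R e"] by simp
      have "(LINT x|lborel. ((\<phi> (x + h n *\<^sub>R e) - \<phi> x) / h n) *\<^sub>R u x)
          = (LINT x|lborel. (\<phi> (h n *\<^sub>R e + x) *\<^sub>R u x - \<phi> x *\<^sub>R u x) /\<^sub>R h n)"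
        by (intro Bochner_Integration.integral_cong refl) (simp add: scaleR_diff_left[symmetric] add.commute divide_inverse mult.commute)
      also have "\<dots> = (LINT x|lborel. (\<phi> x *\<^sub>R u (- h n *\<^sub>R e + x) - \<phi> x *\<^sub>R u x) /\<^sub>R h n)"
        using i1 i2 m by simp
      also have "\<dots> = (LINT x|lborel. \<phi> x *\<^sub>R ((u (x + (- h n) *\<^sub>R e) - u x) /\<^sub>R h n))"
        by (intro Bochner_Integration.integral_cong refl) (simp add: scaleR_diff_right add.commute mult.commute)
      finally show ?thesis .
    qed
    show ?thesis using LIMSEQ_unique[OF lhs[unfolded eq] rhs] by simp
  qed
  then show ?thesis using u g by (auto simp: grad_pair_def has_weak_gradient_def)
qed

subsection \<open>The \<open>L\<^sup>2\<close> inner product\<close>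

lemma borel_measurable_cnj [measurable (raw)]:
  "f \<in> borel_measurable M \<Longrightarrow> (\<lambda>x. cnj (f x)) \<in> borel_measurable M"
  by (rule measurable_compose[of _ _ borel]) (auto intro!: borel_measurable_continuous_onI continuous_intros)

lemma L2_inner_integrable:
  assumes "L2_fun u" "L2_fun v" shows "integrable lborel (\<lambda>x. cnj (u x) * v x)"
  using L2_fun_measurable[OF assms(1)] L2_fun_measurable[OF assms(2)]
  by (intro L2_mult_integrable[OF assms]) (auto simp: norm_mult)

lemma L2_inner_add_right:
  "L2_fun u \<Longrightarrow> L2_fun v \<Longrightarrow> L2_fun w \<Longrightarrow> L2_inner u (\<lambda>x. v x + w x) = L2_inner u v + L2_inner u w"
  using L2_inner_integrable[of u v] L2_inner_integrable[of u w] by (simp add: L2_inner_def distrib_left)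

lemma L2_inner_cmult_right: "L2_inner u (\<lambda>x. c * v x) = c * L2_inner u v"
proof -
  have "L2_inner u (\<lambda>x. c * v x) = (LINT x|lborel. c * (cnj (u x) * v x))"
    unfolding L2_inner_def by (simp add: mult.left_commute)
  also have "\<dots> = c * L2_inner u v" unfolding L2_inner_def by (rule integral_mult_right_zero)
  finally show ?thesis .
qed

lemma L2_inner_cnj: "L2_inner v u = cnj (L2_inner u v)"
  unfolding L2_inner_def by (simp add: mult.commute flip: Bochner_Integration.integral_cnj)

lemma L2_inner_self: "L2_inner u u = of_real (LINT x|lborel. (norm (u x))\<^sup>2)"
  unfolding L2_inner_def by (simp add: mult.commute complex_norm_square[symmetric] del: of_real_power)

lemma L2_inner_sum_right:
  assumes "L2_fun u" "\<And>k. k \<in> S \<Longrightarrow> L2_fun (v k)"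
  shows "L2_inner u (\<lambda>x. \<Sum>k\<in>S. c k * v k x) = (\<Sum>k\<in>S. c k * L2_inner u (v k))"
  using assms(2)
proof (induction S rule: infinite_finite_induct)
  case (insert k S)
  have "L2_inner u (\<lambda>x. c k * v k x + (\<Sum>k\<in>S. c k * v k x)) = L2_inner u (\<lambda>x. c k * v k x) + L2_inner u (\<lambda>x. \<Sum>k\<in>S. c k * v k x)"
    using insert assms(1) by (intro L2_inner_add_right L2_fun_cmult L2_fun_sum) auto
  then show ?case using insert by (simp add: L2_inner_cmult_right)
qed (auto simp: L2_inner_def)

lemma L2_inner_sum_left:
  assumes "L2_fun u" "\<And>k. k \<in> S \<Longrightarrow> L2_fun (v k)"
  shows "L2_inner (\<lambda>x. \<Sum>k\<in>S. c k * v k x) u = (\<Sum>k\<in>S. cnj (c k) * L2_inner (v k) u)"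
proof -
  have "L2_inner (\<lambda>x. \<Sum>k\<in>S. c k * v k x) u = cnj (L2_inner u (\<lambda>x. \<Sum>k\<in>S. c k * v k x))"
    by (rule L2_inner_cnj)
  also have "\<dots> = (\<Sum>k\<in>S. cnj (c k) * cnj (L2_inner u (v k)))"
    by (simp add: L2_inner_sum_right[OF assms])
  also have "\<dots> = (\<Sum>k\<in>S. cnj (c k) * L2_inner (v k) u)"
    by (intro sum.cong refl) (metis L2_inner_cnj)
  finally show ?thesis .
qed

lemma L2_inner_add_left:
  assumes "L2_fun u" "L2_fun v" "L2_fun w"
  shows "L2_inner (\<lambda>x. v x + w x) u = L2_inner v u + L2_inner w u"
  using L2_inner_add_right[OF assms] L2_inner_cnj[of "\<lambda>x. v x + w x" u] L2_inner_cnj[of v u] L2_inner_cnj[of w u]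
  by (simp only: complex_cnj_add)

text \<open>The difference of the two sides is the squared norm of \<open>\<kappa> + w\<close>,
  where \<open>w\<close> is minus the projection of \<open>\<kappa>\<close> onto the span of the
  \<open>u k\<close>.\<close>

lemma L2_bessel:
  assumes "finite S" "\<And>k. k \<in> S \<Longrightarrow> L2_fun (u k)" "L2_fun \<kappa>"
    and orth: "\<And>j k. j \<in> S \<Longrightarrow> k \<in> S \<Longrightarrow> L2_inner (u j) (u k) = (if j = k then 1 else 0)"
  shows "(\<Sum>k\<in>S. (norm (L2_inner (u k) \<kappa>))\<^sup>2) \<le> (LINT x|lborel. (norm (\<kappa> x))\<^sup>2)"
proof -
  define c where "c k = L2_inner (u k) \<kappa>" for k
  define w where "w x = (\<Sum>k\<in>S. (- c k) * u k x)" for x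
  have w: "L2_fun w" unfolding w_def using assms by (intro L2_fun_sum L2_fun_cmult) auto
  have kc: "L2_inner \<kappa> (u k) = cnj (c k)" for k
    unfolding c_def by (rule L2_inner_cnj)
  have kw: "L2_inner \<kappa> w = - (\<Sum>k\<in>S. c k * cnj (c k))"
    unfolding w_def using assms by (subst L2_inner_sum_right) (auto simp: kc sum_negf)
  have wk: "L2_inner (u k) w = - c k" if "k \<in> S" for k
    unfolding w_def using assms that by (subst L2_inner_sum_right) (auto simp: orth if_distrib cong: if_cong)
  have ww: "L2_inner w w = (\<Sum>k\<in>S. c k * cnj (c k))"
  proof -
    have "L2_inner w w = (\<Sum>k\<in>S. cnj (- c k) * L2_inner (u k) w)"
      unfolding w_def[abs_def] using assms w by (subst L2_inner_sum_left) (auto simp: w_def[abs_def])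
    then show ?thesis using wk by (simp add: mult.commute)
  qed
  have sq: "(\<Sum>k\<in>S. c k * cnj (c k)) = of_real (\<Sum>k\<in>S. (norm (c k))\<^sup>2)"
    by (simp only: of_real_sum complex_norm_square)
  have "L2_inner (\<lambda>x. \<kappa> x + w x) (\<lambda>x. \<kappa> x + w x) = L2_inner \<kappa> \<kappa> + L2_inner \<kappa> w + cnj (L2_inner \<kappa> w) + L2_inner w w"
    using assms(3) w L2_fun_add[OF assms(3) w] L2_inner_cnj[of w \<kappa>] by (simp add: L2_inner_add_left L2_inner_add_right)
  also have "\<dots> = of_real ((LINT x|lborel. (norm (\<kappa> x))\<^sup>2) - (\<Sum>k\<in>S. (norm (c k))\<^sup>2))"
    unfolding kw ww sq L2_inner_self[of \<kappa>] by simp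
  finally have "(LINT x|lborel. (norm (\<kappa> x + w x))\<^sup>2) = (LINT x|lborel. (norm (\<kappa> x))\<^sup>2) - (\<Sum>k\<in>S. (norm (c k))\<^sup>2)"
    unfolding L2_inner_self by (simp only: of_real_eq_iff)
  moreover have "0 \<le> (LINT x|lborel. (norm (\<kappa> x + w x))\<^sup>2)" by simp
  ultimately show ?thesis unfolding c_def by linarith
qed

subsection \<open>Averages over a scaled kernel\<close>

lemma integral_scale:
  fixes f :: "real^'d \<Rightarrow> 'b::{banach, second_countable_topology}"
  assumes [measurable]: "f \<in> borel_measurable borel" and "l > 0"
  shows "(LINT y|lborel. f ((y - x) /\<^sub>R l)) = l ^ CARD('d) *\<^sub>R (LINT y|lborel. f y)"
proof -
  have "(LINT y|lborel. f ((y - x) /\<^sub>R l))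
      = (LINT y|Nonnegative_Lebesgue_Integration.density (distr lborel borel (\<lambda>y. x + l *\<^sub>R y)) (\<lambda>_. \<bar>l\<bar> ^ DIM(real^'d)). f ((y - x) /\<^sub>R l))"
    using assms(2) by (subst lborel_affine[of l x]) auto
  also have "\<dots> = (LINT y|distr lborel borel (\<lambda>y. x + l *\<^sub>R y). (l ^ CARD('d)) *\<^sub>R f ((y - x) /\<^sub>R l))"
    using assms(2) by (subst integral_density) auto
  also have "\<dots> = (LINT y|lborel. (l ^ CARD('d)) *\<^sub>R f y)"
    using assms(2) by (subst integral_distr) auto
  finally show ?thesis by simp
qed

definition unit_bump :: "real^'d \<Rightarrow> real" where
  "unit_bump = bump 0 (vec 1) 1"

text \<open>The cube carrying the kernel has \<open>x\<close> as a corner rather than as its centre,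
  to match the averages in the differentiation theorem. The normalization makes the mass independent
  of \<open>l\<close>; it is \<open>bump_mass\<close> instead of 1.\<close>

definition ker :: "real^'d \<Rightarrow> real \<Rightarrow> real^'d \<Rightarrow> real" where
  "ker x l y = unit_bump ((y - x) /\<^sub>R l) / l ^ CARD('d)"

definition avg :: "real^'d \<Rightarrow> (real^'d \<Rightarrow> complex) \<Rightarrow> real \<Rightarrow> complex" where
  "avg x u l = (LINT y|lborel. ker x l y *\<^sub>R u y)"

definition bump_mass :: "'d::finite itself \<Rightarrow> real" where
  "bump_mass _ = (LINT y|lborel. unit_bump (y :: real^'d))"

lemma test_function_unit_bump: "test_function unit_bump"
  unfolding unit_bump_def by (rule test_function_bump) simp

lemma unit_bump_measurable [measurable]: "unit_bump \<in> borel_measurable borel"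
  by (rule test_function_measurable[OF test_function_unit_bump])

lemma unit_bump_nonneg: "0 \<le> unit_bump z" and unit_bump_le_1: "unit_bump z \<le> 1"
  by (auto simp: unit_bump_def bump_nonneg bump_le_1)

lemma unit_bump_eq_0: "z \<notin> cbox 0 (vec 1) \<Longrightarrow> unit_bump z = 0"
  unfolding unit_bump_def using box_subset_cbox by (intro bump_eq_0) auto

lemma bump_mass_pos: "bump_mass TYPE('d::finite) > 0"
proof -
  let ?b = "unit_bump :: real^'d \<Rightarrow> real"
  have i: "integrable lborel ?b" by (rule integrable_test_function[OF test_function_unit_bump])
  have "\<not> (AE x in lborel. ?b x = 0)"
  proof
    assume "AE x in lborel. ?b x = 0"
    moreover have "?b x \<noteq> 0" if "x \<in> box 0 (vec 1)" for x
      using bump_pos[OF _ that, of 1] by (simp add: unit_bump_def)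
    ultimately have "AE x in lborel. x \<notin> box 0 (vec 1 :: real^'d)" by (auto elim: eventually_mono)
    then have "negligible (box 0 (vec 1 :: real^'d))"
      by (simp add: AE_iff_null_sets[symmetric] negligible_iff_null_sets null_sets_completionI)
    moreover have "vec (1/2) \<in> box 0 (vec 1 :: real^'d)" by (simp add: mem_box_cart)
    ultimately show False using open_not_negligible[of "box 0 (vec 1 :: real^'d)"] open_box by blast
  qed
  then have "(LINT y|lborel. ?b y) \<noteq> 0"
    using integral_nonneg_eq_0_iff_AE[OF i] unit_bump_nonneg by auto
  moreover have "(LINT y|lborel. ?b y) \<ge> 0" by (intro integral_nonneg_AE AE_I2 unit_bump_nonneg)
  ultimately show ?thesis by (simp add: bump_mass_def)
qed

lemma ker_eq_bump:
  "l > 0 \<Longrightarrow> ker x l y = bump x (x + l *\<^sub>R vec 1) (inverse l) y / l ^ CARD('d)" for x :: "real^'d"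
  unfolding ker_def unit_bump_def bump_def
  by (intro arg_cong2[where f="(/)"] prod.cong refl) (simp add: field_simps)

lemma test_function_ker:
  assumes "l > 0" shows "test_function (ker x l)"
proof -
  have "ker x l = (\<lambda>y. inverse (l ^ CARD('a)) * bump x (x + l *\<^sub>R vec 1) (inverse l) y)"
    using ker_eq_bump[OF assms, of x] by (auto simp: divide_inverse)
  then show ?thesis using assms by (auto intro!: test_function_mult test_function_bump C_k_const)
qed

lemma ker_nonneg: "l > 0 \<Longrightarrow> 0 \<le> ker x l y" and ker_le: "l > 0 \<Longrightarrow> ker x l y \<le> 1 / l ^ CARD('d)"
  for x :: "real^'d"
  by (auto simp: ker_def unit_bump_nonneg divide_right_mono unit_bump_le_1)

lemma ker_eq_0:
  assumes "l > 0" "y \<notin> cbox x (x + l *\<^sub>R vec 1)" shows "ker x l y = 0"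
proof -
  have "(y - x) /\<^sub>R l \<notin> cbox 0 (vec 1)" using assms by (auto simp: mem_box_cart field_simps)
  then show ?thesis by (simp add: ker_def unit_bump_eq_0)
qed

lemma ker_eq_0_ball:
  fixes x :: "real^'d"
  assumes "l > 0" "y \<notin> ball x ((1 + real CARD('d)) * l)" shows "ker x l y = 0"
proof (rule ker_eq_0[OF assms(1)], rule notI)
  assume "y \<in> cbox x (x + l *\<^sub>R vec 1)"
  then have "\<bar>(y - x) $ i\<bar> \<le> l" for i by (auto simp: mem_box_cart abs_le_iff) (metis add.commute add_increasing2 assms(1) diff_le_eq less_imp_le)+
  then have "norm (y - x) \<le> (\<Sum>i\<in>(UNIV::'d set). l)"
    by (intro order_trans[OF norm_le_l1_cart] sum_mono) auto
  also have "\<dots> < (1 + real CARD('d)) * l" using assms(1) by (simp add: algebra_simps)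
  finally show False using assms(2) by (simp add: dist_norm norm_minus_commute)
qed

lemma ker_integral: "l > 0 \<Longrightarrow> (LINT y|lborel. ker x l y) = bump_mass TYPE('d)" for x :: "real^'d"
  using integral_scale[of unit_bump l x] by (simp add: ker_def bump_mass_def)

lemma ker_norm: 
  fixes x :: "real^'d" assumes "l > 0"
  shows "(LINT y|lborel. (ker x l y)\<^sup>2) \<le> bump_mass TYPE('d) / l ^ CARD('d)"
proof -
  note t = test_function_ker[OF assms, of x]
  have "(LINT y|lborel. (ker x l y)\<^sup>2) \<le> (LINT y|lborel. 1 / l ^ CARD('d) * ker x l y)"
  proof (rule integral_mono)
    show "integrable lborel (\<lambda>y. (ker x l y)\<^sup>2)" using L2_fun_integrable[OF L2_fun_test_function[OF t]] by simp
    show "integrable lborel (\<lambda>y. 1 / l ^ CARD('d) * ker x l y)" using integrable_test_function[OF t] by simp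
    show "(ker x l y)\<^sup>2 \<le> 1 / l ^ CARD('d) * ker x l y" for y
      unfolding power2_eq_square by (intro mult_right_mono ker_le ker_nonneg assms)
  qed
  also have "\<dots> = bump_mass TYPE('d) / l ^ CARD('d)" using ker_integral[OF assms, of x] by simp
  finally show ?thesis .
qed

lemma integrable_ker:
  assumes "l > 0" "L2_fun u" shows "integrable lborel (\<lambda>y. ker x l y *\<^sub>R u y)"
  by (intro L2_scaleR_integrable L2_fun_test_function test_function_ker assms)

lemma avg_sum:
  assumes "l > 0" "\<And>k. k \<in> S \<Longrightarrow> L2_fun (u k)"
  shows "avg x (\<lambda>y. \<Sum>k\<in>S. c k * u k y) l = (\<Sum>k\<in>S. c k * avg x (u k) l)"
proof -
  have "avg x (\<lambda>y. \<Sum>k\<in>S. c k * u k y) l = (LINT y|lborel. (\<Sum>k\<in>S. c k * (ker x l y *\<^sub>R u k y)))"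
    unfolding avg_def by (simp add: scaleR_sum_right)
  also have "\<dots> = (\<Sum>k\<in>S. (LINT y|lborel. c k * (ker x l y *\<^sub>R u k y)))"
    by (intro Bochner_Integration.integral_sum integrable_mult_right integrable_ker assms)
  also have "\<dots> = (\<Sum>k\<in>S. c k * avg x (u k) l)"
    unfolding avg_def by (simp only: integral_mult_right_zero)
  finally show ?thesis .
qed

text \<open>Each average is a scalar product with one and the same kernel, so Bessel's inequality
  bounds the sum over the family by the squared norm of that kernel, uniformly in the number of
  functions. This is where orthonormality enters the Lieb--Thirring inequality.\<close>

lemma avg_bessel:
  fixes u :: "nat \<Rightarrow> real^'d \<Rightarrow> complex"
  assumes "l > 0" "finite S" "\<And>k. k \<in> S \<Longrightarrow> L2_fun (u k)"
    "\<And>j k. j \<in> S \<Longrightarrow> k \<in> S \<Longrightarrow> L2_inner (u j) (u k) = (if j = k then 1 else 0)"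
  shows "(\<Sum>k\<in>S. (norm (avg x (u k) l))\<^sup>2) \<le> bump_mass TYPE('d) / l ^ CARD('d)"
proof -
  note t = L2_fun_test_function[OF test_function_ker[OF assms(1), of x]]
  define \<kappa> where "\<kappa> y = complex_of_real (ker x l y)" for y
  have L: "L2_fun \<kappa>" unfolding \<kappa>_def
    by (rule L2_fun_bound[OF t, of _ 1]) (use L2_fun_measurable[OF t] in auto)
  have "avg x (u k) l = cnj (L2_inner (u k) \<kappa>)" for k
    unfolding avg_def L2_inner_cnj[of \<kappa>, symmetric] unfolding L2_inner_def \<kappa>_def by (simp add: scaleR_conv_of_real)
  then have "(\<Sum>k\<in>S. (norm (avg x (u k) l))\<^sup>2) = (\<Sum>k\<in>S. (norm (L2_inner (u k) \<kappa>))\<^sup>2)" by simp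
  also have "\<dots> \<le> (LINT x|lborel. (norm (\<kappa> x))\<^sup>2)" by (intro L2_bessel assms L)
  also have "\<dots> \<le> bump_mass TYPE('d) / l ^ CARD('d)" using ker_norm[OF assms(1), of x] by (simp add: \<kappa>_def)
  finally show ?thesis .
qed

section \<open>Lebesgue points and convergence of the averages\<close>

lemma One_eq_vec_1: "(One :: real^'d) = vec 1"
proof -
  have "(One :: real^'d) $ i = 1" for i
    by (simp add: cart_eq_inner_axis axis_in_Basis_iff)
  then show ?thesis by (simp add: vec_eq_iff)
qed

text \<open>The differentiation theorem is applied to \<open>norm (f y - q)\<close> for each
  \<open>q\<close> in a countable dense set, so that the exceptional sets still have a null union.
  At a remaining point \<open>f x\<close> is approximated by some \<open>q\<close>, at the cost of
  \<open>e / 3\<close> in the integrand and \<open>e / 3\<close> in the limit.\<close>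

lemma AE_lebesgue_point:
  fixes f :: "real^'d \<Rightarrow> complex"
  assumes f: "L2_fun f"
  shows "AE x in lborel. \<forall>e>0. \<exists>d>0. \<forall>h. 0 < h \<and> h < d \<longrightarrow>
    (LINT y:cbox x (x + h *\<^sub>R vec 1)|lborel. norm (f y - f x)) \<le> e * h ^ CARD('d)"
proof -
  note [measurable] = L2_fun_measurable[OF f]
  obtain D :: "complex set" where D: "countable D" "\<forall>X. open X \<longrightarrow> X \<noteq> {} \<longrightarrow> (\<exists>d\<in>D. d \<in> X)"
    using countable_dense_exists by auto
  have si: "set_integrable lborel (cbox a b) (\<lambda>y. norm (f y - q))" for a b q
  proof -
    have "set_integrable lborel (cbox a b) (\<lambda>y. q)"
      unfolding set_integrable_def by (rule integrable_bounded_cbox_support[of _ "norm q" a b]) (auto simp: indicator_def)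
    then have "set_integrable lborel (cbox a b) (\<lambda>y. f y - q)"
      using L2_integrable_cbox[OF f] by (intro set_integral_diff) auto
    then show ?thesis by (rule set_integrable_norm)
  qed
  let ?P = "\<lambda>q x. \<forall>e>0. \<exists>d>0. \<forall>h. 0 < h \<and> h < d \<longrightarrow>
      norm (integral (cbox x (x + h *\<^sub>R One)) (\<lambda>y. norm (f y - q)) /\<^sub>R h ^ DIM(real^'d) - norm (f x - q)) < e"
  have "AE x in lborel. ?P q x" for q
  proof -
    have "(\<lambda>y. norm (f y - q)) integrable_on cbox a b" for a b
      by (intro set_borel_integral_eq_integral si)
    then obtain N where N: "negligible N" and e: "\<And>x e. \<lbrakk>x \<notin> N; 0 < e\<rbrakk> \<Longrightarrow> \<exists>d>0. \<forall>h. 0 < h \<and> h < d \<longrightarrow>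
        norm (integral (cbox x (x + h *\<^sub>R One)) (\<lambda>y. norm (f y - q)) /\<^sub>R h ^ DIM(real^'d) - norm (f x - q)) < e"
      by (rule integrable_ccontinuous_explicit) blast
    show ?thesis by (rule AE_mp[OF negligible_imp_AE[OF N]]) (use e in auto)
  qed
  then have "AE x in lborel. \<forall>q\<in>D. ?P q x" by (subst AE_ball_countable) (use D in auto)
  then show ?thesis
  proof (rule AE_mp, intro AE_I2 impI allI)
    fix x and e :: real assume P: "\<forall>q\<in>D. ?P q x" and e: "e > 0"
    obtain q where q: "q \<in> D" "q \<in> ball (f x) (e / 3)" using D(2) e by (metis ball_eq_empty divide_pos_pos not_le open_ball zero_less_numeral)
    then have fq: "norm (f x - q) < e / 3" by (simp add: dist_norm)
    obtain d where d: "d > 0" "\<And>h. 0 < h \<and> h < d \<Longrightarrow>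
        norm (integral (cbox x (x + h *\<^sub>R One)) (\<lambda>y. norm (f y - q)) /\<^sub>R h ^ DIM(real^'d) - norm (f x - q)) < e / 3"
      using P[rule_format, OF q(1), of "e / 3"] e by auto
    have "(LINT y:cbox x (x + h *\<^sub>R vec 1)|lborel. norm (f y - f x)) \<le> e * h ^ CARD('d)" if h: "0 < h" "h < d" for h
    proof -
      let ?B = "cbox x (x + h *\<^sub>R vec 1)"
      have hp: "h ^ CARD('d) > 0" using h by simp
      have "x \<in> ?B" using h by (simp add: mem_box_cart)
      then have vol: "measure lborel ?B = h ^ CARD('d)"
        by (subst content_cbox_cart) auto
      have "integral ?B (\<lambda>y. norm (f y - q)) / h ^ CARD('d) < 2 * e / 3"
      proof -
        have "\<bar>integral ?B (\<lambda>y. norm (f y - q)) / h ^ CARD('d) - norm (f x - q)\<bar> < e / 3"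
        proof -
          have "integral (cbox x (x + h *\<^sub>R One)) (\<lambda>y. norm (f y - q)) /\<^sub>R h ^ DIM(real^'d)
              = integral ?B (\<lambda>y. norm (f y - q)) / h ^ CARD('d)"
            unfolding One_eq_vec_1 by (simp add: divide_inverse)
          with d(2)[of h] h show ?thesis unfolding real_norm_def by metis
        qed
        then show ?thesis using fq by linarith
      qed
      then have "integral ?B (\<lambda>y. norm (f y - q)) \<le> 2 * e / 3 * h ^ CARD('d)"
        using hp by (simp add: pos_divide_less_eq)
      then have 1: "(LINT y:?B|lborel. norm (f y - q)) \<le> 2 * e / 3 * h ^ CARD('d)"
        using set_borel_integral_eq_integral(2)[OF si] by simp
      have ci: "set_integrable lborel ?B (\<lambda>y. e / 3)"
        unfolding set_integrable_def by (rule integrable_bounded_cbox_support[of _ "\<bar>e / 3\<bar>" x "x + h *\<^sub>R vec 1"]) (auto simp: indicator_def)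
      have "(LINT y:?B|lborel. norm (f y - f x)) \<le> (LINT y:?B|lborel. norm (f y - q) + e / 3)"
      proof (rule set_integral_mono[OF si set_integral_add(1)[OF si ci]])
        fix y
        have "norm (f y - f x) \<le> norm (f y - q) + norm (q - f x)"
          using norm_triangle_ineq[of "f y - q" "q - f x"] by simp
        then show "norm (f y - f x) \<le> norm (f y - q) + e / 3" using fq by (simp add: norm_minus_commute)
      qed
      also have "\<dots> = (LINT y:?B|lborel. norm (f y - q)) + (LINT y:?B|lborel. e / 3)"
        by (rule set_integral_add(2)[OF si ci])
      also have "(LINT y:?B|lborel. e / 3) = e / 3 * h ^ CARD('d)"
        using vol by (simp add: set_lebesgue_integral_def)
      finally show ?thesis using 1 by (simp add: field_simps)
    qed
    then show "\<exists>d>0. \<forall>h. 0 < h \<and> h < d \<longrightarrow> (LINT y:cbox x (x + h *\<^sub>R vec 1)|lborel. norm (f y - f x)) \<le> e * h ^ CARD('d)"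
      using d(1) by blast
  qed
qed

text \<open>The kernel is at most \<open>1 / h ^ CARD('d)\<close> on its cube and vanishes
  elsewhere, so the deviation from the limit is at most the mean of \<open>norm (u y - u x)\<close>
  over that cube, which tends to 0 at a Lebesgue point.\<close>

lemma AE_avg_tendsto:
  fixes u :: "real^'d \<Rightarrow> complex"
  assumes u: "L2_fun u"
  shows "AE x in lborel. (avg x u \<longlongrightarrow> bump_mass TYPE('d) *\<^sub>R u x) (at_right 0)"
proof (rule AE_mp[OF AE_lebesgue_point[OF u]], intro AE_I2 impI)
  fix x
  note [measurable] = L2_fun_measurable[OF u]
  assume L: "\<forall>e>0. \<exists>d>0. \<forall>h. 0 < h \<and> h < d \<longrightarrow>
    (LINT y:cbox x (x + h *\<^sub>R vec 1)|lborel. norm (u y - u x)) \<le> e * h ^ CARD('d)"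
  have b: "norm (avg x u h - bump_mass TYPE('d) *\<^sub>R u x) \<le> (LINT y:cbox x (x + h *\<^sub>R vec 1)|lborel. norm (u y - u x)) / h ^ CARD('d)"
    if h: "h > 0" for h
  proof -
    let ?B = "cbox x (x + h *\<^sub>R vec 1)"
    note kt = test_function_ker[OF h, of x]
    note [measurable] = test_function_measurable[OF kt]
    have i2: "integrable lborel (\<lambda>y. ker x h y *\<^sub>R u x)"
      using integrable_test_function[OF kt] by simp
    have i3: "integrable lborel (\<lambda>y. indicator ?B y *\<^sub>R norm (u y - u x) / h ^ CARD('d))"
    proof -
      have "set_integrable lborel ?B (\<lambda>y. u x)"
        unfolding set_integrable_def by (rule integrable_bounded_cbox_support[of _ "norm (u x)" x "x + h *\<^sub>R vec 1"]) (auto simp: indicator_def)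
      then have "set_integrable lborel ?B (\<lambda>y. norm (u y - u x))"
        using L2_integrable_cbox[OF u] by (intro set_integrable_norm set_integral_diff) auto
      then show ?thesis unfolding set_integrable_def by simp
    qed
    have "avg x u h - bump_mass TYPE('d) *\<^sub>R u x = (LINT y|lborel. ker x h y *\<^sub>R (u y - u x))"
      using integrable_ker[OF h u, of x] i2 ker_integral[OF h, of x] integrable_test_function[OF kt]
      unfolding avg_def by (simp add: scaleR_diff_right)
    also have "norm \<dots> \<le> (LINT y|lborel. indicator ?B y *\<^sub>R norm (u y - u x) / h ^ CARD('d))"
    proof (rule Bochner_Integration.integral_norm_bound_integral[OF _ i3])
      show "integrable lborel (\<lambda>y. ker x h y *\<^sub>R (u y - u x))"
        using integrable_ker[OF h u, of x] i2 by (simp add: scaleR_diff_right)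
      show "norm (ker x h y *\<^sub>R (u y - u x)) \<le> indicator ?B y *\<^sub>R norm (u y - u x) / h ^ CARD('d)" for y
        using ker_eq_0[OF h, of y x] mult_right_mono[OF ker_le[OF h, of x y], of "norm (u y - u x)"] ker_nonneg[OF h, of x y]
        by (cases "y \<in> ?B") auto
    qed
    finally show ?thesis by (simp add: set_lebesgue_integral_def)
  qed
  show "(avg x u \<longlongrightarrow> bump_mass TYPE('d) *\<^sub>R u x) (at_right 0)"
  proof (rule tendstoI)
    fix e :: real assume e: "e > 0"
    obtain d where d: "d > 0" "\<And>h. 0 < h \<and> h < d \<Longrightarrow>
        (LINT y:cbox x (x + h *\<^sub>R vec 1)|lborel. norm (u y - u x)) \<le> e / 2 * h ^ CARD('d)"
      using L[rule_format, of "e / 2"] e by auto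
    have "dist (avg x u h) (bump_mass TYPE('d) *\<^sub>R u x) < e" if h: "0 < h" "h < d" for h
    proof -
      have "(LINT y:cbox x (x + h *\<^sub>R vec 1)|lborel. norm (u y - u x)) / h ^ CARD('d) \<le> e / 2"
        using d(2)[of h] h by (simp add: field_simps)
      then show ?thesis unfolding dist_norm using b[OF h(1)] e by linarith
    qed
    then show "\<forall>\<^sub>F h in at_right 0. dist (avg x u h) (bump_mass TYPE('d) *\<^sub>R u x) < e"
      using d(1) by (auto simp: eventually_at_right_field)
  qed
qed

section \<open>Dependence of the averages on the scale\<close>

lemma has_vector_derivative_of_quotient:
  fixes f :: "real \<Rightarrow> 'b::real_normed_vector"
  assumes "((\<lambda>h. (f (l + h) - f l) /\<^sub>R h) \<longlongrightarrow> D) (at 0)"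
  shows "(f has_vector_derivative D) (at l)"
proof -
  have "((\<lambda>h. norm ((f (l + h) - f l) /\<^sub>R h - D)) \<longlongrightarrow> 0) (at 0)"
    using assms by (simp add: LIM_zero_iff tendsto_norm_zero_iff)
  moreover have "norm ((f (l + h) - f l) /\<^sub>R h - D) = norm (f (l + h) - f l - h *\<^sub>R D) / norm h" if "h \<noteq> 0" for h
  proof -
    have "f (l + h) - f l - h *\<^sub>R D = h *\<^sub>R ((f (l + h) - f l) /\<^sub>R h - D)"
      using that by (simp add: scaleR_diff_right)
    then show ?thesis using that by (simp only: norm_scaleR) simp
  qed
  ultimately have "((\<lambda>h. norm (f (l + h) - f l - h *\<^sub>R D) / norm h) \<longlongrightarrow> 0) (at 0)"
    by (auto intro: Lim_transform_eventually simp: eventually_at_filter)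
  then show ?thesis
    unfolding has_vector_derivative_def has_derivative_at by (simp add: bounded_linear_scaleR_left)
qed

text \<open>The components of the vector field \<open>y - x\<close> times the kernel. Its divergence
  is \<open>- l\<close> times the derivative of the kernel in the scale.\<close>

definition ker_moment :: "real^'d \<Rightarrow> real \<Rightarrow> 'd \<Rightarrow> real^'d \<Rightarrow> real" where
  "ker_moment x l i y = (y $ i - x $ i) * ker x l y"

lemma C_k_affine: "C_k k (\<lambda>y. y $ i - x $ i)" for x :: "real^'d"
  using C_k_add[OF C_k_component C_k_const[where c="- x $ i"], of k i] by simp

lemma test_function_ker_moment: "l > 0 \<Longrightarrow> test_function (ker_moment x l i)"
  unfolding ker_moment_def[abs_def] by (intro test_function_mult test_function_ker C_k_affine)

lemma ker_has_derivative:
  fixes x :: "real^'d"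
  assumes "l > 0"
  shows "(ker x l has_derivative (\<lambda>h. (\<Sum>i\<in>UNIV. h $ i * (partial_deriv i unit_bump ((y - x) /\<^sub>R l) / l ^ Suc CARD('d))))) (at y)"
proof -
  have "((\<lambda>y. unit_bump ((y - x) /\<^sub>R l)) has_derivative
     (\<lambda>h. \<Sum>i\<in>UNIV. (h /\<^sub>R l) $ i * partial_deriv i unit_bump ((y - x) /\<^sub>R l))) (at y)"
    by (rule has_derivative_compose[OF _ test_function_has_derivative[OF test_function_unit_bump]])
      (auto intro!: derivative_eq_intros)
  then have "((\<lambda>y. unit_bump ((y - x) /\<^sub>R l) / l ^ CARD('d)) has_derivative
     (\<lambda>h. (\<Sum>i\<in>UNIV. (h /\<^sub>R l) $ i * partial_deriv i unit_bump ((y - x) /\<^sub>R l)) / l ^ CARD('d))) (at y)"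
    by (rule bounded_linear.has_derivative[OF bounded_linear_divide]) 
  then show ?thesis unfolding ker_def[abs_def]
    by (rule has_derivative_eq_rhs) (auto simp: sum_divide_distrib field_simps)
qed

lemma partial_deriv_ker:
  fixes x :: "real^'d"
  assumes "l > 0"
  shows "partial_deriv i (ker x l) y = partial_deriv i unit_bump ((y - x) /\<^sub>R l) / l ^ Suc CARD('d)"
proof -
  have "partial_deriv i (ker x l) y = (\<Sum>j\<in>UNIV. (axis i 1 :: real^'d) $ j * (partial_deriv j unit_bump ((y - x) /\<^sub>R l) / l ^ Suc CARD('d)))"
    by (rule partial_deriv_eq[OF ker_has_derivative[OF assms]])
  also have "\<dots> = (\<Sum>j\<in>UNIV. if j = i then partial_deriv i unit_bump ((y - x) /\<^sub>R l) / l ^ Suc CARD('d) else 0)"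
    by (intro sum.cong) (auto simp: axis_def)
  finally show ?thesis by simp
qed

lemma partial_deriv_ker_moment:
  fixes x :: "real^'d"
  assumes "l > 0"
  shows "partial_deriv i (ker_moment x l i) y = (y $ i - x $ i) * partial_deriv i unit_bump ((y - x) /\<^sub>R l) / l ^ Suc CARD('d) + ker x l y"
proof -
  have d: "((\<lambda>y::real^'d. y $ i - x $ i) has_derivative (\<lambda>h. h $ i)) (at y)"
    by (auto intro!: derivative_eq_intros bounded_linear_imp_has_derivative bounded_linear_vec_nth)
  show ?thesis unfolding ker_moment_def[abs_def]
    by (subst partial_deriv_mult)
      (use d partial_deriv_eq[OF d, of i] partial_deriv_ker[OF assms, of i x y] in
        \<open>auto simp: differentiable_def intro!: test_function_differentiable[OF test_function_ker[OF assms], unfolded differentiable_def]\<close>)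
qed

definition ker_rate :: "real^'d \<Rightarrow> real \<Rightarrow> real^'d \<Rightarrow> real" where
  "ker_rate x l y = - (\<Sum>i\<in>UNIV. partial_deriv i (ker_moment x l i) y) / l"

text \<open>The kernels have constant mass, so their \<open>l\<close>-derivative is a divergence.\<close>

lemma ker_deriv:
  fixes x :: "real^'d"
  assumes "l > 0"
  shows "((\<lambda>l. ker x l y) has_real_derivative ker_rate x l y) (at l)"
proof -
  define S where "S = (\<Sum>i\<in>UNIV. (y - x) $ i * partial_deriv i unit_bump ((y - x) /\<^sub>R l))"
  have "((\<lambda>l. unit_bump ((y - x) /\<^sub>R l)) has_derivative
     (\<lambda>h. \<Sum>i\<in>UNIV. ((- (h / l\<^sup>2)) *\<^sub>R (y - x)) $ i * partial_deriv i unit_bump ((y - x) /\<^sub>R l))) (at l)"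
    by (rule has_derivative_compose[OF _ test_function_has_derivative[OF test_function_unit_bump]])
      (use assms in \<open>auto intro!: derivative_eq_intros simp: power2_eq_square field_simps\<close>)
  moreover have "(\<Sum>i\<in>UNIV. ((- (h / l\<^sup>2)) *\<^sub>R (y - x)) $ i * partial_deriv i unit_bump ((y - x) /\<^sub>R l)) = (- S / l\<^sup>2) * h" for h
  proof -
    have "(\<Sum>i\<in>UNIV. ((- (h / l\<^sup>2)) *\<^sub>R (y - x)) $ i * partial_deriv i unit_bump ((y - x) /\<^sub>R l))
        = (\<Sum>i\<in>UNIV. (- (h / l\<^sup>2)) * ((y - x) $ i * partial_deriv i unit_bump ((y - x) /\<^sub>R l)))"
      by (simp only: vector_scaleR_component real_scaleR_def mult.assoc)
    then show ?thesis by (simp only: sum_distrib_left[symmetric] S_def[symmetric]) simp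
  qed
  ultimately have "((\<lambda>l. unit_bump ((y - x) /\<^sub>R l)) has_real_derivative - S / l\<^sup>2) (at l)"
    by (simp only: has_field_derivative_def)
  then have "((\<lambda>l. ker x l y) has_real_derivative
     ((- S / l\<^sup>2) * l ^ CARD('d) - unit_bump ((y - x) /\<^sub>R l) * (real CARD('d) * l ^ (CARD('d) - 1))) / (l ^ CARD('d) * l ^ CARD('d))) (at l)"
    unfolding ker_def using assms
    by (intro DERIV_divide) (auto intro!: derivative_eq_intros)
  moreover have "((- S / l\<^sup>2) * l ^ CARD('d) - unit_bump ((y - x) /\<^sub>R l) * (real CARD('d) * l ^ (CARD('d) - 1))) / (l ^ CARD('d) * l ^ CARD('d))
     = ker_rate x l y"
  proof -
    have "(\<Sum>i\<in>UNIV. partial_deriv i (ker_moment x l i) y) = S / l ^ Suc CARD('d) + real CARD('d) * ker x l y"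
      unfolding partial_deriv_ker_moment[OF assms] by (simp add: sum.distrib S_def sum_divide_distrib)
    then have k: "ker_rate x l y = - (S / l ^ Suc CARD('d) + real CARD('d) * (unit_bump ((y - x) /\<^sub>R l) / l ^ CARD('d))) / l"
      by (simp add: ker_rate_def ker_def)
    obtain n where n: "CARD('d) = Suc n" using not0_implies_Suc[of "CARD('d)"] by auto
    show ?thesis unfolding k n using assms by (simp add: field_simps power2_eq_square)
  qed
  ultimately show ?thesis by simp
qed

text \<open>Differentiating the kernel costs one power of \<open>1 / l\<close>, but on the support
  the factor \<open>y $ i - x $ i\<close> of the moment is at most \<open>l\<close> and gains it
  back. The bound serves as domination when differentiating under the integral.\<close>

lemma ker_rate_bound:
  obtains B where "B > 0" "\<And>(x::real^'d) l y. l > 0 \<Longrightarrow> \<bar>ker_rate x l y\<bar> \<le> B / l ^ Suc CARD('d)"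
proof -
  let ?b = "unit_bump :: real^'d \<Rightarrow> real"
  obtain B where B: "B > 0" "\<And>i x. \<bar>partial_deriv i ?b x\<bar> \<le> B"
    by (rule test_function_bounds[OF test_function_unit_bump]) blast
  have z: "partial_deriv i ?b w = 0" if "w \<notin> cbox 0 (vec 1)" for i w
    by (rule partial_deriv_support[OF unit_bump_eq_0 that])
  show ?thesis
  proof (rule that[of "real CARD('d) * (B + 1)"])
    show "real CARD('d) * (B + 1) > 0" using B(1) by simp
    fix x y :: "real^'d" and l :: real assume l: "l > 0"
    have "\<bar>partial_deriv i (ker_moment x l i) y\<bar> \<le> (B + 1) / l ^ CARD('d)" for i
    proof -
      have "\<bar>(y $ i - x $ i) * partial_deriv i ?b ((y - x) /\<^sub>R l)\<bar> \<le> l * B"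
      proof (cases "(y - x) /\<^sub>R l \<in> cbox 0 (vec 1)")
        case True
        then have "0 \<le> (y $ i - x $ i) / l" "(y $ i - x $ i) / l \<le> 1"
          by (auto simp: mem_box_cart divide_inverse mult.commute)
        then have "\<bar>y $ i - x $ i\<bar> \<le> l" using l by (simp add: field_simps)
        then show ?thesis unfolding abs_mult using B(2) l by (intro mult_mono) auto
      qed (use z B(1) l in auto)
      then have "\<bar>(y $ i - x $ i) * partial_deriv i ?b ((y - x) /\<^sub>R l) / l ^ Suc CARD('d)\<bar> \<le> B / l ^ CARD('d)"
        using l by (simp add: field_simps)
      moreover have "\<bar>ker x l y\<bar> \<le> 1 / l ^ CARD('d)" using ker_nonneg[OF l, of x y] ker_le[OF l, of x y] by simp
      ultimately show ?thesis unfolding partial_deriv_ker_moment[OF l] add_divide_distrib by linarith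
    qed
    then have "\<bar>\<Sum>i\<in>UNIV. partial_deriv i (ker_moment x l i) y\<bar> \<le> (\<Sum>i\<in>(UNIV::'d set). (B + 1) / l ^ CARD('d))"
      by (intro order_trans[OF sum_abs] sum_mono)
    then show "\<bar>ker_rate x l y\<bar> \<le> real CARD('d) * (B + 1) / l ^ Suc CARD('d)"
      using l by (simp add: ker_rate_def field_simps)
  qed
qed

text \<open>Differentiation under the integral produces the divergence of the moment field, and
  since the moments are test functions the weak gradient takes over the derivative. The change of an
  average with the scale is thus controlled by the gradient alone.\<close>

lemma avg_has_vector_derivative:
  fixes x :: "real^'d"
  assumes U: "grad_pair U g" and l: "l > 0"
  shows "(avg x U has_vector_derivative (\<Sum>i\<in>UNIV. LINT y|lborel. ker_moment x l i y *\<^sub>R (g y $ i)) /\<^sub>R l) (at l)"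
proof (rule has_vector_derivative_of_quotient)
  note L = grad_pair_L2[OF U]
  note [measurable] = L2_fun_measurable[OF L(1)]
  obtain B where B: "B > 0" "\<And>(x::real^'d) l y. l > 0 \<Longrightarrow> \<bar>ker_rate x l y\<bar> \<le> B / l ^ Suc CARD('d)"
    by (rule ker_rate_bound) blast
  \<comment> \<open>For increments below \<open>l / 2\<close> all scales involved stay above
    \<open>l / 2\<close>, where the rate is at most \<open>M\<close>.\<close>
  define M where "M = B / (l / 2) ^ Suc CARD('d)"
  have M: "M > 0" using B(1) l by (simp add: M_def)
  have lip: "\<bar>ker x (l + h) y - ker x l y\<bar> \<le> M * \<bar>h\<bar>" if "\<bar>h\<bar> < l / 2" for h y
  proof -
    have "norm (ker x (l + h) y - ker x l y) \<le> M * norm (l + h - l)"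
    proof (rule field_differentiable_bound[of "{l / 2..}" "\<lambda>l. ker x l y" "\<lambda>l. ker_rate x l y"])
      show "((\<lambda>l. ker x l y) has_field_derivative ker_rate x z y) (at z within {l / 2..})" if "z \<in> {l / 2..}" for z
        using that l by (auto intro: has_field_derivative_at_within[OF ker_deriv])
      show "norm (ker_rate x z y) \<le> M" if z: "z \<in> {l / 2..}" for z
      proof -
        have zl: "0 < z" "0 < l / 2" "l / 2 \<le> z" using z l by auto
        have "B / z ^ Suc CARD('d) \<le> M" unfolding M_def
          by (intro divide_left_mono power_mono mult_pos_pos zero_less_power zl less_imp_le[OF B(1)] less_imp_le[OF zl(2)])
        with B(2)[OF zl(1), of x y] show ?thesis unfolding real_norm_def by (rule order_trans)
      qed
    next
      show "l + h \<in> {l / 2..}" "l \<in> {l / 2..}" using that l by (auto simp: abs_less_iff)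
    qed simp
    then show ?thesis by simp
  qed
  have D: "(LINT y|lborel. ker_rate x l y *\<^sub>R U y) = (\<Sum>i\<in>UNIV. LINT y|lborel. ker_moment x l i y *\<^sub>R (g y $ i)) /\<^sub>R l"
  proof -
    have "(LINT y|lborel. ker_rate x l y *\<^sub>R U y) = (LINT y|lborel. (- inverse l) *\<^sub>R (\<Sum>i\<in>UNIV. partial_deriv i (ker_moment x l i) y *\<^sub>R U y))"
      by (intro Bochner_Integration.integral_cong refl) (simp add: ker_rate_def scaleR_sum_left[symmetric] divide_inverse mult.commute)
    also have "\<dots> = (- inverse l) *\<^sub>R (\<Sum>i\<in>UNIV. LINT y|lborel. partial_deriv i (ker_moment x l i) y *\<^sub>R U y)"
      using grad_pair_integrable(2)[OF U test_function_ker_moment[OF l]] by simp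
    also have "\<dots> = (\<Sum>i\<in>UNIV. LINT y|lborel. ker_moment x l i y *\<^sub>R (g y $ i)) /\<^sub>R l"
      unfolding grad_pairD[OF U test_function_ker_moment[OF l]] by (simp add: sum_negf)
    finally show ?thesis .
  qed
  show "((\<lambda>h. (avg x U (l + h) - avg x U l) /\<^sub>R h) \<longlongrightarrow> (\<Sum>i\<in>UNIV. LINT y|lborel. ker_moment x l i y *\<^sub>R (g y $ i)) /\<^sub>R l) (at 0)"
    unfolding tendsto_at_iff_sequentially D[symmetric]
  proof (intro allI impI)
    fix X assume X0: "\<forall>i. X i \<in> UNIV - {0::real}" and X: "X \<longlonglongrightarrow> 0"
    obtain n0 where n0: "\<And>n. n \<ge> n0 \<Longrightarrow> \<bar>X n\<bar> < l / 2"
      using LIMSEQ_D[OF X, of "l / 2"] l by auto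
    \<comment> \<open>Dropping the first \<open>n0\<close> members makes every increment small
      enough for the Lipschitz bound; \<open>LIMSEQ_offset\<close> restores them at the end.\<close>
    define h where "h n = X (n + n0)" for n
    have h: "\<bar>h n\<bar> < l / 2" "h n \<noteq> 0" "l + h n > 0" for n
      using n0[of "n + n0"] X0 l by (auto simp: h_def abs_if split: if_splits)
    have hl: "h \<longlonglongrightarrow> 0" unfolding h_def using X by (rule LIMSEQ_ignore_initial_segment)
    have hat: "filterlim h (at 0) sequentially" using h(2) hl by (auto simp: filterlim_at)
    \<comment> \<open>The scales \<open>l + h n\<close> stay below \<open>2 * l\<close>, so a single
      cube of side \<open>2 * l\<close> contains the supports of all kernels in the
      sequence.\<close>
    have lim: "(\<lambda>n. LINT y|lborel. ((ker x (l + h n) y - ker x l y) / h n) *\<^sub>R U y) \<longlonglongrightarrow> (LINT y|lborel. ker_rate x l y *\<^sub>R U y)"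
    proof (rule integral_dominated_convergence[where w="\<lambda>y. norm (M *\<^sub>R (indicator (cbox x (x + (2 * l) *\<^sub>R vec 1)) y *\<^sub>R U y))"])
      show "integrable lborel (\<lambda>y. norm (M *\<^sub>R (indicator (cbox x (x + (2 * l) *\<^sub>R vec 1)) y *\<^sub>R U y)))"
        using L2_integrable_cbox[OF L(1)] unfolding set_integrable_def by (intro integrable_norm integrable_scaleR_right)
      show "AE y in lborel. (\<lambda>n. ((ker x (l + h n) y - ker x l y) / h n) *\<^sub>R U y) \<longlonglongrightarrow> ker_rate x l y *\<^sub>R U y"
      proof (rule AE_I2)
        fix y
        have "((\<lambda>h. (ker x (l + h) y - ker x l y) / h) \<longlongrightarrow> ker_rate x l y) (at 0)"
          using ker_deriv[OF l, of x y] by (simp add: DERIV_def)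
        from filterlim_compose[OF this hat]
        show "(\<lambda>n. ((ker x (l + h n) y - ker x l y) / h n) *\<^sub>R U y) \<longlonglongrightarrow> ker_rate x l y *\<^sub>R U y"
          by (intro tendsto_scaleR tendsto_const)
      qed
      show "AE y in lborel. norm (((ker x (l + h n) y - ker x l y) / h n) *\<^sub>R U y) \<le> norm (M *\<^sub>R (indicator (cbox x (x + (2 * l) *\<^sub>R vec 1)) y *\<^sub>R U y))" for n
      proof (rule AE_I2)
        fix y
        show "norm (((ker x (l + h n) y - ker x l y) / h n) *\<^sub>R U y) \<le> norm (M *\<^sub>R (indicator (cbox x (x + (2 * l) *\<^sub>R vec 1)) y *\<^sub>R U y))"
        proof (cases "y \<in> cbox x (x + (2 * l) *\<^sub>R vec 1)")
          case True
          have "\<bar>(ker x (l + h n) y - ker x l y) / h n\<bar> \<le> M" using lip[OF h(1), of n y] h(2)[of n] by (simp add: field_simps)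
          then have "\<bar>(ker x (l + h n) y - ker x l y) / h n\<bar> * norm (U y) \<le> M * norm (U y)"
            by (rule mult_right_mono) simp
          then show ?thesis using True M by simp
        next
          case False
          have "cbox x (x + r *\<^sub>R vec 1) \<subseteq> cbox x (x + (2 * l) *\<^sub>R vec 1)" if "r \<le> 2 * l" for r
            using that by (auto simp: mem_box_cart) (meson add_left_mono order_trans)
          then have "y \<notin> cbox x (x + r *\<^sub>R vec 1)" if "r \<le> 2 * l" for r using False that by blast
          moreover have "l + h n \<le> 2 * l" using h(1)[of n] l by linarith
          ultimately have "ker x (l + h n) y = 0" "ker x l y = 0" using h(3)[of n] l by (auto intro!: ker_eq_0)
          then show ?thesis by simp
        qed
      qed
      show "(\<lambda>y. ker_rate x l y *\<^sub>R U y) \<in> borel_measurable lborel"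
        unfolding ker_rate_def
        by (simp, intro borel_measurable_scaleR borel_measurable_divide borel_measurable_sum borel_measurable_const
            partial_deriv_measurable test_function_ker_moment l) simp
      show "(\<lambda>y. ((ker x (l + h n) y - ker x l y) / h n) *\<^sub>R U y) \<in> borel_measurable lborel" for n
      proof -
        note [measurable] = test_function_measurable[OF test_function_ker[OF l, of x]]
          test_function_measurable[OF test_function_ker[OF h(3)[of n], of x]]
        show ?thesis by simp
      qed
    qed
    have "(LINT y|lborel. ((ker x (l + h n) y - ker x l y) / h n) *\<^sub>R U y) = (avg x U (l + h n) - avg x U l) /\<^sub>R h n" for n
    proof -
      have "(LINT y|lborel. ((ker x (l + h n) y - ker x l y) / h n) *\<^sub>R U y) = (LINT y|lborel. (ker x (l + h n) y *\<^sub>R U y - ker x l y *\<^sub>R U y) /\<^sub>R h n)"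
        by (intro Bochner_Integration.integral_cong refl) (simp add: scaleR_diff_left[symmetric] divide_inverse mult.commute)
      then show ?thesis unfolding avg_def
        using integrable_ker[OF h(3) L(1), of x n] integrable_ker[OF l L(1), of x] by simp
    qed
    then have "(\<lambda>n. ((\<lambda>h. (avg x U (l + h) - avg x U l) /\<^sub>R h) \<circ> X) (n + n0)) \<longlonglongrightarrow> (LINT y|lborel. ker_rate x l y *\<^sub>R U y)"
      using lim by (simp add: h_def)
    then show "((\<lambda>h. (avg x U (l + h) - avg x U l) /\<^sub>R h) \<circ> X) \<longlonglongrightarrow> (LINT y|lborel. ker_rate x l y *\<^sub>R U y)"
      by (rule LIMSEQ_offset)
  qed
qed

lemma ker_moment_bound: "l > 0 \<Longrightarrow> \<bar>ker_moment x l i y\<bar> \<le> l * ker x l y"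
proof (cases "y \<in> cbox x (x + l *\<^sub>R vec 1)")
  case True
  then have "x $ i \<le> y $ i" "y $ i \<le> x $ i + l" by (auto simp: mem_box_cart)
  then have "\<bar>y $ i - x $ i\<bar> \<le> l" by simp
  moreover assume "l > 0"
  ultimately show ?thesis unfolding ker_moment_def abs_mult by (simp add: ker_nonneg mult_right_mono)
qed (simp add: ker_moment_def ker_eq_0)

text \<open>The number \<open>\<mu>\<close> stands for a bound on the maximal function of
  \<open>G\<close> at \<open>x\<close>, with balls measured by \<open>r ^ CARD('d)\<close> in place
  of their volume. The constant arises because the cube of side \<open>l\<close> lies in the ball of
  radius \<open>(1 + real CARD('d)) * l\<close> around its corner.\<close>

lemma ker_integral_ball_bound:
  fixes x :: "real^'d" and G :: "real^'d \<Rightarrow> real"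
  assumes l: "l > 0" and G: "L2_fun G" "\<And>y. 0 \<le> G y"
    and avg: "\<And>r. r > 0 \<Longrightarrow> (LINT y:ball x r|lborel. G y) \<le> \<mu> * r ^ CARD('d)"
  shows "(LINT y|lborel. ker x l y * G y) \<le> (1 + real CARD('d)) ^ CARD('d) * \<mu>"
proof -
  let ?r = "(1 + real CARD('d)) * l"
  have r: "?r > 0" using l by simp
  have bi: "integrable lborel (\<lambda>y. indicator (ball x ?r) y *\<^sub>R G y)"
  proof -
    obtain a b where "ball x ?r \<subseteq> cbox a b" using bounded_subset_cbox_symmetric[OF bounded_ball] by metis
    then have "set_integrable lborel (ball x ?r) G" by (intro set_integrable_subset[OF L2_integrable_cbox[OF G(1)]]) auto
    then show ?thesis by (simp add: set_integrable_def)
  qed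
  have "(LINT y|lborel. ker x l y * G y) \<le> (LINT y|lborel. 1 / l ^ CARD('d) * (indicator (ball x ?r) y *\<^sub>R G y))"
  proof (rule integral_mono)
    show "integrable lborel (\<lambda>y. ker x l y * G y)"
      using L2_scaleR_integrable[OF L2_fun_test_function[OF test_function_ker[OF l, of x]] G(1)] by simp
    show "integrable lborel (\<lambda>y. 1 / l ^ CARD('d) * (indicator (ball x ?r) y *\<^sub>R G y))" using bi by simp
    show "ker x l y * G y \<le> 1 / l ^ CARD('d) * (indicator (ball x ?r) y *\<^sub>R G y)" for y
      using ker_eq_0_ball[OF l, of y x] mult_right_mono[OF ker_le[OF l, of x y] G(2)[of y]]
      by (cases "y \<in> ball x ?r") auto
  qed
  also have "\<dots> = (LINT y:ball x ?r|lborel. G y) / l ^ CARD('d)" by (simp add: set_lebesgue_integral_def)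
  also have "\<dots> \<le> \<mu> * ?r ^ CARD('d) / l ^ CARD('d)" using avg[OF r] l by (intro divide_right_mono) auto
  also have "\<dots> = (1 + real CARD('d)) ^ CARD('d) * \<mu>" using l by (simp add: power_mult_distrib)
  finally show ?thesis .
qed

text \<open>The moments carry a factor \<open>l\<close> that cancels the \<open>1 / l\<close> in the
  derivative of the average. The Lipschitz constant therefore does not deteriorate as the scale
  tends to 0.\<close>

lemma avg_lipschitz:
  fixes x :: "real^'d" and G :: "real^'d \<Rightarrow> real"
  assumes U: "grad_pair U g" and G: "L2_fun G" "\<And>y. 0 \<le> G y"
    and avg: "\<And>r. r > 0 \<Longrightarrow> (LINT y:ball x r|lborel. G y) \<le> \<mu> * r ^ CARD('d)"
    and gG: "\<And>y. norm (g y) \<le> c * G y" and c: "c \<ge> 0"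
    and l: "0 < l'" "l' \<le> l"
  shows "norm (avg x U l - avg x U l') \<le> real CARD('d) * c * ((1 + real CARD('d)) ^ CARD('d) * \<mu>) * (l - l')"
proof -
  let ?M = "real CARD('d) * c * ((1 + real CARD('d)) ^ CARD('d) * \<mu>)"
  let ?D = "\<lambda>r. (\<Sum>i\<in>UNIV. LINT y|lborel. ker_moment x r i y *\<^sub>R (g y $ i)) /\<^sub>R r"
  have "norm (?D r) \<le> ?M" if r: "r > 0" for r
  proof -
    note kt = test_function_ker[OF r, of x]
    have i1: "integrable lborel (\<lambda>y. ker x r y * G y)"
      using L2_scaleR_integrable[OF L2_fun_test_function[OF kt] G(1)] by simp
    have "norm (LINT y|lborel. ker_moment x r i y *\<^sub>R (g y $ i)) \<le> r * c * ((1 + real CARD('d)) ^ CARD('d) * \<mu>)" for i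
    proof -
      have "norm (LINT y|lborel. ker_moment x r i y *\<^sub>R (g y $ i)) \<le> (LINT y|lborel. r * c * (ker x r y * G y))"
      proof (rule Bochner_Integration.integral_norm_bound_integral)
        show "integrable lborel (\<lambda>y. ker_moment x r i y *\<^sub>R (g y $ i))"
          by (rule grad_pair_integrable(3)[OF U test_function_ker_moment[OF r]])
        show "integrable lborel (\<lambda>y. r * c * (ker x r y * G y))" using i1 by simp
        show "norm (ker_moment x r i y *\<^sub>R (g y $ i)) \<le> r * c * (ker x r y * G y)" for y
        proof -
          have "norm (g y $ i) \<le> c * G y" using Finite_Cartesian_Product.norm_nth_le[of "g y" i] gG[of y] by simp
          then have "\<bar>ker_moment x r i y\<bar> * norm (g y $ i) \<le> (r * ker x r y) * (c * G y)"
            using ker_moment_bound[OF r, of x i y] r ker_nonneg[OF r, of x y] by (intro mult_mono) auto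
          then show ?thesis by (simp add: algebra_simps)
        qed
      qed
      also have "\<dots> = r * c * (LINT y|lborel. ker x r y * G y)" by simp
      also have "\<dots> \<le> r * c * ((1 + real CARD('d)) ^ CARD('d) * \<mu>)"
        using ker_integral_ball_bound[OF r G avg] r c by (intro mult_left_mono) auto
      finally show ?thesis .
    qed
    then have "norm (\<Sum>i\<in>UNIV. LINT y|lborel. ker_moment x r i y *\<^sub>R (g y $ i)) \<le> (\<Sum>i\<in>(UNIV::'d set). r * c * ((1 + real CARD('d)) ^ CARD('d) * \<mu>))"
      by (intro order_trans[OF norm_sum] sum_mono)
    then show ?thesis using r by (simp add: field_simps)
  qed
  then have "norm (avg x U l - avg x U l') \<le> ?M * norm (l - l')"
    using l by (intro differentiable_bound[of "{l'..}" _ "\<lambda>r h. h *\<^sub>R ?D r"])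
      (auto intro!: onorm_le has_vector_derivative_at_within[OF avg_has_vector_derivative[OF U]]
        simp: has_vector_derivative_def[symmetric] mult.commute mult_left_mono simp del: scaleR_scaleR)
  then show ?thesis using l by simp
qed

subsection \<open>The Lieb--Thirring inequality\<close>

lemma norm_sum_smult_le:
  fixes g :: "'k \<Rightarrow> complex^'d"
  shows "norm (\<Sum>k\<in>S. c k *s g k) \<le> sqrt (\<Sum>k\<in>S. (norm (c k))\<^sup>2) * sqrt (\<Sum>k\<in>S. (norm (g k))\<^sup>2)"
proof -
  have "norm (\<Sum>k\<in>S. c k *s g k) \<le> (\<Sum>k\<in>S. \<bar>norm (c k)\<bar> * \<bar>norm (g k)\<bar>)"
    by (intro order_trans[OF norm_sum] sum_mono) (simp add: norm_smult_vec)
  also have "\<dots> \<le> L2_set (\<lambda>k. norm (c k)) S * L2_set (\<lambda>k. norm (g k)) S" by (rule L2_set_mult_ineq)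
  finally show ?thesis by (simp add: L2_set_def)
qed

lemma norm_sum_mult_le:
  fixes g :: "'k \<Rightarrow> complex"
  shows "norm (\<Sum>k\<in>S. c k * g k) \<le> sqrt (\<Sum>k\<in>S. (norm (c k))\<^sup>2) * sqrt (\<Sum>k\<in>S. (norm (g k))\<^sup>2)"
proof -
  have "norm (\<Sum>k\<in>S. c k * g k) \<le> (\<Sum>k\<in>S. \<bar>norm (c k)\<bar> * \<bar>norm (g k)\<bar>)"
    by (intro order_trans[OF norm_sum] sum_mono) (simp add: norm_mult)
  also have "\<dots> \<le> L2_set (\<lambda>k. norm (c k)) S * L2_set (\<lambda>k. norm (g k)) S" by (rule L2_set_mult_ineq)
  finally show ?thesis by (simp add: L2_set_def)
qed

text \<open>With coefficients frozen at \<open>x\<close>, the averages of \<open>U\<close> tend to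
  \<open>bump_mass\<close> times the density \<open>\<rho>\<close> at \<open>x\<close>. At scale
  \<open>l\<close> they differ from this limit by at most a constant times
  \<open>sqrt \<rho> * \<mu> * l\<close>, since the gradient of \<open>U\<close> is at most
  \<open>sqrt \<rho> * G\<close>, while Cauchy--Schwarz and Bessel bound the average itself by
  \<open>sqrt \<rho> * sqrt (bump_mass / l ^ CARD('d))\<close>, up to the type argument of
  \<open>bump_mass\<close>. One factor \<open>sqrt \<rho>\<close> then cancels.\<close>

lemma density_pointwise_bound:
  fixes x :: "real^'d" and u :: "nat \<Rightarrow> real^'d \<Rightarrow> complex"
  assumes S: "finite S" "\<And>k. k \<in> S \<Longrightarrow> grad_pair (u k) (g k)"
    and orth: "\<And>j k. j \<in> S \<Longrightarrow> k \<in> S \<Longrightarrow> L2_inner (u j) (u k) = (if j = k then 1 else 0)"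
    and conv: "\<And>k. k \<in> S \<Longrightarrow> (avg x (u k) \<longlongrightarrow> bump_mass TYPE('d) *\<^sub>R u k x) (at_right 0)"
    and G: "L2_fun G" "\<And>y. G y = sqrt (\<Sum>k\<in>S. (norm (g k y))\<^sup>2)"
    and avg: "\<And>r. r > 0 \<Longrightarrow> (LINT y:ball x r|lborel. G y) \<le> \<mu> * r ^ CARD('d)"
    and l: "l > 0"
  shows "bump_mass TYPE('d) * sqrt (\<Sum>k\<in>S. (norm (u k x))\<^sup>2)
    \<le> sqrt (bump_mass TYPE('d) / l ^ CARD('d)) + real CARD('d) * (1 + real CARD('d)) ^ CARD('d) * \<mu> * l"
proof -
  let ?m = "bump_mass TYPE('d)"
  define \<rho> where "\<rho> = (\<Sum>k\<in>S. (norm (u k x))\<^sup>2)"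
  have \<rho>: "\<rho> \<ge> 0" unfolding \<rho>_def by (simp add: sum_nonneg)
  define C where "C = real CARD('d) * (1 + real CARD('d)) ^ CARD('d)"
  define U where "U y = (\<Sum>k\<in>S. cnj (u k x) * u k y)" for y
  define h where "h y = (\<Sum>k\<in>S. cnj (u k x) *s g k y)" for y
  have U: "grad_pair U h" unfolding U_def h_def using S by (intro grad_pair_sum) auto
  have G0: "0 \<le> G y" for y unfolding G(2) by (simp add: sum_nonneg)
  have hG: "norm (h y) \<le> sqrt \<rho> * G y" for y
    using norm_sum_smult_le[of "\<lambda>k. cnj (u k x)" "\<lambda>k. g k y" S] by (simp add: h_def G(2) \<rho>_def)
  have aU: "avg x U r = (\<Sum>k\<in>S. cnj (u k x) * avg x (u k) r)" if "r > 0" for r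
    unfolding U_def[abs_def] using S grad_pair_L2 that by (intro avg_sum) auto
  have lip: "norm (avg x U l - avg x U l') \<le> C * sqrt \<rho> * \<mu> * l" if l': "0 < l'" "l' \<le> l" for l'
  proof -
    have "0 \<le> (LINT y:ball x 1|lborel. G y)" unfolding set_lebesgue_integral_def by (intro integral_nonneg_AE AE_I2) (simp add: G0)
    then have \<mu>: "\<mu> \<ge> 0" using avg[of 1] by simp
    have "norm (avg x U l - avg x U l') \<le> real CARD('d) * sqrt \<rho> * ((1 + real CARD('d)) ^ CARD('d) * \<mu>) * (l - l')"
      using \<rho> by (intro avg_lipschitz[OF U G(1) G0 avg hG _ l']) auto
    also have "\<dots> \<le> real CARD('d) * sqrt \<rho> * ((1 + real CARD('d)) ^ CARD('d) * \<mu>) * l"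
      using l' \<rho> \<mu> by (intro mult_left_mono) auto
    finally show ?thesis by (simp add: C_def algebra_simps)
  qed
  have "((\<lambda>r. \<Sum>k\<in>S. cnj (u k x) * avg x (u k) r) \<longlongrightarrow> (\<Sum>k\<in>S. cnj (u k x) * (?m *\<^sub>R u k x))) (at_right 0)"
    using conv by (intro tendsto_sum tendsto_mult tendsto_const) auto
  moreover have "(\<Sum>k\<in>S. cnj (u k x) * (?m *\<^sub>R u k x)) = of_real (?m * \<rho>)"
    unfolding \<rho>_def of_real_mult of_real_sum complex_norm_square sum_distrib_left
    by (intro sum.cong refl) (simp add: scaleR_conv_of_real)
  ultimately have lim: "(avg x U \<longlongrightarrow> of_real (?m * \<rho>)) (at_right 0)"
    using aU by (auto elim!: Lim_transform_eventually simp: eventually_at_right_field intro!: exI[of _ 1])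
  have "norm (avg x U l - of_real (?m * \<rho>)) \<le> C * sqrt \<rho> * \<mu> * l"
  proof (rule tendsto_upperbound)
    show "((\<lambda>l'. norm (avg x U l - avg x U l')) \<longlongrightarrow> norm (avg x U l - of_real (?m * \<rho>))) (at_right 0)"
      by (intro tendsto_norm tendsto_diff tendsto_const lim)
    show "\<forall>\<^sub>F l' in at_right 0. norm (avg x U l - avg x U l') \<le> C * sqrt \<rho> * \<mu> * l"
      using lip l by (auto simp: eventually_at_right_field intro!: exI[of _ l])
  qed simp
  moreover have "norm (avg x U l) \<le> sqrt \<rho> * sqrt (?m / l ^ CARD('d))"
  proof -
    have "norm (avg x U l) \<le> sqrt \<rho> * sqrt (\<Sum>k\<in>S. (norm (avg x (u k) l))\<^sup>2)"
      unfolding aU[OF l] using norm_sum_mult_le[of "\<lambda>k. cnj (u k x)" "\<lambda>k. avg x (u k) l" S] by (simp add: \<rho>_def)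
    also have "\<dots> \<le> sqrt \<rho> * sqrt (?m / l ^ CARD('d))"
      using \<rho> S grad_pair_L2 by (intro mult_left_mono real_sqrt_le_mono avg_bessel[OF l] orth) auto
    finally show ?thesis .
  qed
  moreover have "norm (of_real (?m * \<rho>) :: complex) = ?m * \<rho>"
    using \<rho> bump_mass_pos[where 'd='d] by (simp add: norm_mult)
  moreover have "norm (of_real (?m * \<rho>) :: complex) \<le> norm (avg x U l) + norm (avg x U l - of_real (?m * \<rho>))"
    by (metis norm_minus_commute norm_triangle_sub)
  ultimately have m\<rho>: "?m * \<rho> \<le> sqrt \<rho> * sqrt (?m / l ^ CARD('d)) + C * sqrt \<rho> * \<mu> * l" by linarith
  have *: "sqrt \<rho> * (?m * sqrt \<rho>) \<le> sqrt \<rho> * (sqrt (?m / l ^ CARD('d)) + C * \<mu> * l)"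
  proof -
    have "sqrt \<rho> * (?m * sqrt \<rho>) = ?m * (sqrt \<rho> * sqrt \<rho>)" by (simp only: mult_ac)
    also have "\<dots> = ?m * \<rho>" using \<rho> by simp
    finally have e: "sqrt \<rho> * (?m * sqrt \<rho>) = ?m * \<rho>" .
    show ?thesis unfolding e using m\<rho> by (simp add: algebra_simps)
  qed
  \<comment> \<open>Cancelling \<open>sqrt \<rho>\<close> requires a positive density; for density 0
    the right-hand side is nonnegative because \<open>\<mu>\<close> bounds averages of the
    nonnegative \<open>G\<close>.\<close>
  have "?m * sqrt \<rho> \<le> sqrt (?m / l ^ CARD('d)) + C * \<mu> * l"
  proof (cases "\<rho> = 0")
    case True
    have "0 \<le> (LINT y:ball x 1|lborel. G y)" unfolding set_lebesgue_integral_def by (intro integral_nonneg_AE AE_I2) (simp add: G0)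
    then have "\<mu> \<ge> 0" using avg[of 1] by simp
    then show ?thesis using True l bump_mass_pos[where 'd='d] by (simp add: C_def)
  next
    case False
    then have "sqrt \<rho> > 0" using \<rho> by simp
    then show ?thesis using * mult_le_cancel_left_pos by blast
  qed
  then show ?thesis by (simp add: \<rho>_def C_def)
qed

text \<open>For positive \<open>\<rho>\<close> the scale with
  \<open>l ^ d = 4 / (m * \<rho>)\<close> makes the first summand equal to half of the left-hand
  side, so the second summand must carry the other half. The exponent \<open>1 / 2 + 1 / d\<close>
  is half of the Lieb--Thirring exponent.\<close>

lemma optimize_scale:
  fixes s m C \<mu> :: real and d :: nat
  assumes d: "d > 0" and m: "m > 0" and \<rho>: "\<rho> \<ge> 0"
    and le: "\<And>l. l > 0 \<Longrightarrow> m * sqrt \<rho> \<le> sqrt (m / l ^ d) + C * \<mu> * l"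
  shows "\<rho> powr (1 / 2 + 1 / real d) \<le> 2 * C / m * (4 / m) powr (1 / real d) * \<mu>"
proof (cases "\<rho> = 0")
  case True
  have "0 \<le> C * \<mu>"
  proof (rule ccontr)
    assume neg: "\<not> 0 \<le> C * \<mu>"
    \<comment> \<open>This choice gives \<open>C * \<mu> * l = C * \<mu> - sqrt m\<close>, while the
      first summand is at most \<open>sqrt m\<close>; the hypothesis would then force
      \<open>0 \<le> C * \<mu>\<close> after all.\<close>
    define l where "l = 1 + sqrt m / (- (C * \<mu>))"
    have l1: "l \<ge> 1" unfolding l_def using neg m by (simp add: divide_nonneg_neg not_le)
    have "sqrt (m / l ^ d) \<le> sqrt m" using l1 m one_le_power[OF l1, of d] by (simp add: divide_le_eq)
    moreover have "C * \<mu> * l = C * \<mu> - sqrt m"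
    proof -
      have "c * (1 + q / (- c)) = c - q" if "c \<noteq> 0" for c q :: real using that by (simp add: field_simps)
      moreover have "C * \<mu> \<noteq> 0" using neg by auto
      ultimately show ?thesis unfolding l_def by blast
    qed
    moreover have "0 \<le> sqrt (m / l ^ d) + C * \<mu> * l" using le[of l] l1 True by (simp del: real_sqrt_le_iff)
    ultimately show False using neg by linarith
  qed
  then have "0 \<le> C * \<mu> * (2 / m * (4 / m) powr (1 / real d))" using m by (rule_tac mult_nonneg_nonneg) auto
  then show ?thesis using True by (simp add: algebra_simps)
next
  case False
  then have \<rho>': "\<rho> > 0" using \<rho> by simp
  define l where "l = (4 / (m * \<rho>)) powr (1 / real d)"
  have l: "l > 0" unfolding l_def using m \<rho>' by simp
  have "l ^ d = 4 / (m * \<rho>)" unfolding l_def using d m \<rho>' by (simp add: powr_realpow[symmetric] powr_powr)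
  then have "sqrt (m / l ^ d) = sqrt ((m / 2)\<^sup>2 * \<rho>)" by (simp add: power2_eq_square)
  also have "\<dots> = m / 2 * sqrt \<rho>" using m by (simp add: real_sqrt_mult)
  finally have 1: "m / 2 * sqrt \<rho> \<le> C * \<mu> * l" using le[OF l] by simp
  have l2: "l = (4 / m) powr (1 / real d) * \<rho> powr (- (1 / real d))"
    unfolding l_def using m \<rho>' by (simp add: powr_mult powr_divide powr_minus field_simps)
  have "\<rho> powr (1 / 2 + 1 / real d) = sqrt \<rho> * \<rho> powr (1 / real d)"
    using \<rho>' by (simp add: powr_add powr_half_sqrt)
  also have "\<dots> \<le> (2 / m * (C * \<mu> * l)) * \<rho> powr (1 / real d)"
    using 1 m by (intro mult_right_mono) (auto simp: field_simps)
  also have "\<dots> = 2 * C / m * (4 / m) powr (1 / real d) * \<mu>"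
    unfolding l2 using \<rho>' by (simp add: powr_minus field_simps)
  finally show ?thesis .
qed

section \<open>The Hardy--Littlewood maximal inequality\<close>

lemma emeasure_UN_countable_le:
  assumes "countable I" "\<And>i. i \<in> I \<Longrightarrow> X i \<in> sets M"
  shows "emeasure M (\<Union>i\<in>I. X i) \<le> (\<integral>\<^sup>+i. emeasure M (X i) \<partial>count_space I)"
proof -
  have "emeasure M (\<Union>i\<in>I. X i) = (\<integral>\<^sup>+x. indicator (\<Union>i\<in>I. X i) x \<partial>M)"
    using assms by (intro nn_integral_indicator[symmetric] sets.countable_UN'') auto
  also have "\<dots> \<le> (\<integral>\<^sup>+x. (\<integral>\<^sup>+i. indicator (X i) x \<partial>count_space I) \<partial>M)"
  proof (rule nn_integral_mono)
    fix x
    show "indicator (\<Union>i\<in>I. X i) x \<le> (\<integral>\<^sup>+i. indicator (X i) x \<partial>count_space I)"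
    proof (cases "x \<in> (\<Union>i\<in>I. X i)")
      case True
      then obtain j where j: "j \<in> I" "x \<in> X j" by blast
      have "(1::ennreal) = (\<integral>\<^sup>+i. indicator {j} i \<partial>count_space I)" using j(1) by simp
      also have "\<dots> \<le> (\<integral>\<^sup>+i. indicator (X i) x \<partial>count_space I)"
        using j(2) by (intro nn_integral_mono) (auto simp: indicator_def)
      finally show ?thesis using True by simp
    qed simp
  qed
  also have "\<dots> = (\<integral>\<^sup>+i. (\<integral>\<^sup>+x. indicator (X i) x \<partial>M) \<partial>count_space I)"
    using assms by (intro nn_integral_count_space_nn_integral) auto
  also have "\<dots> = (\<integral>\<^sup>+i. emeasure M (X i) \<partial>count_space I)"
    using assms(2) by (intro nn_integral_cong) simp
  finally show ?thesis .
qed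

text \<open>The part of \<open>G\<close> below \<open>s / (2 V)\<close> contributes at most half of any average exceeding \<open>s\<close>.\<close>

lemma weak_type:
  fixes G :: "real^'d \<Rightarrow> real"
  assumes G: "L2_fun G" "\<And>y. 0 \<le> G y" and s: "s > 0" and A: "A \<in> sets borel"
    and big: "\<And>x. x \<in> A \<Longrightarrow> \<exists>r>0. s * r ^ CARD('d) < (LINT y:ball x r|lborel. G y)"
  defines "V \<equiv> measure lborel (ball (0::real^'d) 1)"
  shows "emeasure lborel A \<le> ennreal (2 * 5 ^ CARD('d) * V / s) * (\<integral>\<^sup>+y. ennreal (G y) * indicator {y. s / (2 * V) < G y} y \<partial>lborel)"
proof -
  note [measurable] = L2_fun_measurable[OF G(1)] A
  have vol: "measure lborel (ball x r) = V * r ^ CARD('d)" if "r \<ge> 0" for x :: "real^'d" and r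
    using that by (simp add: V_def content_ball)
  have volc: "measure lborel (cball x r) = V * r ^ CARD('d)" if "r \<ge> 0" for x :: "real^'d" and r
    using vol[OF that, of x] by (simp add: content_cball_conv_ball)
  have V: "V > 0" unfolding V_def by (simp add: content_ball_pos)
  define t where "t = s / (2 * V)"
  have t: "t > 0" using s V by (simp add: t_def)
  define H where "H y = G y * indicator {y. t < G y} y" for y
  have H0: "0 \<le> H y" for y using G(2) by (simp add: H_def)
  have Hm [measurable]: "H \<in> borel_measurable borel" unfolding H_def[abs_def] by measurable
  \<comment> \<open>Although \<open>G\<close> is only square-integrable, its upper part is
    integrable: where \<open>G\<close> exceeds \<open>t\<close> it is at most
    \<open>G\<^sup>2 / t\<close>.\<close>
  have Hi: "integrable lborel H"
  proof (rule Bochner_Integration.integrable_bound[of _ "\<lambda>y. (norm (G y))\<^sup>2 / t"])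
    show "integrable lborel (\<lambda>y. (norm (G y))\<^sup>2 / t)" using L2_fun_integrable[OF G(1)] by simp
    show "AE y in lborel. norm (H y) \<le> norm ((norm (G y))\<^sup>2 / t)"
    proof (rule AE_I2)
      fix y
      show "norm (H y) \<le> norm ((norm (G y))\<^sup>2 / t)"
        using G(2)[of y] t by (auto simp: H_def indicator_def field_simps power2_eq_square intro: mult_left_mono)
    qed
  qed simp
  have HiB: "integrable lborel (\<lambda>y. indicator B y * H y)" if "B \<in> sets borel" for B
    using that Hi by (simp add: integrable_mult_indicator[of B lborel H, simplified])
  have half: "\<exists>r>0. s / 2 * r ^ CARD('d) < (LINT y:ball x r|lborel. H y)" if x: "x \<in> A" for x
  proof -
    obtain r where r: "r > 0" "s * r ^ CARD('d) < (LINT y:ball x r|lborel. G y)" using big[OF x] by blast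
    have "(LINT y:ball x r|lborel. G y) \<le> (LINT y|lborel. indicator (ball x r) y * H y + t * indicator (ball x r) y)"
      unfolding set_lebesgue_integral_def
    proof (rule integral_mono)
      obtain a b where "ball x r \<subseteq> cbox a b" using bounded_subset_cbox_symmetric[OF bounded_ball] by metis
      then have "set_integrable lborel (ball x r) G" by (intro set_integrable_subset[OF L2_integrable_cbox[OF G(1)]]) auto
      then show "integrable lborel (\<lambda>y. indicator (ball x r) y *\<^sub>R G y)" by (simp add: set_integrable_def)
      have "integrable lborel (indicator (ball x r) :: _ \<Rightarrow> real)"
        by (intro integrable_real_indicator emeasure_bounded_finite bounded_ball) simp
      then show "integrable lborel (\<lambda>y. indicator (ball x r) y * H y + t * indicator (ball x r) y)"
        by (intro Bochner_Integration.integrable_add HiB integrable_mult_right) auto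
      show "indicator (ball x r) y *\<^sub>R G y \<le> indicator (ball x r) y * H y + t * indicator (ball x r) y" for y
        using t by (auto simp: H_def indicator_def)
    qed
    also have "\<dots> = (LINT y:ball x r|lborel. H y) + t * measure lborel (ball x r)"
    proof -
      have "integrable lborel (indicator (ball x r) :: _ \<Rightarrow> real)"
        by (intro integrable_real_indicator emeasure_bounded_finite bounded_ball) simp
      then show ?thesis unfolding set_lebesgue_integral_def using HiB[of "ball x r"] by simp
    qed
    also have "t * measure lborel (ball x r) = s / 2 * r ^ CARD('d)"
      using r(1) V by (simp add: vol t_def)
    finally show ?thesis using r by (intro exI[of _ r]) (simp add: field_simps)
  qed
  then obtain r where r: "\<And>x. x \<in> A \<Longrightarrow> r x > 0" "\<And>x. x \<in> A \<Longrightarrow> s / 2 * r x ^ CARD('d) < (LINT y:ball x (r x)|lborel. H y)"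
    by metis
  \<comment> \<open>Vitali's lemma asks for bounded radii. A radius above 1 is at most its own power
    with exponent the dimension, which the total integral of \<open>H\<close> controls.\<close>
  have rb: "r x \<le> 1 + (LINT y|lborel. H y) * 2 / s" if x: "x \<in> A" for x
  proof (cases "r x \<le> 1")
    case True
    then show ?thesis using s H0 by (simp add: add_increasing2)
  next
    case False
    have "(LINT y:ball x (r x)|lborel. H y) \<le> (LINT y|lborel. H y)"
      unfolding set_lebesgue_integral_def using HiB[of "ball x (r x)"] Hi H0
      by (intro integral_mono) (auto simp: indicator_def)
    then have "r x ^ CARD('d) \<le> (LINT y|lborel. H y) * 2 / s" using r(2)[OF x] s by (simp add: field_simps)
    moreover have "r x \<le> r x ^ CARD('d)" using False self_le_power[of "r x" "CARD('d)"] by simp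
    ultimately show ?thesis by linarith
  qed
  have "A \<subseteq> (\<Union>x\<in>A. cball x (r x))" using r(1) by force
  then obtain K where K: "countable K" "K \<subseteq> A" "pairwise (\<lambda>i j. disjnt (cball i (r i)) (cball j (r j))) K"
     "A \<subseteq> (\<Union>x\<in>K. cball x (5 * r x))"
    by (rule Vitali_covering_lemma_cballs[where a="\<lambda>x. x" and B="1 + (LINT y|lborel. H y) * 2 / s"]) (use r(1) rb in auto)
  \<comment> \<open>The factor 5 is the enlargement in Vitali's lemma. The volume of an enlarged
    ball is paid for by the integral of \<open>H\<close> over the original ball, and the selected
    original balls are disjoint, so these integrals add up to at most that of
    \<open>H\<close>.\<close>
  have bd: "emeasure lborel (cball x (5 * r x)) \<le> ennreal (2 * 5 ^ CARD('d) * V / s) * (\<integral>\<^sup>+y. ennreal (H y) * indicator (cball x (r x)) y \<partial>lborel)"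
    if x: "x \<in> A" for x
  proof -
    have "emeasure lborel (cball x (5 * r x)) = ennreal (V * (5 * r x) ^ CARD('d))"
      using volc[of "5 * r x" x] r(1)[OF x] emeasure_bounded_finite[OF bounded_cball, of x "5 * r x"]
      by (simp add: emeasure_eq_ennreal_measure)
    also have "\<dots> \<le> ennreal ((2 * 5 ^ CARD('d) * V / s) * (LINT y|lborel. indicator (cball x (r x)) y * H y))"
    proof (rule ennreal_leI)
      have "(LINT y:ball x (r x)|lborel. H y) \<le> (LINT y|lborel. indicator (cball x (r x)) y * H y)"
        unfolding set_lebesgue_integral_def using HiB[of "ball x (r x)"] HiB[of "cball x (r x)"] H0 ball_subset_cball[of x "r x"]
        by (intro integral_mono) (auto simp: indicator_def)
      then have "s / 2 * r x ^ CARD('d) \<le> (LINT y|lborel. indicator (cball x (r x)) y * H y)" using r(2)[OF x] by linarith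
      then have "(2 * 5 ^ CARD('d) * V / s) * (s / 2 * r x ^ CARD('d)) \<le> (2 * 5 ^ CARD('d) * V / s) * (LINT y|lborel. indicator (cball x (r x)) y * H y)"
        using s V by (intro mult_left_mono) auto
      moreover have "(2 * 5 ^ CARD('d) * V / s) * (s / 2 * r x ^ CARD('d)) = V * (5 * r x) ^ CARD('d)"
        using s by (simp add: power_mult_distrib)
      ultimately show "V * (5 * r x) ^ CARD('d) \<le> (2 * 5 ^ CARD('d) * V / s) * (LINT y|lborel. indicator (cball x (r x)) y * H y)" by simp
    qed
    also have "\<dots> = ennreal (2 * 5 ^ CARD('d) * V / s) * ennreal (LINT y|lborel. indicator (cball x (r x)) y * H y)"
      using s V H0 by (intro ennreal_mult) auto
    also have "ennreal (LINT y|lborel. indicator (cball x (r x)) y * H y) = (\<integral>\<^sup>+y. ennreal (indicator (cball x (r x)) y * H y) \<partial>lborel)"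
      using H0 by (intro nn_integral_eq_integral[symmetric] HiB) auto
    also have "\<dots> = (\<integral>\<^sup>+y. ennreal (H y) * indicator (cball x (r x)) y \<partial>lborel)"
      by (intro nn_integral_cong) (auto simp: indicator_def)
    finally show ?thesis .
  qed
  have disj: "disjoint_family_on (\<lambda>x. cball x (r x)) K"
    using K(3) by (auto simp: disjoint_family_on_def pairwise_def disjnt_def)
  have "emeasure lborel A \<le> emeasure lborel (\<Union>x\<in>K. cball x (5 * r x))"
    using K(1,4) by (intro emeasure_mono sets.countable_UN'') auto
  also have "\<dots> \<le> (\<integral>\<^sup>+x. emeasure lborel (cball x (5 * r x)) \<partial>count_space K)"
    by (intro emeasure_UN_countable_le) (use K(1) in auto)
  also have "\<dots> \<le> (\<integral>\<^sup>+x. ennreal (2 * 5 ^ CARD('d) * V / s) * (\<integral>\<^sup>+y. ennreal (H y) * indicator (cball x (r x)) y \<partial>lborel) \<partial>count_space K)"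
    using K(2) bd by (intro nn_integral_mono) auto
  also have "\<dots> = ennreal (2 * 5 ^ CARD('d) * V / s) * (\<integral>\<^sup>+x. (\<integral>\<^sup>+y. ennreal (H y) * indicator (cball x (r x)) y \<partial>lborel) \<partial>count_space K)"
    by (intro nn_integral_cmult) auto
  also have "(\<integral>\<^sup>+x. (\<integral>\<^sup>+y. ennreal (H y) * indicator (cball x (r x)) y \<partial>lborel) \<partial>count_space K)
      = (\<integral>\<^sup>+x. emeasure (Nonnegative_Lebesgue_Integration.density lborel H) (cball x (r x)) \<partial>count_space K)"
    by (intro nn_integral_cong) (simp add: emeasure_density)
  also have "\<dots> = emeasure (Nonnegative_Lebesgue_Integration.density lborel H) (\<Union>x\<in>K. cball x (r x))"
    by (intro emeasure_UN_countable[symmetric] disj) (use K(1) in auto)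
  also have "\<dots> \<le> emeasure (Nonnegative_Lebesgue_Integration.density lborel H) UNIV"
    by (intro emeasure_mono) auto
  also have "\<dots> = (\<integral>\<^sup>+y. ennreal (H y) \<partial>lborel)" by (subst emeasure_density) auto
  also have "\<dots> = (\<integral>\<^sup>+y. ennreal (G y) * indicator {y. s / (2 * V) < G y} y \<partial>lborel)"
    by (intro nn_integral_cong) (auto simp: H_def t_def indicator_def)
  finally show ?thesis by (simp add: mult_left_mono)
qed


lemma nn_integral_square_layer:
  assumes "a \<ge> (0::real)"
  shows "(\<integral>\<^sup>+s. ennreal (2 * s) * indicator {0<..<a} s \<partial>lborel) = ennreal (a\<^sup>2)"
proof -
  have "(\<integral>\<^sup>+s. ennreal (2 * s) * indicator {0<..<a} s \<partial>lborel) = (\<integral>\<^sup>+s. ennreal (2 * s) * indicator {0..a} s \<partial>lborel)"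
    by (rule nn_integral_cong_AE, rule AE_mp[OF AE_lborel_singleton[of 0]], rule AE_mp[OF AE_lborel_singleton[of a]])
      (auto simp: indicator_def)
  also have "\<dots> = ennreal (a\<^sup>2 - 0\<^sup>2)"
    by (rule nn_integral_FTC_Icc) (use assms in \<open>auto intro!: derivative_eq_intros\<close>)
  finally show ?thesis by simp
qed

text \<open>Any measurable \<open>F\<close> below all bounds for the ball averages of
  \<open>G\<close> takes the role of the maximal function, whose own measurability then does not
  have to be addressed. The proof is Marcinkiewicz interpolation: layer-cake formula for
  \<open>F\<close>, the weak bound with a truncation height proportional to the level, and an
  exchange of integrals.\<close>

lemma strong_type:
  fixes F G :: "real^'d \<Rightarrow> real"
  assumes G: "L2_fun G" "\<And>y. 0 \<le> G y" and F: "F \<in> borel_measurable borel" "\<And>x. 0 \<le> F x"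
    and FG: "AE x in lborel. \<forall>s>0. (\<forall>r>0. (LINT y:ball x r|lborel. G y) \<le> s * r ^ CARD('d)) \<longrightarrow> F x \<le> s"
  defines "V \<equiv> measure lborel (ball (0::real^'d) 1)"
  shows "(\<integral>\<^sup>+x. ennreal ((F x)\<^sup>2) \<partial>lborel) \<le> ennreal (8 * 5 ^ CARD('d) * V\<^sup>2) * (\<integral>\<^sup>+y. ennreal ((G y)\<^sup>2) \<partial>lborel)"
proof -
  note [measurable] = L2_fun_measurable[OF G(1)] F(1)
  have V: "V > 0" unfolding V_def by (simp add: content_ball_pos)
  define K where "K = 2 * 5 ^ CARD('d) * V"
  have K: "K > 0" using V by (simp add: K_def)
  \<comment> \<open>The weak bound needs large averages at every point of the set, so the null set
    where the hypothesis may fail is removed from each superlevel set.\<close>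
  obtain N where N: "N \<in> null_sets lborel" "{x. \<not> (\<forall>s>0. (\<forall>r>0. (LINT y:ball x r|lborel. G y) \<le> s * r ^ CARD('d)) \<longrightarrow> F x \<le> s)} \<subseteq> N"
    using FG unfolding eventually_ae_filter by auto
  have level: "emeasure lborel {x. s < F x} \<le> ennreal (K / s) * (\<integral>\<^sup>+y. ennreal (G y) * indicator {y. s / (2 * V) < G y} y \<partial>lborel)"
    if s: "s > 0" for s
  proof -
    have "emeasure lborel {x. s < F x} = emeasure lborel ({x. s < F x} - N)"
      using N(1) by (intro emeasure_Diff_null_set[symmetric]) auto
    also have "\<dots> \<le> ennreal (2 * 5 ^ CARD('d) * V / s) * (\<integral>\<^sup>+y. ennreal (G y) * indicator {y. s / (2 * V) < G y} y \<partial>lborel)"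
      unfolding V_def
    proof (rule weak_type[OF G s])
      show "{x. s < F x} - N \<in> sets borel" using N(1) by auto
      fix x assume x: "x \<in> {x. s < F x} - N"
      then have "x \<notin> {x. \<not> (\<forall>s>0. (\<forall>r>0. (LINT y:ball x r|lborel. G y) \<le> s * r ^ CARD('d)) \<longrightarrow> F x \<le> s)}"
        using N(2) by blast
      then have "\<forall>s>0. (\<forall>r>0. (LINT y:ball x r|lborel. G y) \<le> s * r ^ CARD('d)) \<longrightarrow> F x \<le> s" by blast
      then have "(\<forall>r>0. (LINT y:ball x r|lborel. G y) \<le> s * r ^ CARD('d)) \<longrightarrow> F x \<le> s" using s by blast
      then show "\<exists>r>0. s * r ^ CARD('d) < (LINT y:ball x r|lborel. G y)" using x by (auto simp: not_le)
    qed
    finally show ?thesis by (simp add: K_def)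
  qed
  have "(\<integral>\<^sup>+x. ennreal ((F x)\<^sup>2) \<partial>lborel) = (\<integral>\<^sup>+x. (\<integral>\<^sup>+s. ennreal (2 * s) * indicator {0<..<F x} s \<partial>lborel) \<partial>lborel)"
    by (simp add: nn_integral_square_layer F(2))
  also have "\<dots> = (\<integral>\<^sup>+x. (\<integral>\<^sup>+s. (\<lambda>(x, s). if 0 < s \<and> s < F x then ennreal (2 * s) else 0) (x, s) \<partial>lborel) \<partial>lborel)"
    by (intro nn_integral_cong) (auto simp: indicator_def)
  also have "\<dots> = (\<integral>\<^sup>+s. (\<integral>\<^sup>+x. (\<lambda>(x, s). if 0 < s \<and> s < F x then ennreal (2 * s) else 0) (x, s) \<partial>lborel) \<partial>lborel)"
    by (rule lborel_pair.Fubini'[symmetric]) measurable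
  also have "\<dots> = (\<integral>\<^sup>+s. (if 0 < s then ennreal (2 * s) else 0) * emeasure lborel {x. s < F x} \<partial>lborel)"
  proof (rule nn_integral_cong)
    fix s :: real
    have "(\<integral>\<^sup>+x. (\<lambda>(x, s). if 0 < s \<and> s < F x then ennreal (2 * s) else 0) (x, s) \<partial>lborel)
        = (\<integral>\<^sup>+x. (if 0 < s then ennreal (2 * s) else 0) * indicator {x. s < F x} x \<partial>lborel)"
      by (intro nn_integral_cong) (auto simp: indicator_def)
    also have "\<dots> = (if 0 < s then ennreal (2 * s) else 0) * emeasure lborel {x. s < F x}"
      by (rule nn_integral_cmult_indicator) simp
    finally show "(\<integral>\<^sup>+x. (\<lambda>(x, s). if 0 < s \<and> s < F x then ennreal (2 * s) else 0) (x, s) \<partial>lborel)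
        = (if 0 < s then ennreal (2 * s) else 0) * emeasure lborel {x. s < F x}" .
  qed
  also have "\<dots> \<le> (\<integral>\<^sup>+s. (\<integral>\<^sup>+y. (\<lambda>(y, s). if 0 < s \<and> s < 2 * V * G y then ennreal (2 * K * G y) else 0) (y, s) \<partial>lborel) \<partial>lborel)"
  proof (rule nn_integral_mono)
    fix s :: real
    show "(if 0 < s then ennreal (2 * s) else 0) * emeasure lborel {x. s < F x}
        \<le> (\<integral>\<^sup>+y. (\<lambda>(y, s). if 0 < s \<and> s < 2 * V * G y then ennreal (2 * K * G y) else 0) (y, s) \<partial>lborel)"
    proof (cases "s > 0")
      case True
      have "ennreal (2 * s) * emeasure lborel {x. s < F x} \<le> ennreal (2 * s) * (ennreal (K / s) * (\<integral>\<^sup>+y. ennreal (G y) * indicator {y. s / (2 * V) < G y} y \<partial>lborel))"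
        by (intro mult_left_mono level True) simp
      also have "\<dots> = ennreal (2 * K) * (\<integral>\<^sup>+y. ennreal (G y) * indicator {y. s / (2 * V) < G y} y \<partial>lborel)"
        using True K by (simp add: mult.assoc[symmetric] ennreal_mult[symmetric])
      also have "\<dots> = (\<integral>\<^sup>+y. ennreal (2 * K) * (ennreal (G y) * indicator {y. s / (2 * V) < G y} y) \<partial>lborel)"
        by (intro nn_integral_cmult[symmetric]) measurable
      also have "\<dots> = (\<integral>\<^sup>+y. (\<lambda>(y, s). if 0 < s \<and> s < 2 * V * G y then ennreal (2 * K * G y) else 0) (y, s) \<partial>lborel)"
        using True K V G(2) by (intro nn_integral_cong) (auto simp: indicator_def ennreal_mult[symmetric] field_simps)
      finally show ?thesis using True by simp
    qed simp
  qed
  also have "\<dots> = (\<integral>\<^sup>+y. (\<integral>\<^sup>+s. (\<lambda>(y, s). if 0 < s \<and> s < 2 * V * G y then ennreal (2 * K * G y) else 0) (y, s) \<partial>lborel) \<partial>lborel)"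
    by (rule lborel_pair.Fubini') measurable
  \<comment> \<open>At level \<open>s\<close> only points with \<open>s < 2 * V * G y\<close>
    contribute, so the integral over \<open>s\<close> is the length \<open>2 * V * G y\<close> times
    the integrand \<open>2 * K * G y\<close>.\<close>
  also have "\<dots> = (\<integral>\<^sup>+y. ennreal (4 * K * V) * ennreal ((G y)\<^sup>2) \<partial>lborel)"
  proof (rule nn_integral_cong)
    fix y
    have "(\<integral>\<^sup>+s. (\<lambda>(y, s). if 0 < s \<and> s < 2 * V * G y then ennreal (2 * K * G y) else 0) (y, s) \<partial>lborel)
        = (\<integral>\<^sup>+s. ennreal (2 * K * G y) * indicator {0<..<2 * V * G y} s \<partial>lborel)"
      by (intro nn_integral_cong) (auto simp: indicator_def)
    also have "\<dots> = ennreal (2 * K * G y) * ennreal (2 * V * G y)"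
      using V G(2)[of y] by (subst nn_integral_cmult_indicator) auto
    also have "\<dots> = ennreal (4 * K * V) * ennreal ((G y)\<^sup>2)"
      using V K G(2)[of y] by (simp add: ennreal_mult[symmetric] power2_eq_square algebra_simps)
    finally show "(\<integral>\<^sup>+s. (\<lambda>(y, s). if 0 < s \<and> s < 2 * V * G y then ennreal (2 * K * G y) else 0) (y, s) \<partial>lborel)
        = ennreal (4 * K * V) * ennreal ((G y)\<^sup>2)" .
  qed
  also have "\<dots> = ennreal (8 * 5 ^ CARD('d) * V\<^sup>2) * (\<integral>\<^sup>+y. ennreal ((G y)\<^sup>2) \<partial>lborel)"
  proof -
    have "4 * K * V = 8 * 5 ^ CARD('d) * V\<^sup>2" by (simp add: K_def power2_eq_square)
    then show ?thesis unfolding \<open>4 * K * V = _\<close> by (intro nn_integral_cmult) simp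
  qed
  finally show ?thesis .
qed

lemma density_measurable [measurable]:
  assumes "\<And>k. k \<in> {1..N} \<Longrightarrow> u k \<in> H1" shows "density N u \<in> borel_measurable borel"
proof -
  have "u k \<in> borel_measurable borel" if "k \<in> {1..N}" for k
    using assms[OF that] by (auto simp: H1_def L2_fun_def)
  then show ?thesis unfolding density_def[abs_def] by (intro borel_measurable_sum borel_measurable_power borel_measurable_norm) auto
qed

lemma density_nonneg: "0 \<le> density N u x"
  by (simp add: density_def sum_nonneg)

text \<open>The optimized pointwise bound puts the power \<open>1 / 2 + 1 / d\<close> of the density
  below every bound for the averages of \<open>G\<close>, and squaring gives the exponent
  \<open>1 + 2 / d\<close>, while the squared norm of \<open>G\<close> is the total kinetic energy.
  Nonnegative integrals are used because integrability of the power is itself a consequence.\<close>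

theorem lieb_thirring_nn:
  "\<exists>C>0. \<forall>N. \<forall>u :: nat \<Rightarrow> real^'d \<Rightarrow> complex. orthonormal_H1 N u \<longrightarrow>
    (\<integral>\<^sup>+x. ennreal (density N u x powr (1 + 2 / real CARD('d))) \<partial>lborel) \<le> ennreal (C * (\<Sum>k=1..N. kinetic (u k)))"
proof -
  let ?d = "real CARD('d)" and ?m = "bump_mass TYPE('d)"
  define V where "V = measure lborel (ball (0::real^'d) 1)"
  have V: "V > 0" unfolding V_def by (simp add: content_ball_pos)
  have m: "?m > 0" by (rule bump_mass_pos)
  define C1 where "C1 = ?d * (1 + ?d) ^ CARD('d)"
  have C1: "C1 > 0" unfolding C1_def by (intro mult_pos_pos zero_less_power) auto
  define C2 where "C2 = 2 * C1 / ?m * (4 / ?m) powr (1 / ?d)"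
  have C2: "C2 > 0" unfolding C2_def using C1 m by (intro mult_pos_pos divide_pos_pos) auto
  define C where "C = C2\<^sup>2 * (8 * 5 ^ CARD('d) * V\<^sup>2)"
  have C: "C > 0" using C2 V by (simp add: C_def)
  show ?thesis
  proof (intro exI[of _ C] conjI C allI impI)
    fix N and u :: "nat \<Rightarrow> real^'d \<Rightarrow> complex" assume on: "orthonormal_H1 N u"
    define g where "g k = weak_gradient (u k)" for k
    have gp: "grad_pair (u k) (g k)" if "k \<in> {1..N}" for k
      unfolding g_def using on that by (intro grad_pair_weak_gradient) (auto simp: orthonormal_H1_def)
    have orth: "\<And>j k. j \<in> {1..N} \<Longrightarrow> k \<in> {1..N} \<Longrightarrow> L2_inner (u j) (u k) = (if j = k then 1 else 0)"
      using on by (auto simp: orthonormal_H1_def)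
    define G where "G y = sqrt (\<Sum>k=1..N. (norm (g k y))\<^sup>2)" for y
    have G0: "0 \<le> G y" for y by (simp add: G_def sum_nonneg)
    have G2: "(G y)\<^sup>2 = (\<Sum>k=1..N. (norm (g k y))\<^sup>2)" for y by (simp add: G_def sum_nonneg)
    have gi: "integrable lborel (\<lambda>y. (norm (g k y))\<^sup>2)" if "k \<in> {1..N}" for k
      using L2_fun_integrable[OF grad_pair_L2(2)[OF gp[OF that]]] .
    have G2i: "integrable lborel (\<lambda>y. (G y)\<^sup>2)" unfolding G2 by (intro Bochner_Integration.integrable_sum gi)
    have Gm: "G \<in> borel_measurable borel" unfolding G_def[abs_def]
      by (rule measurable_compose[OF _ borel_measurable_sqrt])
        (intro borel_measurable_sum borel_measurable_power borel_measurable_norm measurable_compose[OF _ borel_measurable_norm] L2_fun_measurable grad_pair_L2(2)[OF gp])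
    have GL: "L2_fun G" using Gm G2i by (simp add: L2_fun_def)
    have intG: "(LINT y|lborel. (G y)\<^sup>2) = (\<Sum>k=1..N. kinetic (u k))"
      unfolding G2 using kinetic_eq[OF gp] gi by (subst Bochner_Integration.integral_sum) auto
    \<comment> \<open>Dividing by \<open>C2\<close> turns the optimized bound into the plain
      condition that \<open>F x\<close> is at most every admissible \<open>s\<close>.\<close>
    define F where "F x = density N u x powr (1 / 2 + 1 / ?d) / C2" for x
    have [measurable]: "density N u \<in> borel_measurable borel"
      using on by (intro density_measurable) (auto simp: orthonormal_H1_def)
    have "(\<integral>\<^sup>+x. ennreal ((F x)\<^sup>2) \<partial>lborel) \<le> ennreal (8 * 5 ^ CARD('d) * V\<^sup>2) * (\<integral>\<^sup>+y. ennreal ((G y)\<^sup>2) \<partial>lborel)"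
      unfolding V_def
    proof (rule strong_type[OF GL G0])
      show "F \<in> borel_measurable borel" unfolding F_def[abs_def] by measurable
      show "0 \<le> F x" for x using C2 by (simp add: F_def)
      have "AE x in lborel. \<forall>k\<in>{1..N}. (avg x (u k) \<longlongrightarrow> ?m *\<^sub>R u k x) (at_right 0)"
        by (intro AE_finite_allI AE_avg_tendsto grad_pair_L2(1)[OF gp]) auto
      then show "AE x in lborel. \<forall>s>0. (\<forall>r>0. (LINT y:ball x r|lborel. G y) \<le> s * r ^ CARD('d)) \<longrightarrow> F x \<le> s"
      proof (rule AE_mp, intro AE_I2 impI allI)
        fix x and s :: real
        assume conv: "\<forall>k\<in>{1..N}. (avg x (u k) \<longlongrightarrow> ?m *\<^sub>R u k x) (at_right 0)" and "s > 0"
          and av: "\<forall>r>0. (LINT y:ball x r|lborel. G y) \<le> s * r ^ CARD('d)"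
        have "?m * sqrt (density N u x) \<le> sqrt (?m / l ^ CARD('d)) + C1 * s * l" if l: "l > 0" for l
          unfolding density_def C1_def
          by (rule density_pointwise_bound[OF finite_atLeastAtMost gp orth _ GL G_def _ l]) (use conv av in auto)
        from optimize_scale[OF _ m density_nonneg this]
        have "density N u x powr (1 / 2 + 1 / ?d) \<le> C2 * s" by (simp add: C2_def)
        then show "F x \<le> s" using C2 by (simp add: F_def field_simps)
      qed
    qed
    also have "(\<integral>\<^sup>+y. ennreal ((G y)\<^sup>2) \<partial>lborel) = ennreal (\<Sum>k=1..N. kinetic (u k))"
      using nn_integral_eq_integral[OF G2i] intG by simp
    finally have FK: "(\<integral>\<^sup>+x. ennreal ((F x)\<^sup>2) \<partial>lborel) \<le> ennreal (8 * 5 ^ CARD('d) * V\<^sup>2) * ennreal (\<Sum>k=1..N. kinetic (u k))" .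
    have "density N u x powr (1 + 2 / ?d) = C2\<^sup>2 * (F x)\<^sup>2" for x
    proof -
      have "(density N u x powr (1 / 2 + 1 / ?d))\<^sup>2 = density N u x powr (1 + 2 / ?d)"
        by (simp add: power2_eq_square powr_add[symmetric] add_divide_distrib[symmetric])
      then show ?thesis using C2 by (simp add: F_def power_divide)
    qed
    then have "(\<integral>\<^sup>+x. ennreal (density N u x powr (1 + 2 / ?d)) \<partial>lborel) = ennreal (C2\<^sup>2) * (\<integral>\<^sup>+x. ennreal ((F x)\<^sup>2) \<partial>lborel)"
      by (simp add: ennreal_mult nn_integral_cmult F_def)
    also have "\<dots> \<le> ennreal (C2\<^sup>2) * (ennreal (8 * 5 ^ CARD('d) * V\<^sup>2) * ennreal (\<Sum>k=1..N. kinetic (u k)))"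
      by (intro mult_left_mono FK) simp
    also have "\<dots> = ennreal (C * (\<Sum>k=1..N. kinetic (u k)))"
      by (simp add: C_def ennreal_mult[symmetric] sum_nonneg kinetic_nonneg mult.assoc)
    finally show "(\<integral>\<^sup>+x. ennreal (density N u x powr (1 + 2 / ?d)) \<partial>lborel) \<le> ennreal (C * (\<Sum>k=1..N. kinetic (u k)))" .
  qed
qed

subsection \<open>The energy per particle is bounded from below\<close>

lemma powr_le_tangent:
  fixes t a :: real
  assumes "0 \<le> t" "0 < a" "a < 1" shows "t powr a \<le> 1 + a * (t - 1)"
proof (cases "t = 0")
  case True
  then show ?thesis using assms by simp
next
  case False
  have "t powr a * 1 powr (1 - a) \<le> a * t + (1 - a) * 1"
    by (rule Youngs_inequality_0) (use assms False in auto)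
  then show ?thesis by (simp add: algebra_simps)
qed

text \<open>The concave tangent bound for the exponent \<open>1 / q\<close>, applied to
  \<open>t powr q\<close>. Integrated against a measure it becomes Jensen's inequality for trial
  densities.\<close>

lemma powr_ge_tangent:
  fixes t q :: real
  assumes "0 \<le> t" "1 < q" shows "1 + q * (t - 1) \<le> t powr q"
proof (cases "t = 0")
  case True
  then show ?thesis using assms by simp
next
  case False
  have "(t powr q) powr (1 / q) \<le> 1 + (1 / q) * (t powr q - 1)"
    by (rule powr_le_tangent) (use assms in auto)
  then show ?thesis using assms False by (simp add: powr_powr field_simps)
qed

text \<open>The substitution \<open>s = r\<^bsup>2/d\<^esup>\<close> turns the energy per unit mass into \<open>c s - s\<^bsup>a\<^esup> / p\<close> with
  \<open>a = d (p - 1) / 2 < 1\<close>, whose minimum over \<open>s\<close> is the constant.\<close>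

lemma energy_profile:
  fixes c d p :: real
  assumes c: "c > 0" and d: "d > 0" and p: "1 < p" "p < 1 + 2 / d"
  shows e_of_constant_le: "r > 0 \<Longrightarrow> e_of_constant c d p \<le> c * r powr (2 / d) - r powr (p - 1) / p"
    and e_of_constant_attained: "\<exists>r>0. c * r powr (2 / d) - r powr (p - 1) / p = e_of_constant c d p"
    and e_of_constant_neg: "e_of_constant c d p < 0"
proof -
  define a where "a = d * (p - 1) / 2"
  have a: "0 < a" "a < 1" using d p by (auto simp: a_def field_simps)
  define B where "B = a / (p * c)"
  have B: "B > 0" using a p c by (simp add: B_def)
  \<comment> \<open>The zero of the derivative \<open>c - a * s powr (a - 1) / p\<close>; there
    \<open>s0 powr (1 - a) = B\<close>.\<close>
  define s0 where "s0 = B powr (1 / (1 - a))"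
  have s0: "s0 > 0" using B by (simp add: s0_def)
  have crit: "s0 powr a * a / p = c * s0"
  proof -
    have "s0 powr a * B = B powr (a / (1 - a) + 1)" using B by (simp add: s0_def powr_powr powr_add)
    also have "a / (1 - a) + 1 = 1 / (1 - a)" using a by (simp add: field_simps)
    finally have "s0 powr a * B = s0" by (simp add: s0_def)
    then show ?thesis using p c by (simp add: B_def field_simps)
  qed
  have e: "e_of_constant c d p = - (s0 powr a * (1 - a) / p)"
  proof -
    have 1: "(1 + 2 / d - p) * (d / (2 * p)) = (1 - a) / p" using d p by (simp add: a_def field_simps)
    have 2: "d * (p - 1) / (2 * p * c) = B" using p c by (simp add: a_def B_def field_simps)
    have "(p - 1) / (1 + 2 / d - p) = (d * (p - 1)) / (d * (1 + 2 / d - p))" using d by simp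
    also have "d * (p - 1) = 2 * a" by (simp add: a_def)
    also have "d * (1 + 2 / d - p) = 2 * (1 - a)" using d by (simp add: a_def field_simps)
    also have "2 * a / (2 * (1 - a)) = a / (1 - a)" using a by (simp add: field_simps)
    finally have 3: "(p - 1) / (1 + 2 / d - p) = a / (1 - a)" .
    have "e_of_constant c d p = - ((1 - a) / p) * B powr (a / (1 - a))"
      unfolding e_of_constant_def 2 3 by (simp only: mult_minus_left 1)
    then show ?thesis using B by (simp add: s0_def powr_powr)
  qed
  have prof: "c * r powr (2 / d) - r powr (p - 1) / p = c * s - s powr a / p" if "r > 0" "s = r powr (2 / d)" for r s
  proof -
    have "2 / d * a = p - 1" using d by (simp add: a_def)
    then have "s powr a = r powr (p - 1)" unfolding that(2) powr_powr by simp
    then show ?thesis using that by simp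
  qed
  have val: "c * s0 - s0 powr a / p = e_of_constant c d p"
    unfolding e crit[symmetric] using p by (simp add: field_simps)
  show "e_of_constant c d p < 0" unfolding e using a s0 p by (simp add: mult_pos_pos divide_pos_pos)
  show "e_of_constant c d p \<le> c * r powr (2 / d) - r powr (p - 1) / p" if r: "r > 0"
  proof -
    define s where "s = r powr (2 / d)"
    have s: "s > 0" using r by (simp add: s_def)
    \<comment> \<open>By concavity \<open>s powr a\<close> lies below its tangent at
      \<open>s0\<close>, and the critical point equation makes the slope of
      \<open>s powr a / p\<close> there equal to \<open>c\<close>, so the linear terms
      cancel.\<close>
    have "s powr a = s0 powr a * (s / s0) powr a" using s s0 by (simp add: powr_mult[symmetric])
    also have "\<dots> \<le> s0 powr a * (1 + a * (s / s0 - 1))"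
      using s s0 a by (intro mult_left_mono powr_le_tangent) auto
    finally have "s powr a / p \<le> s0 powr a * (1 + a * (s / s0 - 1)) / p" using p by (simp add: divide_right_mono)
    also have "\<dots> = s0 powr a / p + (s0 powr a * a / p) * (s / s0 - 1)" using p by (simp add: field_simps)
    also have "\<dots> = s0 powr a / p + c * (s - s0)" unfolding crit using s0 by (simp add: field_simps)
    finally have "c * s0 - s0 powr a / p \<le> c * s - s powr a / p" by (simp add: algebra_simps)
    then show ?thesis using prof[OF r s_def] val by simp
  qed
  show "\<exists>r>0. c * r powr (2 / d) - r powr (p - 1) / p = e_of_constant c d p"
  proof (intro exI conjI)
    show r: "s0 powr (d / 2) > 0" using s0 by simp
    have "s0 = (s0 powr (d / 2)) powr (2 / d)" using s0 d by (simp add: powr_powr)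
    from prof[OF r this] show "c * (s0 powr (d / 2)) powr (2 / d) - (s0 powr (d / 2)) powr (p - 1) / p = e_of_constant c d p"
      unfolding val .
  qed
qed

lemma energy_density_ge:
  fixes c d p r :: real
  assumes "c > 0" "d > 0" "1 < p" "p < 1 + 2 / d" "r \<ge> 0"
  shows "e_of_constant c d p * r \<le> c * r powr (1 + 2 / d) - r powr p / p"
proof (cases "r = 0")
  case False
  then have r: "r > 0" using assms by simp
  have "e_of_constant c d p * r \<le> (c * r powr (2 / d) - r powr (p - 1) / p) * r"
    using e_of_constant_le[OF assms(1-4) r] r by (intro mult_right_mono) auto
  also have "\<dots> = c * (r * r powr (2 / d)) - (r * r powr (p - 1)) / p" by (simp add: algebra_simps)
  also have "r * r powr (2 / d) = r powr (1 + 2 / d)" using r by (simp add: powr_add)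
  also have "r * r powr (p - 1) = r powr p" using r by (simp add: powr_mult_base)
  finally show ?thesis .
qed (use assms in simp)

lemma orthonormal_H1D:
  assumes "orthonormal_H1 N u" "k \<in> {1..N}"
  shows "u k \<in> H1" "grad_pair (u k) (weak_gradient (u k))" "L2_fun (u k)"
proof -
  show "u k \<in> H1" using assms by (auto simp: orthonormal_H1_def)
  then show "grad_pair (u k) (weak_gradient (u k))" by (rule grad_pair_weak_gradient)
  then show "L2_fun (u k)" by (rule grad_pair_L2)
qed

lemma orthonormal_density:
  fixes u :: "nat \<Rightarrow> real^'d \<Rightarrow> complex"
  assumes "orthonormal_H1 N u"
  shows "integrable lborel (density N u)" "(LINT x|lborel. density N u x) = real N"
    "density N u \<in> borel_measurable borel"
proof -
  have i: "integrable lborel (\<lambda>x. (norm (u k x))\<^sup>2)" if "k \<in> {1..N}" for k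
    using L2_fun_integrable orthonormal_H1D(3)[OF assms that] by blast
  then show "integrable lborel (density N u)" unfolding density_def[abs_def] by (intro Bochner_Integration.integrable_sum)
  have "(LINT x|lborel. (norm (u k x))\<^sup>2) = 1" if "k \<in> {1..N}" for k
    using assms that L2_inner_self[of "u k"] by (auto simp: orthonormal_H1_def)
  then show "(LINT x|lborel. density N u x) = real N"
    unfolding density_def using i by (subst Bochner_Integration.integral_sum) auto
  show "density N u \<in> borel_measurable borel"
    using orthonormal_H1D(1)[OF assms] by (intro density_measurable) auto
qed

text \<open>The finite bound on the nonnegative integral yields integrability first; only then does
  the Bochner integral represent the same quantity.\<close>

lemma lieb_thirring:
  "\<exists>c>0. \<forall>N. \<forall>u :: nat \<Rightarrow> real^'d \<Rightarrow> complex. orthonormal_H1 N u \<longrightarrow>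
    integrable lborel (\<lambda>x. density N u x powr (1 + 2 / real CARD('d))) \<and>
    c * (LINT x|lborel. density N u x powr (1 + 2 / real CARD('d))) \<le> (\<Sum>k=1..N. kinetic (u k))"
proof -
  obtain C where C: "C > 0" and nn: "\<And>N (u :: nat \<Rightarrow> real^'d \<Rightarrow> complex). orthonormal_H1 N u \<Longrightarrow>
    (\<integral>\<^sup>+x. ennreal (density N u x powr (1 + 2 / real CARD('d))) \<partial>lborel) \<le> ennreal (C * (\<Sum>k=1..N. kinetic (u k)))"
    using lieb_thirring_nn[where 'd='d] by blast
  show ?thesis
  proof (intro exI[of _ "inverse C"] conjI allI impI)
    show "inverse C > 0" using C by simp
    fix N and u :: "nat \<Rightarrow> real^'d \<Rightarrow> complex" assume on: "orthonormal_H1 N u"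
    have m: "(\<lambda>x. density N u x powr (1 + 2 / real CARD('d))) \<in> borel_measurable borel"
      using orthonormal_density(3)[OF on] by measurable
    show i: "integrable lborel (\<lambda>x. density N u x powr (1 + 2 / real CARD('d)))"
      by (rule integrableI_bounded) (use m le_less_trans[OF nn[OF on]] in auto)
    have "ennreal (LINT x|lborel. density N u x powr (1 + 2 / real CARD('d))) \<le> ennreal (C * (\<Sum>k=1..N. kinetic (u k)))"
      using nn[OF on] nn_integral_eq_integral[OF i] by simp
    moreover have "0 \<le> C * (\<Sum>k=1..N. kinetic (u k))" using C by (simp add: sum_nonneg kinetic_nonneg)
    ultimately have "(LINT x|lborel. density N u x powr (1 + 2 / real CARD('d))) \<le> C * (\<Sum>k=1..N. kinetic (u k))"
      by (simp add: ennreal_le_iff)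
    then show "inverse C * (LINT x|lborel. density N u x powr (1 + 2 / real CARD('d))) \<le> (\<Sum>k=1..N. kinetic (u k))"
      using C by (simp add: field_simps)
  qed
qed

text \<open>A power between the two extreme exponents is dominated by the density where the density
  is at most 1 and by its Lieb--Thirring power elsewhere. A Bochner integral of a non-integrable
  function would be 0 by convention, so this is what makes the interaction term of the energy
  meaningful.\<close>

lemma density_powr_integrable:
  fixes u :: "nat \<Rightarrow> real^'d \<Rightarrow> complex"
  assumes on: "orthonormal_H1 N u" and q: "1 \<le> q" "q \<le> 1 + 2 / real CARD('d)"
  shows "integrable lborel (\<lambda>x. density N u x powr q)"
proof (rule Bochner_Integration.integrable_bound[of _ "\<lambda>x. density N u x + density N u x powr (1 + 2 / real CARD('d))"])
  show "integrable lborel (\<lambda>x. density N u x + density N u x powr (1 + 2 / real CARD('d)))"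
    using orthonormal_density(1)[OF on] lieb_thirring[where 'd='d] on by (intro Bochner_Integration.integrable_add) blast+
  show "(\<lambda>x. density N u x powr q) \<in> borel_measurable lborel"
    using orthonormal_density(3)[OF on] by simp
  show "AE x in lborel. norm (density N u x powr q) \<le> norm (density N u x + density N u x powr (1 + 2 / real CARD('d)))"
  proof (rule AE_I2)
    fix x
    have r: "0 \<le> density N u x" by (rule density_nonneg)
    have "density N u x powr q \<le> density N u x + density N u x powr (1 + 2 / real CARD('d))"
    proof (cases "density N u x \<le> 1")
      case True
      have "density N u x powr q \<le> density N u x"
        using powr_mono'[OF q(1) r True] r by simp
      then show ?thesis by (simp add: add_increasing2)
    next
      case False
      have "density N u x powr q \<le> density N u x powr (1 + 2 / real CARD('d))"
        using False q by (intro powr_mono) auto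
      then show ?thesis using r by simp
    qed
    then show "norm (density N u x powr q) \<le> norm (density N u x + density N u x powr (1 + 2 / real CARD('d)))"
      using r by simp
  qed
qed

lemma grad_pair_test_function:
  fixes \<phi> :: "real^'d \<Rightarrow> real"
  assumes "test_function \<phi>"
  shows "grad_pair (\<lambda>x. of_real (\<phi> x)) (\<lambda>x. \<chi> i. of_real (partial_deriv i \<phi> x))"
proof -
  obtain a b B where B: "B > 0" "\<And>x. \<bar>\<phi> x\<bar> \<le> B" "\<And>i x. \<bar>partial_deriv i \<phi> x\<bar> \<le> B"
    "\<And>x. x \<notin> cbox a b \<Longrightarrow> \<phi> x = 0" "\<And>i x. x \<notin> cbox a b \<Longrightarrow> partial_deriv i \<phi> x = 0"
    by (rule test_function_bounds[OF assms]) blast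
  note [measurable] = test_function_measurable[OF assms] partial_deriv_measurable[OF assms]
  show ?thesis
  proof (rule grad_pair_lipschitz[of _ _ B])
    show "L2_fun (\<lambda>x. of_real (\<phi> x) :: complex)"
      by (rule L2_fun_bound[OF L2_fun_test_function[OF assms], of _ 1]) auto
    show "integrable lborel (\<lambda>x. of_real (\<phi> x) :: complex)"
      using integrable_test_function[OF assms] by (rule integrable_of_real)
    have "norm (\<chi> i. complex_of_real (partial_deriv i \<phi> x)) \<le> real CARD('d) * B" for x
    proof -
      have "norm (\<chi> i. complex_of_real (partial_deriv i \<phi> x)) \<le> (\<Sum>i\<in>(UNIV::'d set). \<bar>partial_deriv i \<phi> x\<bar>)"
        using L2_set_le_sum[of UNIV "\<lambda>i. \<bar>partial_deriv i \<phi> x\<bar>"] by (simp add: norm_vec_def)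
      also have "\<dots> \<le> (\<Sum>i\<in>(UNIV::'d set). B)" by (intro sum_mono B(3))
      finally show ?thesis by simp
    qed
    then show "L2_fun (\<lambda>x. \<chi> i. complex_of_real (partial_deriv i \<phi> x))"
      by (intro L2_fun_bounded_cbox_support[of _ "real CARD('d) * B" a b] borel_measurable_vec_lambda borel_measurable_of_real)
        (auto simp: B(5) vec_eq_iff)
    fix i and x :: "real^'d"
    show "norm (of_real (\<phi> (x + h *\<^sub>R axis i 1)) - of_real (\<phi> x) :: complex) \<le> B * \<bar>h\<bar>" for h
    proof -
      have "norm (\<phi> (x + h *\<^sub>R axis i 1) - \<phi> (x + 0 *\<^sub>R axis i 1)) \<le> B * norm (h - 0)"
        by (rule field_differentiable_bound[of UNIV "\<lambda>k. \<phi> (x + k *\<^sub>R axis i 1)" "\<lambda>k. partial_deriv i \<phi> (x + k *\<^sub>R axis i 1)"])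
          (auto simp: B(3) test_function_line_deriv[OF assms])
      then show ?thesis by (simp flip: of_real_diff)
    qed
  next
    fix i
    show "AE x in lborel. ((\<lambda>h. (of_real (\<phi> (x + h *\<^sub>R axis i 1)) - of_real (\<phi> x)) /\<^sub>R h) \<longlongrightarrow>
        (\<chi> i. complex_of_real (partial_deriv i \<phi> x)) $ i) (at 0)"
    proof (rule AE_I2)
      fix x :: "real^'d"
      have "((\<lambda>k. (\<phi> (x + k *\<^sub>R axis i 1) - \<phi> x) / k) \<longlongrightarrow> partial_deriv i \<phi> x) (at 0)"
        using test_function_line_deriv[OF assms, of x i 0] by (simp add: DERIV_def)
      then have "((\<lambda>k. of_real ((\<phi> (x + k *\<^sub>R axis i 1) - \<phi> x) / k)) \<longlongrightarrow> (of_real (partial_deriv i \<phi> x) :: complex)) (at 0)"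
        by (rule tendsto_of_real)
      then show "((\<lambda>h. (of_real (\<phi> (x + h *\<^sub>R axis i 1)) - of_real (\<phi> x)) /\<^sub>R h) \<longlongrightarrow>
          (\<chi> i. complex_of_real (partial_deriv i \<phi> x)) $ i) (at 0)"
        by (simp add: scaleR_conv_of_real divide_inverse mult.commute)
    qed
  qed
qed

text \<open>A fixed normalized state supported in the unit cube. Its translates furnish admissible
  families of every size and repair orthonormality after cutting off.\<close>

definition unit_state :: "real^'d \<Rightarrow> complex" where
  "unit_state x = of_real (unit_bump x / sqrt (LINT y|lborel. (unit_bump (y::real^'d))\<^sup>2))"

lemma unit_state:
  shows unit_state_H1: "(unit_state :: real^'d \<Rightarrow> complex) \<in> H1"
    and unit_state_norm: "L2_inner unit_state (unit_state :: real^'d \<Rightarrow> complex) = 1"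
    and unit_state_support: "x \<notin> cbox 0 (vec 1) \<Longrightarrow> unit_state x = 0"
proof -
  let ?b = "unit_bump :: real^'d \<Rightarrow> real"
  let ?q = "LINT y|lborel. (?b y)\<^sup>2"
  have i: "integrable lborel (\<lambda>y. (?b y)\<^sup>2)"
    using L2_fun_integrable[OF L2_fun_test_function[OF test_function_unit_bump]] by simp
  have q: "?q > 0"
  proof -
    have "?q \<noteq> 0"
    proof
      assume "?q = 0"
      then have "AE y in lborel. (?b y)\<^sup>2 = 0" using integral_nonneg_eq_0_iff_AE[OF i] by simp
      then have "AE y in lborel. ?b y = 0" by (rule eventually_mono) simp
      then have "(LINT y|lborel. ?b y) = 0" by (rule integral_eq_zero_AE)
      then show False using bump_mass_pos[where 'd='d] by (simp add: bump_mass_def)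
    qed
    moreover have "?q \<ge> 0" by simp
    ultimately show ?thesis by linarith
  qed
  have "test_function (\<lambda>x. inverse (sqrt ?q) * ?b x)"
    by (intro test_function_mult test_function_unit_bump C_k_const)
  from grad_pair_test_function[OF this] show "(unit_state :: real^'d \<Rightarrow> complex) \<in> H1"
    unfolding H1_iff unit_state_def[abs_def] by (auto simp: divide_inverse mult.commute)
  have "(LINT x|lborel. (norm (unit_state (x::real^'d)))\<^sup>2) = (LINT x|lborel. (?b x)\<^sup>2 / ?q)"
    using q by (intro Bochner_Integration.integral_cong refl) (simp add: unit_state_def norm_divide power_divide)
  then have "(LINT x|lborel. (norm (unit_state (x::real^'d)))\<^sup>2) = 1" using q by simp
  then show "L2_inner unit_state (unit_state :: real^'d \<Rightarrow> complex) = 1" by (simp add: L2_inner_self)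
  show "x \<notin> cbox 0 (vec 1) \<Longrightarrow> unit_state x = 0" by (simp add: unit_state_def unit_bump_eq_0)
qed

text \<open>A supremum of reals behaves well only for a nonempty set that is bounded above. The
  inequality just proved supplies a positive member; a single normalized state supplies the upper
  bound, because the integral of its density power is positive. Dividing by this positive integral
  for a general family shows that the supremum is itself an admissible constant.\<close>

lemma c_LT:
  shows c_LT_pos: "c_LT TYPE('d::finite) > 0"
    and c_LT_inequality: "orthonormal_H1 N (u :: nat \<Rightarrow> real^'d \<Rightarrow> complex) \<Longrightarrow> N \<ge> 1 \<Longrightarrow>
      c_LT TYPE('d) * (LINT x|lborel. density N u x powr (1 + 2 / real CARD('d))) \<le> (\<Sum>k=1..N. kinetic (u k))"
proof -
  let ?I = "\<lambda>N (u :: nat \<Rightarrow> real^'d \<Rightarrow> complex). LINT x|lborel. density N u x powr (1 + 2 / real CARD('d))"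
  define S where "S = {c. \<forall>N\<ge>1. \<forall>u :: nat \<Rightarrow> real^'d \<Rightarrow> complex. orthonormal_H1 N u \<longrightarrow>
     (\<Sum>n=1..N. kinetic (u n)) \<ge> c * ?I N u}"
  have cS: "c_LT TYPE('d) = Sup S" by (simp add: c_LT_def S_def)
  obtain c where c: "c > 0" "c \<in> S" using lieb_thirring[where 'd='d] by (auto simp: S_def)
  have I0: "?I N u \<ge> 0" for N u by (intro integral_nonneg_AE AE_I2) simp
  have bound: "x \<le> (\<Sum>n=1..N. kinetic (u n)) / ?I N u" if "x \<in> S" "N \<ge> 1" "orthonormal_H1 N u" "?I N u > 0" for x N u
    using that by (auto simp: S_def pos_le_divide_eq)
  have Ipos: "?I N u > 0" if on: "orthonormal_H1 N u" and N: "N \<ge> 1" for N u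
  proof (rule ccontr)
    assume "\<not> ?I N u > 0"
    then have "?I N u = 0" using I0[of N u] by simp
    moreover have "integrable lborel (\<lambda>x. density N u x powr (1 + 2 / real CARD('d)))"
      by (rule density_powr_integrable[OF on]) auto
    ultimately have "AE x in lborel. density N u x powr (1 + 2 / real CARD('d)) = 0"
      using integral_nonneg_eq_0_iff_AE[of lborel "\<lambda>x. density N u x powr (1 + 2 / real CARD('d))"] by simp
    then have "AE x in lborel. density N u x = 0" by (rule eventually_mono) simp
    then have "(LINT x|lborel. density N u x) = 0" by (rule integral_eq_zero_AE)
    then show False using orthonormal_density(2)[OF on] N by simp
  qed
  have u1: "orthonormal_H1 1 (\<lambda>_. unit_state :: real^'d \<Rightarrow> complex)"
    using unit_state_H1 unit_state_norm by (auto simp: orthonormal_H1_def)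
  have bdd: "bdd_above S"
    using bound[OF _ _ u1 Ipos[OF u1]] by (intro bdd_aboveI) auto
  then show "c_LT TYPE('d) > 0" unfolding cS using c cSup_upper[of c S] by linarith
  assume on: "orthonormal_H1 N u" and N: "N \<ge> 1"
  have "Sup S \<le> (\<Sum>k=1..N. kinetic (u k)) / ?I N u"
    using c(2) bound[OF _ N on Ipos[OF on N]] by (intro cSup_least) auto
  then show "c_LT TYPE('d) * ?I N u \<le> (\<Sum>k=1..N. kinetic (u k))"
    unfolding cS using Ipos[OF on N] by (simp add: field_simps)
qed

lemma energy_lower_bound:
  fixes u :: "nat \<Rightarrow> real^'d \<Rightarrow> complex"
  assumes p: "1 < p" "p < 1 + 2 / real CARD('d)" and on: "orthonormal_H1 N u" and N: "N \<ge> 1"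
  shows "e_LT TYPE('d) p * real N \<le> energy p N u"
proof -
  let ?d = "real CARD('d)" and ?c = "c_LT TYPE('d)"
  have i: "integrable lborel (\<lambda>x. density N u x powr p)" "integrable lborel (\<lambda>x. density N u x powr (1 + 2 / ?d))"
    using p by (auto intro: density_powr_integrable[OF on])
  have "e_LT TYPE('d) p * real N = (LINT x|lborel. e_LT TYPE('d) p * density N u x)"
    using orthonormal_density[OF on] by simp
  also have "\<dots> \<le> (LINT x|lborel. ?c * density N u x powr (1 + 2 / ?d) - density N u x powr p / p)"
    using i orthonormal_density(1)[OF on] unfolding e_LT_def
    by (intro integral_mono energy_density_ge c_LT_pos p density_nonneg) auto
  also have "\<dots> = ?c * (LINT x|lborel. density N u x powr (1 + 2 / ?d)) - (LINT x|lborel. density N u x powr p) / p"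
    using i by simp
  also have "\<dots> \<le> energy p N u"
    using c_LT_inequality[OF on N] by (simp add: energy_def)
  finally show ?thesis .
qed

subsection \<open>Compactly supported competitors\<close>

lemma L2_inner_null_left:
  assumes "L2_fun e" "(LINT x|lborel. (norm (e x))\<^sup>2) = 0" shows "L2_inner e v = 0"
proof -
  have "AE x in lborel. (norm (e x))\<^sup>2 = 0"
    using assms integral_nonneg_eq_0_iff_AE[OF L2_fun_integrable[OF assms(1)]] by simp
  then have "AE x in lborel. cnj (e x) * v x = 0" by (rule eventually_mono) simp
  then show ?thesis unfolding L2_inner_def by (rule integral_eq_zero_AE)
qed

text \<open>A Cholesky factorization of the Gram matrix, by Gram--Schmidt elimination of one function at a time.\<close>

lemma gram_factorization:
  fixes f :: "'k \<Rightarrow> real^'d \<Rightarrow> complex"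
  assumes "finite S" "\<And>i. i \<in> S \<Longrightarrow> L2_fun (f i)"
  shows "\<exists>A. \<forall>i\<in>S. \<forall>j\<in>S. L2_inner (f i) (f j) = (\<Sum>k\<in>S. cnj (A i k) * A j k)"
  using assms
proof (induction S arbitrary: f rule: finite_induct)
  case empty
  then show ?case by simp
next
  case (insert n S)
  define e where "e = f n"
  define q where "q = (LINT x|lborel. (norm (e x))\<^sup>2)"
  define b where "b i = L2_inner e (f i)" for i
  have Le: "L2_fun e" and Lf: "\<And>i. i \<in> S \<Longrightarrow> L2_fun (f i)" using insert.prems by (auto simp: e_def)
  have q0: "q \<ge> 0" by (simp add: q_def)
  have ee: "L2_inner e e = of_real q" by (simp add: q_def L2_inner_self)
  \<comment> \<open>Dependent families are allowed: if \<open>e\<close> is a null function, all its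
    inner products vanish and the divisions by \<open>q\<close>, being 0 by convention, remain
    consistent.\<close>
  have b0: "b i = 0" if "q = 0" for i unfolding b_def using that by (intro L2_inner_null_left Le) (simp add: q_def)
  have be: "L2_inner (f i) e = cnj (b i)" for i unfolding b_def by (rule L2_inner_cnj)
  define f' where "f' i x = f i x + (- b i / of_real q) * e x" for i x
  have Lc: "L2_fun (\<lambda>x. c * e x)" for c by (rule L2_fun_cmult[OF Le])
  have Lf': "L2_fun (f' i)" if "i \<in> S" for i unfolding f'_def[abs_def] by (intro L2_fun_add Lf that Lc)
  obtain A where A: "\<And>i j. i \<in> S \<Longrightarrow> j \<in> S \<Longrightarrow> L2_inner (f' i) (f' j) = (\<Sum>k\<in>S. cnj (A i k) * A j k)"
    using insert.IH[of f'] Lf' by blast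
  have G: "L2_inner (f i) (f j) = (\<Sum>k\<in>S. cnj (A i k) * A j k) + cnj (b i) * b j / of_real q" if i: "i \<in> S" and j: "j \<in> S" for i j
  proof -
    have 1: "L2_inner v (f' j) = L2_inner v (f j) + (- b j / of_real q) * L2_inner v e" if "L2_fun v" for v
      unfolding f'_def[abs_def] by (simp only: L2_inner_add_right[OF that Lf[OF j] Lc] L2_inner_cmult_right)
    have e2: "L2_inner e (f' j) = 0"
      unfolding 1[OF Le] ee b_def[symmetric] using b0[of j] by (cases "q = 0") auto
    have "L2_inner (\<lambda>x. (- b i / of_real q) * e x) (f' j) = cnj (- b i / of_real q) * L2_inner e (f' j)"
      using L2_inner_cnj[of "\<lambda>x. (- b i / of_real q) * e x" "f' j"] L2_inner_cnj[of e "f' j"]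
      by (simp only: L2_inner_cmult_right complex_cnj_mult complex_cnj_cnj)
    then have "L2_inner (f' i) (f' j) = L2_inner (f i) (f' j)"
      using L2_inner_add_left[OF Lf'[OF j] Lf[OF i] Lc[of "- b i / of_real q"]] e2 by (simp add: f'_def[abs_def])
    then show ?thesis using A[OF i j] unfolding 1[OF Lf[OF i]] be by (simp add: algebra_simps)
  qed
  \<comment> \<open>Column \<open>n\<close> holds the components along the normalized
    \<open>e\<close>, and the row of \<open>n\<close> is zero off the diagonal; the remaining
    entries come from the family reduced by its components along \<open>e\<close>.\<close>
  define A' where "A' i k = (if i = n then (if k = n then of_real (sqrt q) else 0) else if k = n then b i / of_real (sqrt q) else A i k)" for i k
  have nS: "n \<notin> S" "finite S" using insert.hyps by auto
  have sq: "complex_of_real (sqrt q) * of_real (sqrt q) = of_real q" using q0 by (simp flip: of_real_mult)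
  have sumS: "(\<Sum>k\<in>S. cnj (A' i k) * A' j k) = (if i = n \<or> j = n then 0 else (\<Sum>k\<in>S. cnj (A i k) * A j k))" for i j
    using nS by (auto simp: A'_def intro!: sum.neutral sum.cong)
  have "L2_inner (f i) (f j) = (\<Sum>k\<in>insert n S. cnj (A' i k) * A' j k)" if i: "i \<in> insert n S" and j: "j \<in> insert n S" for i j
  proof -
    have *: "(\<Sum>k\<in>insert n S. cnj (A' i k) * A' j k) = cnj (A' i n) * A' j n + (if i = n \<or> j = n then 0 else (\<Sum>k\<in>S. cnj (A i k) * A j k))"
      using nS by (simp add: sumS)
    consider "i = n" "j = n" | "i = n" "j \<in> S" "j \<noteq> n" | "i \<in> S" "j = n" "i \<noteq> n" | "i \<in> S" "j \<in> S" "i \<noteq> n" "j \<noteq> n"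
      using i j nS by auto
    then show ?thesis
    proof cases
      case 1
      then show ?thesis unfolding * using ee sq by (simp add: A'_def e_def)
    next
      case 2
      then show ?thesis unfolding * using b0[of j] by (cases "q = 0") (auto simp: A'_def b_def e_def)
    next
      case 3
      then show ?thesis unfolding * using b0[of i] be[of i] by (cases "q = 0") (auto simp: A'_def e_def)
    next
      case 4
      have "cnj (b i / of_real (sqrt q)) * (b j / of_real (sqrt q)) = cnj (b i) * b j / of_real q"
        unfolding sq[symmetric] by simp
      then have e: "cnj (A' i n) * A' j n = cnj (b i) * b j / of_real q"
        using 4 by (simp only: A'_def refl if_False if_True)
      show ?thesis unfolding * e using 4 G[OF 4(1,2)] by simp
    qed
  qed
  then show ?case by blast
qed

lemma L2_inner_disjoint: "(\<And>x. u x = 0 \<or> v x = 0) \<Longrightarrow> L2_inner u v = 0"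
  unfolding L2_inner_def by (rule integral_eq_zero_AE) (rule AE_I2, auto)

lemma L2_inner_translate:
  assumes "L2_fun u" "L2_fun v"
  shows "L2_inner (\<lambda>x. u (t + x)) (\<lambda>x. v (t + x)) = L2_inner u v"
  unfolding L2_inner_def using L2_fun_measurable[OF assms(1)] L2_fun_measurable[OF assms(2)]
  by (intro integral_translate[of "\<lambda>x. cnj (u x) * v x"]) measurable

lemma kinetic_translate:
  assumes "u \<in> H1" shows "kinetic (\<lambda>x. u (t + x)) = kinetic u"
proof -
  obtain g where g: "grad_pair u g" using assms by (auto simp: H1_iff)
  show ?thesis
    unfolding kinetic_eq[OF g] kinetic_eq[OF grad_pair_translate[OF g]]
    using L2_fun_measurable[OF grad_pair_L2(2)[OF g]]
    by (intro integral_translate[of "\<lambda>x. (norm (g x))\<^sup>2"]) measurable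
qed

text \<open>The explicit gradient vanishes at every point outside the cube, not merely almost
  everywhere, so supports of gradients can be compared pointwise.\<close>

lemma unit_state_gradient:
  obtains g where "grad_pair (unit_state :: real^'d \<Rightarrow> complex) g" "\<And>x. x \<notin> cbox 0 (vec 1) \<Longrightarrow> g x = 0"
proof -
  let ?c = "inverse (sqrt (LINT y|lborel. (unit_bump (y::real^'d))\<^sup>2))"
  have t: "test_function (\<lambda>x::real^'d. ?c * unit_bump x)"
    by (intro test_function_mult test_function_unit_bump C_k_const)
  have "partial_deriv i (\<lambda>x::real^'d. ?c * unit_bump x) x = 0" if "x \<notin> cbox 0 (vec 1)" for i x
    by (rule partial_deriv_support[OF _ that]) (simp add: unit_bump_eq_0)
  then show ?thesis using grad_pair_test_function[OF t]
    by (intro that[of "\<lambda>x. \<chi> i. of_real (partial_deriv i (\<lambda>x. ?c * unit_bump x) x)"])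
      (auto simp: unit_state_def[abs_def] divide_inverse mult.commute vec_eq_iff)
qed

text \<open>Steps of length 2 along the diagonal keep the supporting unit cubes disjoint, and all
  their points have coordinates at least \<open>T\<close>.\<close>

definition far_state :: "real \<Rightarrow> nat \<Rightarrow> real^'d \<Rightarrow> complex" where
  "far_state T k x = unit_state (- vec (T + 2 * real k) + x)"

lemma far_cube:
  fixes x :: "real^'d"
  assumes "- vec (T + 2 * real k) + x \<in> cbox 0 (vec 1)"
  shows "T + 2 * real k \<le> x $ i" "x $ i \<le> T + 2 * real k + 1"
  using assms by (auto simp: mem_box_cart algebra_simps)

lemma far_cube_disjoint:
  fixes x :: "real^'d"
  assumes "k \<noteq> l" "- vec (T + 2 * real k) + x \<in> cbox 0 (vec 1)" shows "- vec (T + 2 * real l) + x \<notin> cbox 0 (vec 1)"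
proof
  assume "- vec (T + 2 * real l) + x \<in> cbox 0 (vec 1)"
  from far_cube[OF this] far_cube[OF assms(2)]
  have "2 * real l \<le> 2 * real k + 1" "2 * real k \<le> 2 * real l + 1" by (metis add.assoc add_le_cancel_left order_trans)+
  then have "2 * l \<le> 2 * k + 1" "2 * k \<le> 2 * l + 1" by linarith+
  then show False using assms(1) by simp
qed

lemma
  shows far_state_H1: "(far_state T k :: real^'d \<Rightarrow> complex) \<in> H1"
    and far_state_orthonormal: "L2_inner (far_state T k) (far_state T l :: real^'d \<Rightarrow> complex) = (if k = l then 1 else 0)"
proof -
  obtain g where g: "grad_pair (unit_state :: real^'d \<Rightarrow> complex) g" by (rule unit_state_gradient) blast
  have L: "L2_fun (unit_state :: real^'d \<Rightarrow> complex)" by (rule grad_pair_L2(1)[OF g])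
  show "(far_state T k :: real^'d \<Rightarrow> complex) \<in> H1"
    unfolding H1_iff far_state_def[abs_def] using grad_pair_translate[OF g] by blast
  show "L2_inner (far_state T k) (far_state T l :: real^'d \<Rightarrow> complex) = (if k = l then 1 else 0)"
  proof (cases "k = l")
    case True
    then show ?thesis unfolding far_state_def[abs_def] by (simp only: L2_inner_translate[OF L L] unit_state_norm simp_thms if_True)
  next
    case False
    have "far_state T k x = 0 \<or> far_state T l x = 0" for x :: "real^'d"
      using far_cube_disjoint[OF False] unit_state_support unfolding far_state_def by blast
    then show ?thesis using False by (simp add: L2_inner_disjoint)
  qed
qed

lemma far_states_orthonormal_H1: "orthonormal_H1 N (far_state 0 :: nat \<Rightarrow> real^'d \<Rightarrow> complex)"
  by (simp add: orthonormal_H1_def far_state_H1 far_state_orthonormal)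

text \<open>If the Gram matrices of \<open>v\<close> and \<open>f\<close> add up to the identity, orthonormality of \<open>v\<close> can be
  restored by adding combinations of states supported far away.\<close>

lemma orthonormal_completion:
  fixes v f :: "nat \<Rightarrow> real^'d \<Rightarrow> complex"
  assumes v: "\<And>i. i \<in> {1..N} \<Longrightarrow> grad_pair (v i) (h i)"
    and supp: "\<And>i x. i \<in> {1..N} \<Longrightarrow> x \<notin> cbox (vec (-R)) (vec R) \<Longrightarrow> v i x = 0 \<and> h i x = 0"
    and f: "\<And>i. i \<in> {1..N} \<Longrightarrow> L2_fun (f i)"
    and gram: "\<And>i j. i \<in> {1..N} \<Longrightarrow> j \<in> {1..N} \<Longrightarrow> L2_inner (v i) (v j) + L2_inner (f i) (f j) = (if i = j then 1 else 0)"
    and R: "R \<ge> 0"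
  shows "\<exists>w R'. orthonormal_H1 N w \<and> R' \<ge> 0 \<and> (\<forall>i\<in>{1..N}. \<forall>x. x \<notin> cbox (vec (-R')) (vec R') \<longrightarrow> w i x = 0) \<and>
    (\<Sum>i=1..N. kinetic (w i)) \<le> (\<Sum>i=1..N. LINT x|lborel. (norm (h i x))\<^sup>2) +
       real N * kinetic (unit_state :: real^'d \<Rightarrow> complex) * (\<Sum>i=1..N. LINT x|lborel. (norm (f i x))\<^sup>2) \<and>
    (\<forall>x. density N v x \<le> density N w x)"
proof -
  obtain g where g: "grad_pair (unit_state :: real^'d \<Rightarrow> complex) g" and gs: "\<And>x. x \<notin> cbox 0 (vec 1) \<Longrightarrow> g x = 0"
    by (rule unit_state_gradient) blast
  obtain A where A: "\<And>i j. i \<in> {1..N} \<Longrightarrow> j \<in> {1..N} \<Longrightarrow> L2_inner (f i) (f j) = (\<Sum>k=1..N. cnj (A i k) * A j k)"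
    using gram_factorization[of "{1..N}" f] f by blast
  define T where "T = R + 1"
  define \<phi> where "\<phi> = (far_state T :: nat \<Rightarrow> real^'d \<Rightarrow> complex)"
  define \<gamma> where "\<gamma> k x = g (- vec (T + 2 * real k) + x)" for k and x :: "real^'d"
  have gp\<phi>: "grad_pair (\<phi> k) (\<gamma> k)" for k
    unfolding \<phi>_def far_state_def[abs_def] \<gamma>_def[abs_def] by (rule grad_pair_translate[OF g])
  \<comment> \<open>Since the far states are orthonormal, combining them with a factor
    \<open>A\<close> of the Gram matrix of \<open>f\<close> reproduces that matrix exactly. The
    functions \<open>f\<close> themselves enter only through it.\<close>
  define z where "z i x = (\<Sum>k=1..N. A i k * \<phi> k x)" for i x
  define \<zeta> where "\<zeta> i x = (\<Sum>k=1..N. A i k *s \<gamma> k x)" for i x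
  have gpz: "grad_pair (z i) (\<zeta> i)" for i
    unfolding z_def[abs_def] \<zeta>_def[abs_def] by (rule grad_pair_sum[OF gp\<phi>])
  define w where "w i x = v i x + z i x" for i x
  have gpw: "grad_pair (w i) (\<lambda>x. h i x + \<zeta> i x)" if "i \<in> {1..N}" for i
    unfolding w_def[abs_def] by (rule grad_pair_add[OF v[OF that] gpz])
  have near: "\<phi> k x = 0 \<and> \<gamma> k x = 0" if "x \<in> cbox (vec (-R)) (vec R)" for k x
  proof -
    have "- vec (T + 2 * real k) + x \<notin> cbox 0 (vec 1)"
    proof
      assume "- vec (T + 2 * real k) + x \<in> cbox 0 (vec 1)"
      from far_cube(1)[OF this] that have "T + 2 * real k \<le> R" by (auto simp: mem_box_cart) (meson order_trans)
      then show False by (simp add: T_def)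
    qed
    then show ?thesis unfolding \<phi>_def far_state_def \<gamma>_def using gs unit_state_support by blast
  qed
  \<comment> \<open>Functions and gradients are separated together, so the cross terms vanish in the
    inner products as well as in the kinetic energy.\<close>
  have disj: "(v i x = 0 \<and> h i x = 0) \<or> (z j x = 0 \<and> \<zeta> j x = 0)" if "i \<in> {1..N}" for i j x
    using supp[OF that] near[of x] by (cases "x \<in> cbox (vec (-R)) (vec R)") (auto simp: z_def \<zeta>_def)
  have Lv: "L2_fun (v i)" if "i \<in> {1..N}" for i using grad_pair_L2(1)[OF v[OF that]] .
  have Lz: "L2_fun (z i)" for i using grad_pair_L2(1)[OF gpz] .
  have Lw: "L2_fun (w i)" if "i \<in> {1..N}" for i using grad_pair_L2(1)[OF gpw[OF that]] .
  have zz: "L2_inner (z i) (z j) = (\<Sum>k=1..N. cnj (A i k) * A j k)" for i j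
  proof -
    have "L2_inner (z i) (z j) = (\<Sum>k=1..N. cnj (A i k) * L2_inner (\<phi> k) (z j))"
      unfolding z_def[of i, abs_def] using grad_pair_L2(1)[OF gp\<phi>] Lz by (intro L2_inner_sum_left) auto
    also have "\<dots> = (\<Sum>k=1..N. cnj (A i k) * A j k)"
    proof (rule sum.cong[OF refl])
      fix k assume k: "k \<in> {1..N}"
      have "L2_inner (\<phi> k) (z j) = (\<Sum>l=1..N. A j l * L2_inner (\<phi> k) (\<phi> l))"
        unfolding z_def[of j, abs_def] using grad_pair_L2(1)[OF gp\<phi>] by (intro L2_inner_sum_right) auto
      also have "\<dots> = A j k" using k by (simp add: \<phi>_def far_state_orthonormal if_distrib cong: if_cong)
      finally show "cnj (A i k) * L2_inner (\<phi> k) (z j) = cnj (A i k) * A j k" by simp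
    qed
    finally show ?thesis .
  qed
  have ww: "L2_inner (w i) (w j) = (if i = j then 1 else 0)" if i: "i \<in> {1..N}" and j: "j \<in> {1..N}" for i j
  proof -
    have "L2_inner (w i) (w j) = L2_inner (v i) (v j) + L2_inner (v i) (z j) + (L2_inner (z i) (v j) + L2_inner (z i) (z j))"
      using L2_inner_add_left[OF Lw[OF j] Lv[OF i] Lz[of i]]
        L2_inner_add_right[OF Lv[OF i] Lv[OF j] Lz[of j]] L2_inner_add_right[OF Lz[of i] Lv[OF j] Lz[of j]]
      by (simp add: w_def[abs_def])
    moreover have "L2_inner (v i) (z j) = 0" "L2_inner (z i) (v j) = 0"
      using disj[OF i] disj[OF j] by (intro L2_inner_disjoint; blast)+
    ultimately show ?thesis using gram[OF i j] A[OF i j] zz[of i j] by simp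
  qed
  have "w i \<in> H1" if "i \<in> {1..N}" for i unfolding H1_iff using gpw[OF that] by blast
  then have on: "orthonormal_H1 N w" using ww by (simp add: orthonormal_H1_def)
  define R' where "R' = T + 2 * real N + 1"
  have w0: "w i x = 0" if i: "i \<in> {1..N}" and x: "x \<notin> cbox (vec (-R')) (vec R')" for i x
  proof -
    have "cbox (vec (-R)) (vec R) \<subseteq> cbox (vec (-R')) (vec R' :: real^'d)"
      using R by (auto simp: mem_box_cart R'_def T_def) (smt (verit) of_nat_0_le_iff)+
    then have "v i x = 0" using supp[OF i] x by blast
    moreover have "\<phi> k x = 0" if k: "k \<in> {1..N}" for k
    proof -
      have "- vec (T + 2 * real k) + x \<notin> cbox 0 (vec 1)"
      proof
        assume a: "- vec (T + 2 * real k) + x \<in> cbox 0 (vec 1)"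
        have "- R' \<le> x $ m \<and> x $ m \<le> R'" for m
          using far_cube[OF a, of m] k R by (auto simp: R'_def T_def)
        then show False using x by (auto simp: mem_box_cart)
      qed
      then show ?thesis unfolding \<phi>_def far_state_def by (rule unit_state_support)
    qed
    ultimately show ?thesis by (simp add: w_def z_def)
  qed
  have kin: "kinetic (w i) \<le> (LINT x|lborel. (norm (h i x))\<^sup>2) + real N * kinetic (unit_state :: real^'d \<Rightarrow> complex) * (LINT x|lborel. (norm (f i x))\<^sup>2)"
    if i: "i \<in> {1..N}" for i
  proof -
    define q where "q = (\<Sum>k=1..N. (norm (A i k))\<^sup>2)"
    have qf: "q = (LINT x|lborel. (norm (f i x))\<^sup>2)"
    proof -
      have "complex_of_real q = (\<Sum>k=1..N. cnj (A i k) * A i k)"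
        unfolding q_def of_real_sum complex_norm_square by (simp add: mult.commute)
      also have "\<dots> = of_real (LINT x|lborel. (norm (f i x))\<^sup>2)" using A[OF i i] L2_inner_self[of "f i"] by simp
      finally show ?thesis by (simp only: of_real_eq_iff)
    qed
    have ih: "integrable lborel (\<lambda>x. (norm (h i x))\<^sup>2)" using L2_fun_integrable[OF grad_pair_L2(2)[OF v[OF i]]] .
    have ig: "integrable lborel (\<lambda>x. (norm (\<gamma> k x))\<^sup>2)" for k using L2_fun_integrable[OF grad_pair_L2(2)[OF gp\<phi>]] .
    have k\<gamma>: "(LINT x|lborel. (norm (\<gamma> k x))\<^sup>2) = kinetic (unit_state :: real^'d \<Rightarrow> complex)" for k
    proof -
      have "(unit_state :: real^'d \<Rightarrow> complex) \<in> H1" using g by (auto simp: H1_iff)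
      then show ?thesis using kinetic_translate[of "unit_state :: real^'d \<Rightarrow> complex" "- vec (T + 2 * real k)"] kinetic_eq[OF gp\<phi>[of k]]
        by (simp add: \<phi>_def far_state_def[abs_def])
    qed
    have "kinetic (w i) = (LINT x|lborel. (norm (h i x + \<zeta> i x))\<^sup>2)" by (rule kinetic_eq[OF gpw[OF i]])
    \<comment> \<open>Cauchy--Schwarz over the far states loses a factor of order \<open>N\<close>,
      which is harmless: \<open>N\<close> stays fixed while the norm of \<open>f\<close> is made
      small.\<close>
    also have "\<dots> \<le> (LINT x|lborel. (norm (h i x))\<^sup>2 + q * (\<Sum>k=1..N. (norm (\<gamma> k x))\<^sup>2))"
    proof (rule integral_mono)
      show "integrable lborel (\<lambda>x. (norm (h i x + \<zeta> i x))\<^sup>2)" using L2_fun_integrable[OF grad_pair_L2(2)[OF gpw[OF i]]] .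
      show "integrable lborel (\<lambda>x. (norm (h i x))\<^sup>2 + q * (\<Sum>k=1..N. (norm (\<gamma> k x))\<^sup>2))"
        by (intro Bochner_Integration.integrable_add integrable_mult_right Bochner_Integration.integrable_sum ih ig)
      show "(norm (h i x + \<zeta> i x))\<^sup>2 \<le> (norm (h i x))\<^sup>2 + q * (\<Sum>k=1..N. (norm (\<gamma> k x))\<^sup>2)" for x
      proof -
        have "(norm (\<zeta> i x))\<^sup>2 \<le> (sqrt q * sqrt (\<Sum>k=1..N. (norm (\<gamma> k x))\<^sup>2))\<^sup>2"
          unfolding \<zeta>_def q_def by (intro power_mono norm_sum_smult_le norm_ge_zero)
        also have "\<dots> = q * (\<Sum>k=1..N. (norm (\<gamma> k x))\<^sup>2)"
          by (simp add: power_mult_distrib q_def sum_nonneg)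
        finally have "(norm (\<zeta> i x))\<^sup>2 \<le> q * (\<Sum>k=1..N. (norm (\<gamma> k x))\<^sup>2)" .
        moreover have "0 \<le> q * (\<Sum>k=1..N. (norm (\<gamma> k x))\<^sup>2)" by (simp add: q_def sum_nonneg)
        ultimately show ?thesis using disj[OF i, of x i] by auto
      qed
    qed
    also have "\<dots> = (LINT x|lborel. (norm (h i x))\<^sup>2) + q * (\<Sum>k=1..N. LINT x|lborel. (norm (\<gamma> k x))\<^sup>2)"
      using ih ig by simp
    finally show ?thesis using qf k\<gamma> by (simp add: mult_ac)
  qed
  have "(\<Sum>i=1..N. kinetic (w i)) \<le> (\<Sum>i=1..N. (LINT x|lborel. (norm (h i x))\<^sup>2) + real N * kinetic (unit_state :: real^'d \<Rightarrow> complex) * (LINT x|lborel. (norm (f i x))\<^sup>2))"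
    by (intro sum_mono kin)
  then have "(\<Sum>i=1..N. kinetic (w i)) \<le> (\<Sum>i=1..N. LINT x|lborel. (norm (h i x))\<^sup>2) +
       real N * kinetic (unit_state :: real^'d \<Rightarrow> complex) * (\<Sum>i=1..N. LINT x|lborel. (norm (f i x))\<^sup>2)"
    by (simp only: sum.distrib sum_distrib_left)
  moreover have "density N v x \<le> density N w x" for x
    unfolding density_def
  proof (rule sum_mono)
    fix i assume i: "i \<in> {1..N}"
    show "(norm (v i x))\<^sup>2 \<le> (norm (w i x))\<^sup>2" using disj[OF i, of x i] by (auto simp: w_def)
  qed
  moreover have "R' \<ge> 0" using R by (simp add: R'_def T_def)
  ultimately show ?thesis using on w0 by blast
qed

section \<open>Smooth cutoffs at a large scale\<close>

definition cutoff :: "real \<Rightarrow> real^'d \<Rightarrow> real" where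
  "cutoff r y = unit_bump (vec (1 / 2) + y /\<^sub>R r) / unit_bump (vec (1 / 2) :: real^'d)"

text \<open>From \<open>4 * (t * (1 - t)) \<le> 1\<close> it follows that
  \<open>1 / t + 1 / (1 - t)\<close> is at least 4, its value at the midpoint. Hence
  \<open>unit_bump\<close> peaks at the centre of its cube, and dividing by that value yields a
  cutoff bounded by 1.\<close>

lemma flat_exp_product_le: "flat_exp 0 t * flat_exp 0 (1 - t) \<le> flat_exp 0 (1 / 2) * flat_exp 0 (1 / 2)"
proof (cases "0 < t \<and> t < 1")
  case True
  have "0 \<le> (2 * t - 1)\<^sup>2" by simp
  then have "4 * (t * (1 - t)) \<le> 1" by (simp add: power2_eq_square algebra_simps)
  then have "4 \<le> 1 / (t * (1 - t))" using True by (simp add: pos_le_divide_eq)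
  also have "1 / (t * (1 - t)) = 1 / t + 1 / (1 - t)" using True by (simp add: field_simps)
  finally have "exp (- (1 / t) + - (1 / (1 - t))) \<le> exp (- 2 + - 2)" by (subst exp_le_cancel_iff) linarith
  then show ?thesis using True by (simp add: flat_exp_def flip: exp_add)
qed (auto simp: flat_exp_def)

lemma unit_bump_center_pos: "unit_bump (vec (1 / 2) :: real^'d) > 0"
  unfolding unit_bump_def by (rule bump_pos) (auto simp: mem_box_cart)

lemma unit_bump_le_center: "unit_bump z \<le> unit_bump (vec (1 / 2) :: real^'d)" for z :: "real^'d"
  unfolding unit_bump_def bump_def
  by (intro prod_mono) (auto intro: flat_exp_product_le mult_nonneg_nonneg flat_exp_nonneg)

lemma cutoff_nonneg: "0 \<le> cutoff r y" and cutoff_le_1: "cutoff r y \<le> 1" for y :: "real^'d"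
  using unit_bump_center_pos[where 'd='d] unit_bump_le_center[of "vec (1 / 2) + y /\<^sub>R r"]
  by (auto simp: cutoff_def unit_bump_nonneg divide_le_eq)

text \<open>Up to a constant the cutoff is the averaging kernel of the cube of side \<open>r\<close>
  centred at the origin, from which it inherits smoothness and derivative bounds.\<close>

lemma cutoff_eq_ker:
  fixes y :: "real^'d"
  assumes "r > 0"
  shows "cutoff r y = (r ^ CARD('d) / unit_bump (vec (1 / 2) :: real^'d)) * ker (- (r / 2) *\<^sub>R vec 1) r y"
proof -
  have "(y - - (r / 2) *\<^sub>R vec 1) /\<^sub>R r = vec (1 / 2) + y /\<^sub>R r"
    using assms by (simp add: vec_eq_iff field_simps)
  then show ?thesis using assms unfolding cutoff_def ker_def by simp
qed

lemma cutoff_eq_ker_fun: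
  assumes "r > 0"
  shows "cutoff r = (\<lambda>y::real^'d. (r ^ CARD('d) / unit_bump (vec (1 / 2) :: real^'d)) * ker (- (r / 2) *\<^sub>R vec 1) r y)"
  by (rule ext) (rule cutoff_eq_ker[OF assms])

lemma test_function_cutoff:
  assumes "r > 0" shows "test_function (cutoff r)"
  unfolding cutoff_eq_ker_fun[OF assms]
  by (rule test_function_mult[OF test_function_ker[OF assms] C_k_const])

lemma cutoff_support:
  fixes x :: "real^'d"
  assumes "r > 0" "x \<notin> cbox (vec (-r)) (vec r)"
  shows "cutoff r x = 0" "partial_deriv i (cutoff r) x = 0"
proof -
  have s: "cutoff r x = 0" if x: "x \<notin> cbox (vec (-r)) (vec r)" for x :: "real^'d"
  proof -
    have "vec (1 / 2) + x /\<^sub>R r \<notin> cbox 0 (vec 1)"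
    proof
      assume a: "vec (1 / 2) + x /\<^sub>R r \<in> cbox 0 (vec 1)"
      have "- r \<le> x $ i \<and> x $ i \<le> r" for i
      proof -
        have e: "(vec (1 / 2) + x /\<^sub>R r) $ i = 1 / 2 + x $ i / r" using assms(1) by (simp add: field_simps)
        have "0 \<le> (vec (1 / 2) + x /\<^sub>R r) $ i \<and> (vec (1 / 2) + x /\<^sub>R r) $ i \<le> 1"
          using a unfolding mem_box_cart by (metis vec_component zero_index)
        then have "- (1 / 2) \<le> x $ i / r" "x $ i / r \<le> 1 / 2" unfolding e by linarith+
        then have "r * (- (1 / 2)) \<le> r * (x $ i / r)" "r * (x $ i / r) \<le> r * (1 / 2)"
          using assms(1) by (intro mult_left_mono; simp)+
        then have "- (r / 2) \<le> x $ i" "x $ i \<le> r / 2" using assms(1) by simp_all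
        then show ?thesis using assms(1) by linarith
      qed
      then show False using x by (auto simp: mem_box_cart)
    qed
    then show ?thesis by (simp add: cutoff_def unit_bump_eq_0)
  qed
  then show "cutoff r x = 0" using assms(2) .
  show "partial_deriv i (cutoff r) x = 0" by (rule partial_deriv_support[OF s assms(2)])
qed

lemma cutoff_partial_deriv_bound:
  obtains B where "B > 0" "\<And>r i (x::real^'d). r > 0 \<Longrightarrow> \<bar>partial_deriv i (cutoff r) x\<bar> \<le> B / r"
proof -
  let ?b = "unit_bump :: real^'d \<Rightarrow> real"
  let ?m = "?b (vec (1 / 2))"
  obtain B where B: "B > 0" "\<And>i x. \<bar>partial_deriv i ?b x\<bar> \<le> B"
    by (rule test_function_bounds[OF test_function_unit_bump]) blast
  show ?thesis
  proof (rule that[of "B / ?m"])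
    show "B / ?m > 0" using B(1) unit_bump_center_pos[where 'd='d] by simp
    fix r :: real and i and x :: "real^'d" assume r: "r > 0"
    let ?a = "- (r / 2) *\<^sub>R vec 1 :: real^'d"
    have "(ker ?a r has_derivative frechet_derivative (ker ?a r) (at x)) (at x)"
      using test_function_differentiable[OF test_function_ker[OF r]] by (simp add: frechet_derivative_works)
    from partial_deriv_eq[OF has_derivative_mult_right[OF this, of "r ^ CARD('d) / ?m"], of i]
    have "partial_deriv i (cutoff r) x = (r ^ CARD('d) / ?m) * partial_deriv i (ker ?a r) x"
      unfolding cutoff_eq_ker_fun[OF r] by (simp only: partial_deriv_def)
    then have "partial_deriv i (cutoff r) x = (r ^ CARD('d) / ?m) * (partial_deriv i unit_bump ((x - ?a) /\<^sub>R r) / r ^ Suc CARD('d))"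
      unfolding partial_deriv_ker[OF r] .
    then have "partial_deriv i (cutoff r) x = partial_deriv i unit_bump ((x - ?a) /\<^sub>R r) / (?m * r)"
      using r by simp
    then have "\<bar>partial_deriv i (cutoff r) x\<bar> = \<bar>partial_deriv i ?b ((x - ?a) /\<^sub>R r)\<bar> / (?m * r)"
      using r unit_bump_center_pos[where 'd='d] by (simp add: abs_mult)
    also have "\<dots> \<le> B / (?m * r)" using r unit_bump_center_pos[where 'd='d] by (intro divide_right_mono B(2)) auto
    finally show "\<bar>partial_deriv i (cutoff r) x\<bar> \<le> B / ?m / r" by simp
  qed
qed

lemma cutoff_tendsto_1: "(\<lambda>n. cutoff (real (Suc n)) x) \<longlonglongrightarrow> 1" for x :: "real^'d"
proof -
  let ?c = "vec (1 / 2) :: real^'d"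
  have "(\<lambda>n. ?c + inverse (real (Suc n)) *\<^sub>R x) \<longlonglongrightarrow> ?c + 0 *\<^sub>R x"
    by (intro tendsto_intros LIMSEQ_inverse_real_of_nat)
  moreover have "isCont unit_bump (?c + 0 *\<^sub>R x)"
  proof -
    have "test_function (unit_bump :: real^'d \<Rightarrow> real)" by (rule test_function_unit_bump)
    from test_function_continuous[OF this] show ?thesis by (simp add: continuous_on_eq_continuous_at)
  qed
  ultimately have "(\<lambda>n. unit_bump (?c + inverse (real (Suc n)) *\<^sub>R x)) \<longlonglongrightarrow> unit_bump (?c + 0 *\<^sub>R x)"
    by (rule isCont_tendsto_compose[rotated])
  then have "(\<lambda>n. unit_bump (?c + inverse (real (Suc n)) *\<^sub>R x) / unit_bump (?c)) \<longlonglongrightarrow> unit_bump (?c + 0 *\<^sub>R x) / unit_bump (?c)"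
    by (rule tendsto_divide[OF _ tendsto_const]) (use unit_bump_center_pos[where 'd='d] in \<open>auto simp: less_le\<close>)
  then show ?thesis unfolding cutoff_def using unit_bump_center_pos[where 'd='d] by (simp add: less_le)
qed

text \<open>The kept part \<open>v\<close> and the discarded part \<open>f\<close> have Gram
  matrices adding up to that of \<open>u\<close>, which is what the completion by far states
  requires. As the cutoff spreads out, dominated convergence sends the norm of \<open>f\<close> to 0
  and the kinetic and interaction terms of \<open>v\<close> to those of \<open>u\<close>, so some
  fixed cutoff already brings the error below \<open>\<epsilon>\<close>.\<close>

lemma compact_approximation:
  fixes u :: "nat \<Rightarrow> real^'d \<Rightarrow> complex"
  assumes on: "orthonormal_H1 N u" and p: "1 < p" "p < 1 + 2 / real CARD('d)" and eps: "\<epsilon> > 0"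
  shows "\<exists>(w :: nat \<Rightarrow> real^'d \<Rightarrow> complex) R. orthonormal_H1 N w \<and> R \<ge> 0 \<and> (\<forall>i\<in>{1..N}. \<forall>x. x \<notin> cbox (vec (-R)) (vec R) \<longrightarrow> w i x = 0) \<and>
    energy p N w \<le> energy p N u + \<epsilon>"
proof -
  define \<kappa> where "\<kappa> = real N * kinetic (unit_state :: real^'d \<Rightarrow> complex)"
  define g where "g i = weak_gradient (u i)" for i
  have gp: "grad_pair (u i) (g i)" if "i \<in> {1..N}" for i
    unfolding g_def using orthonormal_H1D(2)[OF on that] .
  have Lu: "L2_fun (u i)" and Lg: "L2_fun (g i)" if "i \<in> {1..N}" for i
    using grad_pair_L2[OF gp[OF that]] by auto
  obtain B where B: "B > 0" "\<And>r i (x::real^'d). r > 0 \<Longrightarrow> \<bar>partial_deriv i (cutoff r) x\<bar> \<le> B / r"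
    by (rule cutoff_partial_deriv_bound) blast
  define c where "c n = (cutoff (real (Suc n)) :: real^'d \<Rightarrow> real)" for n
  have tc: "test_function (c n)" for n unfolding c_def by (intro test_function_cutoff) simp
  have c01: "0 \<le> c n x" "c n x \<le> 1" for n x unfolding c_def by (rule cutoff_nonneg cutoff_le_1)+
  have c2: "(c n x)\<^sup>2 \<le> 1" for n x using c01[of n x] by (simp add: power_le_one)
  have cm [measurable]: "c n \<in> borel_measurable borel" for n by (rule test_function_measurable[OF tc])
  have clim: "(\<lambda>n. c n x) \<longlonglongrightarrow> 1" for x unfolding c_def by (rule cutoff_tendsto_1)
  have dclim: "(\<lambda>n. partial_deriv i (c n) x) \<longlonglongrightarrow> 0" for i x
  proof (rule Lim_null_comparison)
    show "\<forall>\<^sub>F n in sequentially. norm (partial_deriv i (c n) x) \<le> B * inverse (real (Suc n))"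
      using B(2) unfolding c_def by (intro always_eventually allI) (simp add: divide_inverse)
    show "(\<lambda>n. B * inverse (real (Suc n))) \<longlonglongrightarrow> 0"
      using tendsto_mult_right_zero[OF LIMSEQ_inverse_real_of_nat] .
  qed
  have dcB: "\<bar>partial_deriv i (c n) x\<bar> \<le> B" for i n x
  proof -
    have "B / real (Suc n) \<le> B" using B(1) by (simp add: divide_le_eq)
    then show ?thesis using B(2)[of "real (Suc n)" i x] unfolding c_def by simp
  qed
  define v where "v n i x = c n x *\<^sub>R u i x" for n i x
  define h where "h n i = cutoff_gradient (c n) (u i) (g i)" for n i
  \<comment> \<open>The weight is dictated by \<open>c\<^sup>2 + (1 - c\<^sup>2) = 1\<close>, which
    makes the two Gram matrices complementary for all pairs of indices at once.\<close>
  define f where "f n i x = sqrt (1 - (c n x)\<^sup>2) *\<^sub>R u i x" for n i x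
  have gpv: "grad_pair (v n i) (h n i)" if "i \<in> {1..N}" for n i
    unfolding v_def[abs_def] h_def by (rule grad_pair_cutoff[OF gp[OF that] tc])
  have Lf: "L2_fun (f n i)" if "i \<in> {1..N}" for n i
    unfolding f_def[abs_def]
  proof (rule L2_fun_scaleR_bounded[OF _ _ Lu[OF that]])
    show "(\<lambda>x. sqrt (1 - (c n x)\<^sup>2)) \<in> borel_measurable borel" by measurable
    show "\<bar>sqrt (1 - (c n x)\<^sup>2)\<bar> \<le> 1" for x using c01[of n x] c2[of n x] by simp
  qed
  have gram: "L2_inner (v n i) (v n j) + L2_inner (f n i) (f n j) = (if i = j then 1 else 0)" if i: "i \<in> {1..N}" and j: "j \<in> {1..N}" for n i j
  proof -
    have "L2_inner (v n i) (v n j) + L2_inner (f n i) (f n j) = (LINT x|lborel. cnj (v n i x) * v n j x + cnj (f n i x) * f n j x)"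
      unfolding L2_inner_def
      by (intro Bochner_Integration.integral_add[symmetric] L2_inner_integrable grad_pair_L2(1)[OF gpv] Lf i j)
    also have "\<dots> = L2_inner (u i) (u j)"
      unfolding L2_inner_def
    proof (intro Bochner_Integration.integral_cong refl)
      fix x
      have "cnj (v n i x) * v n j x + cnj (f n i x) * f n j x = ((c n x)\<^sup>2 + (sqrt (1 - (c n x)\<^sup>2))\<^sup>2) *\<^sub>R (cnj (u i x) * u j x)"
        by (simp add: v_def f_def scaleR_add_left power2_eq_square del: real_sqrt_pow2 real_sqrt_mult_self)
      also have "(c n x)\<^sup>2 + (sqrt (1 - (c n x)\<^sup>2))\<^sup>2 = 1" using c2[of n x] by simp
      finally show "cnj (v n i x) * v n j x + cnj (f n i x) * f n j x = cnj (u i x) * u j x" by simp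
    qed
    finally show ?thesis using on i j by (simp add: orthonormal_H1_def)
  qed
  have hlim: "(\<lambda>n. LINT x|lborel. (norm (h n i x))\<^sup>2) \<longlonglongrightarrow> (LINT x|lborel. (norm (g i x))\<^sup>2)" if i: "i \<in> {1..N}" for i
  proof (rule integral_dominated_convergence[where w="\<lambda>x. 2 * (norm (g i x))\<^sup>2 + 2 * (real CARD('d) * B)\<^sup>2 * (norm (u i x))\<^sup>2"])
    show "integrable lborel (\<lambda>x. 2 * (norm (g i x))\<^sup>2 + 2 * (real CARD('d) * B)\<^sup>2 * (norm (u i x))\<^sup>2)"
      using L2_fun_integrable[OF Lu[OF i]] L2_fun_integrable[OF Lg[OF i]] by simp
    show "(\<lambda>x. (norm (g i x))\<^sup>2) \<in> borel_measurable lborel" using L2_fun_measurable[OF Lg[OF i]] by simp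
    show "(\<lambda>x. (norm (h n i x))\<^sup>2) \<in> borel_measurable lborel" for n
      using L2_fun_measurable[OF grad_pair_L2(2)[OF gpv[OF i]]] by simp
    show "AE x in lborel. (\<lambda>n. (norm (h n i x))\<^sup>2) \<longlonglongrightarrow> (norm (g i x))\<^sup>2"
    proof (rule AE_I2)
      fix x
      have "(\<lambda>n. \<chi> j. partial_deriv j (c n) x *\<^sub>R u i x) \<longlonglongrightarrow> (\<chi> j. 0 *\<^sub>R u i x)"
        by (intro tendsto_vec_lambda tendsto_scaleR dclim tendsto_const)
      then have "(\<lambda>n. h n i x) \<longlonglongrightarrow> 1 *\<^sub>R g i x + (\<chi> j. 0 *\<^sub>R u i x)"
        unfolding h_def cutoff_gradient_def by (intro tendsto_add tendsto_scaleR clim tendsto_const)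
      then have "(\<lambda>n. h n i x) \<longlonglongrightarrow> g i x" by (simp add: vec_eq_iff[symmetric] zero_vec_def[symmetric])
      then show "(\<lambda>n. (norm (h n i x))\<^sup>2) \<longlonglongrightarrow> (norm (g i x))\<^sup>2" by (intro tendsto_intros)
    qed
    show "AE x in lborel. norm ((norm (h n i x))\<^sup>2) \<le> 2 * (norm (g i x))\<^sup>2 + 2 * (real CARD('d) * B)\<^sup>2 * (norm (u i x))\<^sup>2" for n
    proof (rule AE_I2)
      fix x
      have "norm (\<chi> j. partial_deriv j (c n) x *\<^sub>R u i x) \<le> (\<Sum>j\<in>(UNIV::'d set). norm (partial_deriv j (c n) x *\<^sub>R u i x))"
        using L2_set_le_sum[of UNIV "\<lambda>j. norm (partial_deriv j (c n) x *\<^sub>R u i x)"] by (simp add: norm_vec_def)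
      also have "\<dots> \<le> (\<Sum>j\<in>(UNIV::'d set). B * norm (u i x))"
        using dcB by (intro sum_mono) (auto intro: mult_right_mono)
      finally have 1: "norm (\<chi> j. partial_deriv j (c n) x *\<^sub>R u i x) \<le> real CARD('d) * B * norm (u i x)" by simp
      have 2: "norm (c n x *\<^sub>R g i x) \<le> norm (g i x)" using c01[of n x] by (simp add: mult_left_le_one_le)
      have "norm (h n i x) \<le> norm (c n x *\<^sub>R g i x) + norm (\<chi> j. partial_deriv j (c n) x *\<^sub>R u i x)"
        unfolding h_def cutoff_gradient_def by (rule norm_triangle_ineq)
      also have "\<dots> \<le> norm (g i x) + real CARD('d) * B * norm (u i x)" by (rule add_mono[OF 2 1])
      finally have "(norm (h n i x))\<^sup>2 \<le> (norm (g i x) + real CARD('d) * B * norm (u i x))\<^sup>2"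
        by (intro power_mono) auto
      also have "\<dots> \<le> 2 * (norm (g i x))\<^sup>2 + 2 * (real CARD('d) * B * norm (u i x))\<^sup>2"
        using sum_squares_bound[of "norm (g i x)" "real CARD('d) * B * norm (u i x)"] by (simp add: power2_sum)
      finally show "norm ((norm (h n i x))\<^sup>2) \<le> 2 * (norm (g i x))\<^sup>2 + 2 * (real CARD('d) * B)\<^sup>2 * (norm (u i x))\<^sup>2"
        by (simp add: power_mult_distrib)
    qed
  qed
  have flim: "(\<lambda>n. LINT x|lborel. (norm (f n i x))\<^sup>2) \<longlonglongrightarrow> (LINT x::real^'d|lborel. (0::real))" if i: "i \<in> {1..N}" for i
  proof (rule integral_dominated_convergence[where w="\<lambda>x. (norm (u i x))\<^sup>2"])
    have e: "(norm (f n i x))\<^sup>2 = (1 - (c n x)\<^sup>2) * (norm (u i x))\<^sup>2" for n x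
      using c2[of n x] by (simp add: f_def power_mult_distrib)
    show "AE x in lborel. (\<lambda>n. (norm (f n i x))\<^sup>2) \<longlonglongrightarrow> 0"
    proof (rule AE_I2)
      fix x
      have "(\<lambda>n. (1 - (c n x)\<^sup>2) * (norm (u i x))\<^sup>2) \<longlonglongrightarrow> (1 - 1\<^sup>2) * (norm (u i x))\<^sup>2"
        by (intro tendsto_intros clim)
      then show "(\<lambda>n. (norm (f n i x))\<^sup>2) \<longlonglongrightarrow> 0" unfolding e by simp
    qed
    show "AE x in lborel. norm ((norm (f n i x))\<^sup>2) \<le> (norm (u i x))\<^sup>2" for n
    proof (rule AE_I2)
      fix x
      have "(1 - (c n x)\<^sup>2) * (norm (u i x))\<^sup>2 \<le> 1 * (norm (u i x))\<^sup>2" by (intro mult_right_mono) auto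
      moreover have "norm ((norm (f n i x))\<^sup>2) = (norm (f n i x))\<^sup>2" by simp
      ultimately show "norm ((norm (f n i x))\<^sup>2) \<le> (norm (u i x))\<^sup>2" unfolding e by simp
    qed
    show "(\<lambda>x. (norm (f n i x))\<^sup>2) \<in> borel_measurable lborel" for n
      using L2_fun_measurable[OF Lf[OF i]] by simp
    show "integrable lborel (\<lambda>x. (norm (u i x))\<^sup>2)" using L2_fun_integrable[OF Lu[OF i]] .
  qed simp
  have dv: "density N (v n) x = (c n x)\<^sup>2 * density N u x" for n x
    using c01[of n x] by (simp add: density_def v_def power_mult_distrib sum_distrib_left)
  have ip: "integrable lborel (\<lambda>x. density N u x powr p)" using p by (intro density_powr_integrable[OF on]) auto
  have dlim: "(\<lambda>n. LINT x|lborel. density N (v n) x powr p) \<longlonglongrightarrow> (LINT x|lborel. density N u x powr p)"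
  proof (rule integral_dominated_convergence[OF _ _ ip])
    show "AE x in lborel. (\<lambda>n. density N (v n) x powr p) \<longlonglongrightarrow> density N u x powr p"
    proof (rule AE_I2)
      fix x
      have "(\<lambda>n. (c n x)\<^sup>2 * density N u x) \<longlonglongrightarrow> 1\<^sup>2 * density N u x" by (intro tendsto_intros clim)
      then have "(\<lambda>n. density N (v n) x) \<longlonglongrightarrow> density N u x" unfolding dv by simp
      then show "(\<lambda>n. density N (v n) x powr p) \<longlonglongrightarrow> density N u x powr p"
        using p density_nonneg by (intro tendsto_powr' tendsto_const) (auto intro!: always_eventually)
    qed
    show "AE x in lborel. norm (density N (v n) x powr p) \<le> density N u x powr p" for n
    proof (rule AE_I2)
      fix x
      have "density N (v n) x \<le> density N u x"
        unfolding dv using c2[of n x] density_nonneg[of N u x] by (simp add: mult_left_le_one_le)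
      then show "norm (density N (v n) x powr p) \<le> density N u x powr p"
        using p density_nonneg[of N "v n" x] by (simp add: powr_mono2)
    qed
    show "(\<lambda>x. density N u x powr p) \<in> borel_measurable lborel" using ip by simp
    show "(\<lambda>x. density N (v n) x powr p) \<in> borel_measurable lborel" for n
      unfolding dv using orthonormal_density(3)[OF on] by simp
  qed
  have "(\<lambda>n. (\<Sum>i=1..N. LINT x|lborel. (norm (h n i x))\<^sup>2) + \<kappa> * (\<Sum>i=1..N. LINT x|lborel. (norm (f n i x))\<^sup>2)
      - 1 / p * (LINT x|lborel. density N (v n) x powr p))
    \<longlonglongrightarrow> (\<Sum>i=1..N. LINT x|lborel. (norm (g i x))\<^sup>2) + \<kappa> * (\<Sum>i=1..N. LINT x::real^'d|lborel. (0::real))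
      - 1 / p * (LINT x|lborel. density N u x powr p)"
    by (intro tendsto_diff tendsto_add tendsto_mult tendsto_const tendsto_sum hlim flim dlim)
  moreover have "(\<Sum>i=1..N. LINT x|lborel. (norm (g i x))\<^sup>2) + \<kappa> * (\<Sum>i=1..N. LINT x::real^'d|lborel. (0::real))
      - 1 / p * (LINT x|lborel. density N u x powr p) = energy p N u"
    using kinetic_eq[OF gp] by (simp add: energy_def)
  ultimately have "\<forall>\<^sub>F n in sequentially. (\<Sum>i=1..N. LINT x|lborel. (norm (h n i x))\<^sup>2) + \<kappa> * (\<Sum>i=1..N. LINT x|lborel. (norm (f n i x))\<^sup>2)
      - 1 / p * (LINT x|lborel. density N (v n) x powr p) < energy p N u + \<epsilon>"
    using eps by (intro order_tendstoD(2)) auto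
  then obtain n where n: "(\<Sum>i=1..N. LINT x|lborel. (norm (h n i x))\<^sup>2) + \<kappa> * (\<Sum>i=1..N. LINT x|lborel. (norm (f n i x))\<^sup>2)
      - 1 / p * (LINT x|lborel. density N (v n) x powr p) < energy p N u + \<epsilon>"
    using eventually_happens'[OF sequentially_bot] by blast
  have supp: "v n i x = 0 \<and> h n i x = 0"
    if "i \<in> {1..N}" "x \<notin> cbox (vec (- real (Suc n))) (vec (real (Suc n)))" for i x
    using cutoff_support[OF _ that(2)] by (simp add: v_def h_def c_def cutoff_gradient_def vec_eq_iff)
  have "\<exists>w R. orthonormal_H1 N w \<and> R \<ge> 0 \<and> (\<forall>i\<in>{1..N}. \<forall>x. x \<notin> cbox (vec (-R)) (vec R) \<longrightarrow> w i x = 0) \<and>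
      (\<Sum>i=1..N. kinetic (w i)) \<le> (\<Sum>i=1..N. LINT x|lborel. (norm (h n i x))\<^sup>2) + \<kappa> * (\<Sum>i=1..N. LINT x|lborel. (norm (f n i x))\<^sup>2) \<and>
      (\<forall>x. density N (v n) x \<le> density N w x)"
    unfolding \<kappa>_def
    by (rule orthonormal_completion[of N "v n" "h n" "real (Suc n)" "f n"]) (assumption | rule gpv supp Lf gram of_nat_0_le_iff)+
  then obtain w R where w: "orthonormal_H1 N w" "R \<ge> 0" "\<forall>i\<in>{1..N}. \<forall>x. x \<notin> cbox (vec (-R)) (vec R) \<longrightarrow> w i x = 0"
    "(\<Sum>i=1..N. kinetic (w i)) \<le> (\<Sum>i=1..N. LINT x|lborel. (norm (h n i x))\<^sup>2) + \<kappa> * (\<Sum>i=1..N. LINT x|lborel. (norm (f n i x))\<^sup>2)"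
    "\<forall>x. density N (v n) x \<le> density N w x"
    by (elim exE conjE) (rule that)
  \<comment> \<open>The far states can only raise the density, and the interaction is subtracted, so
    this change has the right sign.\<close>
  have pm: "density N (v n) x powr p \<le> density N w x powr p" for x
    by (rule powr_mono2) (use p w(5) density_nonneg[of N "v n" x] in auto)
  have "(LINT x|lborel. density N (v n) x powr p) \<le> (LINT x|lborel. density N w x powr p)"
  proof (rule integral_mono)
    show wi: "integrable lborel (\<lambda>x. density N w x powr p)" using p by (intro density_powr_integrable[OF w(1)]) auto
    show "density N (v n) x powr p \<le> density N w x powr p" for x
      by (rule pm)
    show "integrable lborel (\<lambda>x. density N (v n) x powr p)"
    proof (rule Bochner_Integration.integrable_bound[OF wi])
      show "(\<lambda>x. density N (v n) x powr p) \<in> borel_measurable lborel"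
        unfolding dv using orthonormal_density(3)[OF on] by simp
      show "AE x in lborel. norm (density N (v n) x powr p) \<le> norm (density N w x powr p)"
        by (intro AE_I2) (simp add: pm)
    qed
  qed
  then have "1 / p * (LINT x|lborel. density N (v n) x powr p) \<le> 1 / p * (LINT x|lborel. density N w x powr p)"
    using p by (intro mult_left_mono) auto
  then have E: "energy p N w \<le> energy p N u + \<epsilon>" using n w(4) by (simp add: energy_def)
  show ?thesis by (rule exI[of _ w], rule exI[of _ R], intro conjI w(1) w(2) w(3) E)
qed

subsection \<open>Subadditivity\<close>

lemma powr_add_disjoint:
  fixes a b :: real
  assumes "a = 0 \<or> b = 0" "p > 0" shows "(a + b) powr p = a powr p + b powr p"
  using assms by auto

text \<open>Disjoint supports make the inner products between the two families vanish. At each point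
  at most one of the densities is nonzero, so even the nonlinear power is additive.\<close>

lemma orthonormal_union:
  fixes w1 w2 :: "nat \<Rightarrow> real^'d \<Rightarrow> complex"
  assumes p: "1 < p" "p < 1 + 2 / real CARD('d)"
    and w1: "orthonormal_H1 N w1" "R1 \<ge> 0" "\<And>i x. i \<in> {1..N} \<Longrightarrow> x \<notin> cbox (vec (-R1)) (vec R1) \<Longrightarrow> w1 i x = 0"
    and w2: "orthonormal_H1 M w2" "R2 \<ge> 0" "\<And>i x. i \<in> {1..M} \<Longrightarrow> x \<notin> cbox (vec (-R2)) (vec R2) \<Longrightarrow> w2 i x = 0"
  shows "\<exists>w :: nat \<Rightarrow> real^'d \<Rightarrow> complex. orthonormal_H1 (N + M) w \<and> energy p (N + M) w = energy p N w1 + energy p M w2"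
proof -
  \<comment> \<open>After the shift, the second family lives where every coordinate is at least
    \<open>R1 + 1\<close>, the first where every coordinate is at most \<open>R1\<close>.\<close>
  define t where "t = (vec (- (R1 + R2 + 1)) :: real^'d)"
  define w where "w k = (if k \<le> N then w1 k else (\<lambda>x. w2 (k - N) (t + x)))" for k
  have disj: "w1 i x = 0 \<or> w2 j (t + x) = 0" if i: "i \<in> {1..N}" and j: "j \<in> {1..M}" for i j x
  proof (rule ccontr)
    assume "\<not> (w1 i x = 0 \<or> w2 j (t + x) = 0)"
    then have a: "x \<in> cbox (vec (-R1)) (vec R1)" "t + x \<in> cbox (vec (-R2)) (vec R2)" using w1(3)[OF i] w2(3)[OF j] by blast+
    obtain m :: 'd where True by blast
    have "x $ m \<le> R1" "- R2 \<le> (t + x) $ m" using a by (auto simp: mem_box_cart)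
    then show False by (simp add: t_def)
  qed
  have idx: "k \<in> {1..N} \<or> (k - N \<in> {1..M} \<and> \<not> k \<le> N)" if "k \<in> {1..N + M}" for k using that by auto
  have H: "w k \<in> H1" if "k \<in> {1..N + M}" for k
    using idx[OF that]
  proof
    assume "k \<in> {1..N}" then show ?thesis using orthonormal_H1D(1)[OF w1(1)] by (simp add: w_def)
  next
    assume k: "k - N \<in> {1..M} \<and> \<not> k \<le> N"
    then obtain g where "grad_pair (w2 (k - N)) g" using orthonormal_H1D(2)[OF w2(1)] by blast
    from grad_pair_translate[OF this, of t] show ?thesis using k unfolding H1_iff by (auto simp: w_def)
  qed
  have I: "L2_inner (w j) (w k) = (if j = k then 1 else 0)" if j: "j \<in> {1..N + M}" and k: "k \<in> {1..N + M}" for j k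
  proof -
    consider "j \<in> {1..N}" "k \<in> {1..N}" | "j \<in> {1..N}" "k - N \<in> {1..M}" "\<not> k \<le> N"
      | "j - N \<in> {1..M}" "\<not> j \<le> N" "k \<in> {1..N}" | "j - N \<in> {1..M}" "\<not> j \<le> N" "k - N \<in> {1..M}" "\<not> k \<le> N"
      using idx[OF j] idx[OF k] by blast
    then show ?thesis
    proof cases
      case 1
      then show ?thesis using w1(1) by (auto simp: w_def orthonormal_H1_def)
    next
      case 2
      have "L2_inner (w j) (w k) = 0" using disj[OF 2(1,2)] 2 by (intro L2_inner_disjoint) (auto simp: w_def)
      then show ?thesis using 2 by auto
    next
      case 3
      have "L2_inner (w j) (w k) = 0" using disj[OF 3(3,1)] 3 by (intro L2_inner_disjoint) (auto simp: w_def)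
      then show ?thesis using 3 by auto
    next
      case 4
      have "L2_inner (w j) (w k) = L2_inner (w2 (j - N)) (w2 (k - N))"
        using 4 L2_inner_translate[OF orthonormal_H1D(3)[OF w2(1) 4(1)] orthonormal_H1D(3)[OF w2(1) 4(3)]] by (simp add: w_def)
      also have "\<dots> = (if j - N = k - N then 1 else 0)" using w2(1) 4 by (auto simp: orthonormal_H1_def)
      finally show ?thesis using 4 by auto
    qed
  qed
  have on: "orthonormal_H1 (N + M) w" using H I by (simp add: orthonormal_H1_def)
  have split: "(\<Sum>i=1..N + M. F (w i)) = (\<Sum>i=1..N. F (w1 i)) + (\<Sum>i=1..M. F (\<lambda>x. w2 i (t + x)))"
    for F :: "(real^'d \<Rightarrow> complex) \<Rightarrow> real"
  proof -
    have "(\<Sum>i=1..N + M. F (w i)) = (\<Sum>i=1..N. F (w i)) + (\<Sum>i=N + 1..N + M. F (w i))"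
      by (rule sum.ub_add_nat) simp
    also have "(\<Sum>i=N + 1..N + M. F (w i)) = (\<Sum>i=1..M. F (w (i + N)))"
      using sum.shift_bounds_cl_nat_ivl[of "\<lambda>i. F (w i)" 1 N M] by (simp add: add.commute)
    also have "\<dots> = (\<Sum>i=1..M. F (\<lambda>x. w2 i (t + x)))" by (intro sum.cong refl) (auto simp: w_def)
    also have "(\<Sum>i=1..N. F (w i)) = (\<Sum>i=1..N. F (w1 i))" by (intro sum.cong refl) (auto simp: w_def)
    finally show ?thesis .
  qed
  have kin: "(\<Sum>i=1..N + M. kinetic (w i)) = (\<Sum>i=1..N. kinetic (w1 i)) + (\<Sum>i=1..M. kinetic (w2 i))"
    unfolding split using kinetic_translate[OF orthonormal_H1D(1)[OF w2(1)]] by simp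
  have dens: "density (N + M) w x = density N w1 x + density M w2 (t + x)" for x
    unfolding density_def by (rule split[of "\<lambda>f. (norm (f x))\<^sup>2"])
  have dz: "density N w1 x = 0 \<or> density M w2 (t + x) = 0" for x
  proof (rule ccontr)
    assume nz: "\<not> (density N w1 x = 0 \<or> density M w2 (t + x) = 0)"
    have "\<exists>i\<in>{1..N}. w1 i x \<noteq> 0" using nz by (rule_tac ccontr) (auto simp: density_def)
    moreover have "\<exists>j\<in>{1..M}. w2 j (t + x) \<noteq> 0" using nz by (rule_tac ccontr) (auto simp: density_def)
    ultimately show False using disj by blast
  qed
  have i1: "integrable lborel (\<lambda>x. density N w1 x powr p)" using p by (intro density_powr_integrable[OF w1(1)]) auto
  have i2: "integrable lborel (\<lambda>x. density M w2 x powr p)" using p by (intro density_powr_integrable[OF w2(1)]) auto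
  have m2: "(\<lambda>x. density M w2 x powr p) \<in> borel_measurable borel" using borel_measurable_integrable[OF i2] by simp
  have "(LINT x|lborel. density (N + M) w x powr p) = (LINT x|lborel. density N w1 x powr p + density M w2 (t + x) powr p)"
    unfolding dens using dz p by (intro Bochner_Integration.integral_cong refl powr_add_disjoint) auto
  also have "\<dots> = (LINT x|lborel. density N w1 x powr p) + (LINT x|lborel. density M w2 (t + x) powr p)"
    using i1 i2 integrable_translate[OF m2, of t] by (intro Bochner_Integration.integral_add) auto
  also have "(LINT x|lborel. density M w2 (t + x) powr p) = (LINT x|lborel. density M w2 x powr p)"
    by (rule integral_translate[OF m2])
  finally have "energy p (N + M) w = energy p N w1 + energy p M w2"
    unfolding energy_def kin by (simp add: algebra_simps)
  then show ?thesis using on by blast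
qed

context
  fixes p :: real and T :: "'d::finite itself"
  assumes p: "1 < p" "p < 1 + 2 / real CARD('d)" 
begin

text \<open>Nonemptiness comes from disjoint translates of one state and the lower bound from
  Lieb--Thirring; together they make the \<open>Inf\<close> in \<open>J\<close> a genuine
  infimum.\<close>

lemma energy_set:
  assumes "N \<ge> 1"
  defines "S \<equiv> {energy p N u | u :: nat \<Rightarrow> real^'d \<Rightarrow> complex. orthonormal_H1 N u}"
  shows "S \<noteq> {}" "bdd_below S" "J T p N = Inf S"
proof -
  show "S \<noteq> {}" unfolding S_def using far_states_orthonormal_H1 by blast
  show "bdd_below S" unfolding S_def
    using energy_lower_bound[OF p _ assms(1)] by (intro bdd_belowI[of _ "e_LT TYPE('d) p * real N"]) auto
  show "J T p N = Inf S" by (simp add: J_def S_def)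
qed

lemma J_le_energy:
  assumes "N \<ge> 1" "orthonormal_H1 N (u :: nat \<Rightarrow> real^'d \<Rightarrow> complex)" shows "J T p N \<le> energy p N u"
  unfolding energy_set(3)[OF assms(1)] using assms energy_set(2)[OF assms(1)] by (intro cInf_lower) auto

lemma J_lower_bound: "N \<ge> 1 \<Longrightarrow> e_LT TYPE('d) p * real N \<le> J T p N"
  unfolding energy_set(3) using energy_set(1) energy_lower_bound[OF p] by (intro cInf_greatest) auto

lemma J_approx:
  assumes "N \<ge> 1" "\<epsilon> > 0"
  obtains u :: "nat \<Rightarrow> real^'d \<Rightarrow> complex" where "orthonormal_H1 N u" "energy p N u < J T p N + \<epsilon>"
  using cInf_lessD[OF energy_set(1)[OF assms(1)], of "J T p N + \<epsilon>"] energy_set(3)[OF assms(1)] assms(2) that by auto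

text \<open>Minimizers are not assumed to exist. The error \<open>\<epsilon>\<close> is shared among
  four steps: an almost minimizing family on each side and a compactly supported replacement for
  each.\<close>

lemma J_subadditive:
  assumes N: "N \<ge> 1" "M \<ge> 1" shows "J T p (N + M) \<le> J T p N + J T p M"
proof (rule field_le_epsilon)
  fix \<epsilon> :: real assume e: "\<epsilon> > 0"
  have e4: "\<epsilon> / 4 > 0" using e by simp
  obtain u1 :: "nat \<Rightarrow> real^'d \<Rightarrow> complex" where u1: "orthonormal_H1 N u1" "energy p N u1 < J T p N + \<epsilon> / 4"
    by (rule J_approx[OF N(1) e4])
  obtain u2 :: "nat \<Rightarrow> real^'d \<Rightarrow> complex" where u2: "orthonormal_H1 M u2" "energy p M u2 < J T p M + \<epsilon> / 4"
    by (rule J_approx[OF N(2) e4])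
  obtain w1 :: "nat \<Rightarrow> real^'d \<Rightarrow> complex" and R1 where w1: "orthonormal_H1 N w1" "R1 \<ge> 0" "\<forall>i\<in>{1..N}. \<forall>x. x \<notin> cbox (vec (-R1)) (vec R1) \<longrightarrow> w1 i x = 0"
    "energy p N w1 \<le> energy p N u1 + \<epsilon> / 4"
    using compact_approximation[OF u1(1) p e4] by (elim exE conjE) (rule that)
  obtain w2 :: "nat \<Rightarrow> real^'d \<Rightarrow> complex" and R2 where w2: "orthonormal_H1 M w2" "R2 \<ge> 0" "\<forall>i\<in>{1..M}. \<forall>x. x \<notin> cbox (vec (-R2)) (vec R2) \<longrightarrow> w2 i x = 0"
    "energy p M w2 \<le> energy p M u2 + \<epsilon> / 4"
    using compact_approximation[OF u2(1) p e4] by (elim exE conjE) (rule that)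
  have "\<exists>w :: nat \<Rightarrow> real^'d \<Rightarrow> complex. orthonormal_H1 (N + M) w \<and> energy p (N + M) w = energy p N w1 + energy p M w2"
    by (rule orthonormal_union[OF p w1(1,2) _ w2(1,2)]) (use w1(3) w2(3) in blast)+
  then obtain w :: "nat \<Rightarrow> real^'d \<Rightarrow> complex" where w: "orthonormal_H1 (N + M) w" "energy p (N + M) w = energy p N w1 + energy p M w2"
    by blast
  have "J T p (N + M) \<le> energy p (N + M) w" using N by (intro J_le_energy w(1)) simp
  then show "J T p (N + M) \<le> J T p N + J T p M + \<epsilon>" using w(2) w1(4) w2(4) u1(2) u2(2) by linarith
qed

end

text \<open>Division with remainder by an index \<open>m\<close> that is almost optimal.
  Subadditivity is assumed for positive indices only, so multiples of \<open>m\<close> are written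
  with \<open>Suc q\<close> and a zero remainder is a separate case.\<close>

lemma fekete:
  fixes a :: "nat \<Rightarrow> real"
  assumes sub: "\<And>m n. m \<ge> 1 \<Longrightarrow> n \<ge> 1 \<Longrightarrow> a (m + n) \<le> a m + a n"
    and bdd: "\<And>n. n \<ge> 1 \<Longrightarrow> L * real n \<le> a n"
  shows "(\<lambda>n. a n / real n) \<longlonglongrightarrow> (INF n\<in>{1..}. a n / real n)"
proof -
  let ?S = "(\<lambda>n. a n / real n) ` {1..}"
  have low: "I \<le> a n / real n" if "I = Inf ?S" "n \<ge> 1" for n I
  proof -
    have "bdd_below ?S" using bdd by (intro bdd_belowI[of _ L]) (auto simp: pos_le_divide_eq)
    then show ?thesis using that by (auto intro: cInf_lower)
  qed
  show ?thesis
  proof (rule LIMSEQ_I)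
    fix e :: real assume e: "e > 0"
    have "?S \<noteq> {}" by auto
    from cInf_lessD[OF this, of "Inf ?S + e / 2"] obtain m where m: "m \<ge> 1" "a m / real m < Inf ?S + e / 2"
      using e by auto
    define M where "M = (\<Sum>r<m. \<bar>a r\<bar>)"
    have M: "\<bar>a r\<bar> \<le> M" if "r < m" for r unfolding M_def using that by (intro member_le_sum) auto
    have mult: "a (Suc q * m) \<le> real (Suc q) * a m" for q
    proof (induction q)
      case (Suc q)
      have "a (Suc (Suc q) * m) \<le> a m + a (Suc q * m)" using sub[of m "Suc q * m"] m(1) by simp
      then show ?case using Suc by (simp add: algebra_simps)
    qed simp
    \<comment> \<open>\<open>M\<close> bounds the value at the remainder, and
      \<open>\<bar>a m\<bar>\<close> absorbs the error from replacing \<open>q\<close> by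
      \<open>n / m\<close>, whichever sign \<open>a m\<close> has.\<close>
    define K where "K = \<bar>a m\<bar> + M"
    have K: "K \<ge> 0" using M[of 0] m(1) by (simp add: K_def)
    have bound: "a n / real n \<le> a m / real m + K / real n" if n: "n \<ge> m" for n
    proof -
      define q r where "q = n div m" and "r = n mod m"
      have q: "q \<ge> 1" unfolding q_def using n m(1) by (simp add: div_greater_zero_iff Suc_leI)
      have r: "r < m" unfolding r_def using m(1) by simp
      have nq: "n = q * m + r" by (simp add: q_def r_def)
      have aq: "a (q * m) \<le> real q * a m" using mult[of "q - 1"] q by simp
      have "a n \<le> real q * a m + M"
      proof (cases "r = 0")
        case True
        then show ?thesis using aq nq M[of 0] m(1) by simp
      next
        case False
        have "a n \<le> a (q * m) + a r" unfolding nq using False q m(1) by (intro sub) auto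
        then show ?thesis using aq M[OF r] by linarith
      qed
      moreover have "real q * a m \<le> real n * (a m / real m) + \<bar>a m\<bar>"
      proof -
        have "real n * (a m / real m) = real q * a m + real r * (a m / real m)"
          unfolding nq using m(1) by (simp add: field_simps)
        moreover have "- (real r * (a m / real m)) \<le> \<bar>a m\<bar>"
        proof -
          have "\<bar>real r * (a m / real m)\<bar> = (real r / real m) * \<bar>a m\<bar>" using m(1) by (simp add: abs_mult)
          also have "\<dots> \<le> 1 * \<bar>a m\<bar>" using r by (intro mult_right_mono) auto
          finally show ?thesis by linarith
        qed
        ultimately show ?thesis by linarith
      qed
      ultimately have "a n \<le> real n * (a m / real m) + K" by (simp add: K_def)
      moreover have "real n > 0" using n m(1) by simp
      ultimately show ?thesis using divide_right_mono[of "a n" _ "real n"] by (fastforce simp: add_divide_distrib)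
    qed
    obtain n0 where n0: "2 * K / e < real n0" using reals_Archimedean2 by blast
    show "\<exists>n1. \<forall>n\<ge>n1. norm (a n / real n - (INF n\<in>{1..}. a n / real n)) < e"
    proof (intro exI allI impI)
      fix n assume n: "n \<ge> max m (Suc n0)"
      have "K / real n < e / 2"
      proof -
        have "2 * K / e < real n" using n0 n by linarith
        moreover have "real n > 0" using n by simp
        ultimately show ?thesis using e by (simp add: field_simps)
      qed
      moreover have "m \<le> n" using n by simp
      ultimately have "a n / real n < Inf ?S + e" using bound[of n] m(2) by linarith
      moreover have "Inf ?S \<le> a n / real n" using low n by auto
      ultimately show "norm (a n / real n - (INF n\<in>{1..}. a n / real n)) < e" by simp
    qed
  qed
qed

subsection \<open>Dirichlet modes on a cube\<close>

lemma AE_component_neq: "AE x in (lborel :: (real^'d) measure). x $ i \<noteq> c"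
proof -
  have "(axis i 1 :: real^'d) \<in> Basis" by (simp add: axis_in_Basis_iff)
  from negligible_imp_AE[OF negligible_standard_hyperplane[OF this, of c]]
  show ?thesis by (simp add: cart_eq_inner_axis)
qed

text \<open>Lebesgue measure is the image of a product measure indexed by \<open>Basis\<close>, and
  the axes identify \<open>Basis\<close> with the coordinate type; the claim is Fubini's theorem for
  that product.\<close>

lemma integral_prod_components:
  fixes f :: "'d::finite \<Rightarrow> real \<Rightarrow> real"
  assumes i: "\<And>i. integrable lborel (f i)"
  shows "integrable lborel (\<lambda>x::real^'d. \<Prod>i\<in>UNIV. f i (x $ i))"
    and "(LINT x::real^'d|lborel. (\<Prod>i\<in>UNIV. f i (x $ i))) = (\<Prod>i\<in>UNIV. LINT t|lborel. f i t)"
proof -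
  let ?a = "\<lambda>i. axis i 1 :: real^'d"
  have inj: "inj ?a" by (auto simp: inj_on_def axis_eq_axis)
  have Basis: "(Basis :: (real^'d) set) = range ?a" by (auto simp: Basis_vec_def)
  define F where "F b = f (inv ?a b)" for b
  have Fa: "F (?a i) = f i" for i by (simp add: F_def inv_f_f[OF inj])
  have iF: "integrable lborel (F b)" for b unfolding F_def by (rule i)
  have prodB: "(\<Prod>b\<in>Basis. g b) = (\<Prod>i\<in>UNIV. g (?a i))" for g :: "real^'d \<Rightarrow> real"
    unfolding Basis by (rule prod.reindex[OF inj, unfolded comp_def])
  have P: "(\<Prod>i\<in>UNIV. f i (x $ i)) = (\<Prod>b\<in>Basis. F b (x \<bullet> b))" for x :: "real^'d"
    unfolding prodB Fa by (simp add: cart_eq_inner_axis)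
  have m [measurable]: "F b \<in> borel_measurable borel" for b using borel_measurable_integrable[OF iF] by simp
  interpret product_sigma_finite "\<lambda>b::real^'d. lborel :: real measure" ..
  have fB: "finite (Basis :: (real^'d) set)" by simp
  let ?D = "distr (\<Pi>\<^sub>M b\<in>(Basis::(real^'d) set). lborel) borel (\<lambda>f. \<Sum>b\<in>Basis. f b *\<^sub>R b)"
  have comp: "(\<Sum>c\<in>Basis. h c *\<^sub>R c) \<bullet> b = h b" if "b \<in> Basis" for h :: "real^'d \<Rightarrow> real" and b
    using that by (simp add: inner_sum_left_Basis)
  have eq: "(\<Prod>b\<in>Basis. F b ((\<Sum>c\<in>Basis. h c *\<^sub>R c) \<bullet> b)) = (\<Prod>b\<in>Basis. F b (h b))" for h :: "real^'d \<Rightarrow> real"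
    using comp by (intro prod.cong) auto
  show "integrable lborel (\<lambda>x::real^'d. \<Prod>i\<in>UNIV. f i (x $ i))"
    unfolding P
    by (subst lborel_eq, subst integrable_distr_eq)
      (simp, measurable, unfold eq, intro product_integrable_prod fB iF)
  have "(LINT x::real^'d|lborel. (\<Prod>i\<in>UNIV. f i (x $ i))) = (LINT x|?D. (\<Prod>b\<in>Basis. F b (x \<bullet> b)))"
    unfolding P by (subst lborel_eq) simp
  also have "\<dots> = (LINT h|(\<Pi>\<^sub>M b\<in>(Basis::(real^'d) set). lborel). (\<Prod>b\<in>Basis. F b (h b)))"
    by (subst integral_distr) (auto simp: eq)
  also have "\<dots> = (\<Prod>b\<in>Basis. LINT t|lborel. F b t)" by (intro product_integral_prod fB iF)
  also have "\<dots> = (\<Prod>i\<in>UNIV. LINT t|lborel. f i t)" unfolding prodB Fa ..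
  finally show "(LINT x::real^'d|lborel. (\<Prod>i\<in>UNIV. f i (x $ i))) = (\<Prod>i\<in>UNIV. LINT t|lborel. f i t)" .
qed

context
  fixes L :: real assumes L: "L > 0"
begin

text \<open>Clamping the argument to \<open>[0, L]\<close> extends the sine by zero, since it vanishes at both ends.\<close>

definition sine :: "nat \<Rightarrow> real \<Rightarrow> real" where
  "sine m t = sqrt (2 / L) * sin (pi * real m / L * max 0 (min t L))"

definition sine' :: "nat \<Rightarrow> real \<Rightarrow> real" where
  "sine' m t = (if 0 < t \<and> t < L then sqrt (2 / L) * (pi * real m / L) * cos (pi * real m / L * t) else 0)"

lemma sine_eq: "sine m t = sqrt (2 / L) * sin (pi * real m / L * t) * indicator {0..L} t"
proof -
  have "sin (pi * real m / L * L) = 0" using L by (simp add: mult.commute)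
  then show ?thesis using L by (auto simp: sine_def indicator_def max_def min_def)
qed

lemma sine_bound: "\<bar>sine m t\<bar> \<le> sqrt (2 / L)"
  unfolding sine_def abs_mult using L by (simp add: mult_left_le)

lemma sine'_bound: "\<bar>sine' m t\<bar> \<le> sqrt (2 / L) * (pi * real m / L)"
proof -
  define c where "c = sqrt (2 / L) * (pi * real m / L)"
  have c: "c \<ge> 0" using L by (simp add: c_def)
  show ?thesis unfolding sine'_def c_def[symmetric] using c by (auto simp: abs_mult mult_left_le)
qed

lemma sine_lipschitz: "\<bar>sine m s - sine m t\<bar> \<le> sqrt (2 / L) * (pi * real m / L) * \<bar>s - t\<bar>"
proof -
  define c where "c = pi * real m / L"
  have c: "c \<ge> 0" using L by (simp add: c_def)
  have sin_lip: "\<bar>sin x - sin y\<bar> \<le> \<bar>x - y\<bar>" for x y :: real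
    using field_differentiable_bound[of UNIV sin cos 1 x y] by (auto intro: DERIV_sin)
  have "\<bar>sine m s - sine m t\<bar> = sqrt (2 / L) * \<bar>sin (c * max 0 (min s L)) - sin (c * max 0 (min t L))\<bar>"
    unfolding sine_def c_def[symmetric] using L c by (simp add: abs_mult right_diff_distrib[symmetric])
  also have "\<dots> \<le> sqrt (2 / L) * \<bar>c * max 0 (min s L) - c * max 0 (min t L)\<bar>"
    using L c by (intro mult_left_mono sin_lip) auto
  also have "\<dots> = sqrt (2 / L) * ((c) * \<bar>max 0 (min s L) - max 0 (min t L)\<bar>)"
    using L c by (simp add: abs_mult right_diff_distrib[symmetric])
  also have "\<dots> \<le> sqrt (2 / L) * ((c) * \<bar>s - t\<bar>)"
    using L c by (intro mult_left_mono) (auto simp: max_def min_def)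
  finally show ?thesis by (simp add: mult.assoc c_def)
qed

lemma sine_deriv:
  assumes "t \<noteq> 0" "t \<noteq> L" shows "(sine m has_real_derivative sine' m t) (at t)"
proof -
  consider "t < 0" | "0 < t" "t < L" | "t > L" using assms by linarith
  then show ?thesis
  proof cases
    case 1
    have "((\<lambda>t. 0) has_real_derivative sine' m t) (at t)" using 1 by (simp add: sine'_def)
    then show ?thesis
      by (rule has_field_derivative_transform_within_open[of _ _ _ "{..<0}"]) (use 1 in \<open>auto simp: sine_eq\<close>)
  next
    case 2
    have "((\<lambda>t. sqrt (2 / L) * sin (pi * real m / L * t)) has_real_derivative sine' m t) (at t)"
      using 2 by (auto intro!: derivative_eq_intros simp: sine'_def)
    then show ?thesis
      by (rule has_field_derivative_transform_within_open[of _ _ _ "{0<..<L}"]) (use 2 in \<open>auto simp: sine_eq\<close>)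
  next
    case 3
    have "((\<lambda>t. 0) has_real_derivative sine' m t) (at t)" using 3 by (simp add: sine'_def)
    then show ?thesis
      by (rule has_field_derivative_transform_within_open[of _ _ _ "{L<..}"]) (use 3 in \<open>auto simp: sine_eq\<close>)
  qed
qed

lemma sine_measurable [measurable]: "sine m \<in> borel_measurable borel" "sine' m \<in> borel_measurable borel"
proof -
  show "sine m \<in> borel_measurable borel" unfolding sine_def by measurable
  show "sine' m \<in> borel_measurable borel" unfolding sine'_def by measurable
qed

lemma sine_orthonormal:
  assumes "m \<ge> 1" "n \<ge> 1"
  shows "integrable lborel (\<lambda>t. sine m t * sine n t)"
    "(LINT t|lborel. sine m t * sine n t) = (if m = n then 1 else 0)"
proof -
  define a b where "a = pi * real m / L" and "b = pi * real n / L"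
  have ab: "a > 0" "b > 0" using assms L by (auto simp: a_def b_def)
  have aL: "a * L = real m * pi" "b * L = real n * pi" using L by (auto simp: a_def b_def)
  have s2: "sqrt (2 / L) * sqrt (2 / L) = 2 / L" using L by simp
  have e: "sine m t * sine n t = (2 / L * (sin (a * t) * sin (b * t))) * indicator {0..L} t" for t
  proof -
    have "sqrt (2 / L) * x * (sqrt (2 / L) * y) = (sqrt (2 / L) * sqrt (2 / L)) * (x * y)" for x y
      by (simp only: mult_ac)
    then have "sqrt (2 / L) * x * (sqrt (2 / L) * y) = 2 / L * (x * y)" for x y
      unfolding s2 .
    then show ?thesis
      unfolding sine_eq a_def[symmetric] b_def[symmetric] by (auto simp: indicator_def simp del: times_divide_eq_left times_divide_eq_right)
  qed
  \<comment> \<open>An antiderivative from the product-to-sum formula. Its sine terms vanish at both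
    ends because \<open>a * L\<close> and \<open>b * L\<close> are multiples of
    \<open>pi\<close>.\<close>
  define F where "F t = (if m = n then 2 / L * (t / 2 - sin (2 * a * t) / (4 * a))
      else 2 / L * (sin ((a - b) * t) / (2 * (a - b)) - sin ((a + b) * t) / (2 * (a + b))))" for t
  have ne: "m \<noteq> n \<Longrightarrow> a - b \<noteq> 0" using L by (auto simp: a_def b_def)
  have D: "DERIV F t :> 2 / L * (sin (a * t) * sin (b * t))" for t
  proof (cases "m = n")
    case True
    have D1: "DERIV (\<lambda>t. 2 / L * (t / 2 - sin (2 * a * t) / (4 * a))) t :> 2 / L * (1 / 2 - cos (2 * a * t) * (2 * a) / (4 * a))"
      using ab L by (auto intro!: derivative_eq_intros)
    have E1: "1 / 2 - cos (2 * a * t) * (2 * a) / (4 * a) = sin (a * t) * sin (b * t)"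
    proof -
      have "b = a" using True by (simp add: a_def b_def)
      have "c * (2 * a) / (4 * a) = c / 2" for c using ab by simp
      then have "1 / 2 - cos (2 * a * t) * (2 * a) / (4 * a) = 1 / 2 - cos (2 * (a * t)) / 2" by (simp only: mult.assoc)
      then show ?thesis unfolding cos_double_sin \<open>b = a\<close> by (simp add: diff_divide_distrib power2_eq_square)
    qed
    have "F = (\<lambda>t. 2 / L * (t / 2 - sin (2 * a * t) / (4 * a)))" by (auto simp: F_def True)
    then show ?thesis using D1 unfolding E1 by (simp only:)
  next
    case False
    have G: "DERIV (\<lambda>t. sin (c * t) / (2 * c)) t :> cos (c * t) / 2" if "c \<noteq> 0" for c
      using that by (auto intro!: derivative_eq_intros)
    have "a + b \<noteq> 0" using ab by simp
    then have D1: "DERIV (\<lambda>t. 2 / L * (sin ((a - b) * t) / (2 * (a - b)) - sin ((a + b) * t) / (2 * (a + b)))) t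
        :> 2 / L * (cos ((a - b) * t) / 2 - cos ((a + b) * t) / 2)"
      by (intro DERIV_cmult DERIV_diff G ne[OF False])
    have E1: "cos ((a - b) * t) / 2 - cos ((a + b) * t) / 2 = sin (a * t) * sin (b * t)"
      by (simp add: left_diff_distrib distrib_right cos_diff cos_add diff_divide_distrib add_divide_distrib)
    have "F = (\<lambda>t. 2 / L * (sin ((a - b) * t) / (2 * (a - b)) - sin ((a + b) * t) / (2 * (a + b))))" by (auto simp: F_def False)
    then show ?thesis using D1 unfolding E1 by (simp only:)
  qed
  have "has_bochner_integral lborel (\<lambda>t. (2 / L * (sin (a * t) * sin (b * t))) * indicator {0..L} t) (F L - F 0)"
    using L by (intro has_bochner_integral_FTC_Icc_real D) (auto intro!: continuous_intros)
  moreover have "F L - F 0 = (if m = n then 1 else 0)"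
  proof (cases "m = n")
    case True
    have "sin (2 * a * L) = 0" using aL(1) sin_npi[of "2 * m"] by (simp add: mult.assoc)
    then show ?thesis using True L by (simp add: F_def)
  next
    case False
    have "(a - b) * L = pi * of_int (int m - int n)" "(a + b) * L = pi * of_int (int m + int n)"
      using aL by (simp_all add: algebra_simps)
    then have "sin ((a - b) * L) = 0" "sin ((a + b) * L) = 0" by (simp_all only: sin_npi_int)
    then show ?thesis using False by (simp add: F_def)
  qed
  ultimately have "has_bochner_integral lborel (\<lambda>t. sine m t * sine n t) (if m = n then 1 else 0)"
    unfolding e by simp
  then show "integrable lborel (\<lambda>t. sine m t * sine n t)"
    "(LINT t|lborel. sine m t * sine n t) = (if m = n then 1 else 0)"
    by (auto simp: has_bochner_integral_iff)
qed

lemma sine'_norm: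
  assumes "m \<ge> 1"
  shows "integrable lborel (\<lambda>t. (sine' m t)\<^sup>2)" "(LINT t|lborel. (sine' m t)\<^sup>2) = (pi * real m / L)\<^sup>2"
proof -
  define a where "a = pi * real m / L"
  have a: "a > 0" using assms L by (auto simp: a_def)
  have aL: "a * L = real m * pi" using L by (auto simp: a_def)
  let ?f = "\<lambda>t. 2 / L * a\<^sup>2 * (cos (a * t))\<^sup>2"
  define F where "F t = 2 / L * a\<^sup>2 * (t / 2 + sin (2 * a * t) / (4 * a))" for t
  have D: "DERIV F t :> ?f t" for t
  proof -
    have "DERIV F t :> 2 / L * a\<^sup>2 * (1 / 2 + cos (2 * a * t) * (2 * a) / (4 * a))"
      unfolding F_def using a L by (auto intro!: derivative_eq_intros)
    moreover have "1 / 2 + cos (2 * a * t) * (2 * a) / (4 * a) = (cos (a * t))\<^sup>2"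
    proof -
      have "c * (2 * a) / (4 * a) = c / 2" for c using a by simp
      then have "1 / 2 + cos (2 * a * t) * (2 * a) / (4 * a) = 1 / 2 + cos (2 * (a * t)) / 2" by (simp only: mult.assoc)
      then show ?thesis unfolding cos_double_cos by (simp add: diff_divide_distrib)
    qed
    ultimately show ?thesis by simp
  qed
  have "has_bochner_integral lborel (\<lambda>t. ?f t * indicator {0..L} t) (F L - F 0)"
    using L by (intro has_bochner_integral_FTC_Icc_real D) (auto intro!: continuous_intros)
  moreover have "sin (2 * a * L) = 0" using aL sin_npi[of "2 * m"] by (simp add: mult.assoc)
  then have "F L - F 0 = a\<^sup>2" using L by (simp add: F_def)
  ultimately have h: "has_bochner_integral lborel (\<lambda>t. ?f t * indicator {0..L} t) (a\<^sup>2)" by simp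
  have sq: "(sqrt (2 / L) * a * cos y)\<^sup>2 = 2 / L * a\<^sup>2 * (cos y)\<^sup>2" for y
    using L by (simp add: power_mult_distrib)
  have pw: "?f t * indicator {0..L} t = (sine' m t)\<^sup>2" if "t \<noteq> 0" "t \<noteq> L" for t
  proof (cases "0 < t \<and> t < L")
    case True
    then have "indicator {0..L} t = (1::real)" "sine' m t = sqrt (2 / L) * a * cos (a * t)" by (simp_all add: sine'_def a_def)
    then show ?thesis by (simp only: sq mult_1_right)
  next
    case False
    then show ?thesis using that by (auto simp: sine'_def indicator_def)
  qed
  have ae: "AE t in lborel. ?f t * indicator {0..L} t = (sine' m t)\<^sup>2"
    by (rule AE_mp[OF AE_lborel_singleton[of 0]], rule AE_mp[OF AE_lborel_singleton[of L]]) (rule AE_I2, use pw in blast)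
  have "has_bochner_integral lborel (\<lambda>t. (sine' m t)\<^sup>2) (a\<^sup>2)"
    by (rule has_bochner_integral_cong_AE[THEN iffD1, OF _ _ ae h]) measurable
  then show "integrable lborel (\<lambda>t. (sine' m t)\<^sup>2)" "(LINT t|lborel. (sine' m t)\<^sup>2) = (pi * real m / L)\<^sup>2"
    by (auto simp: has_bochner_integral_iff a_def)
qed

definition mode :: "('d::finite \<Rightarrow> nat) \<Rightarrow> real^'d \<Rightarrow> complex" where
  "mode k x = of_real (\<Prod>i\<in>UNIV. sine (k i) (x $ i))"

definition mode_gradient :: "('d::finite \<Rightarrow> nat) \<Rightarrow> real^'d \<Rightarrow> complex^'d" where
  "mode_gradient k x = (\<chi> i. of_real (sine' (k i) (x $ i) * (\<Prod>j\<in>UNIV - {i}. sine (k j) (x $ j))))"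

lemma mode_measurable [measurable]: "mode k \<in> borel_measurable borel"
  unfolding mode_def[abs_def] by measurable

lemma mode_support:
  fixes x :: "real^'d"
  assumes "x \<notin> cbox 0 (vec L)" shows "mode k x = 0" "mode_gradient k x = 0"
proof -
  have "\<exists>i. \<not> (0 \<le> x $ i \<and> x $ i \<le> L)" using assms by (auto simp: mem_box_cart)
  then obtain i where i: "\<not> (0 \<le> x $ i \<and> x $ i \<le> L)" by blast
  then have s: "sine (k i) (x $ i) = 0" "sine' (k i) (x $ i) = 0" by (auto simp: sine_eq sine'_def)
  then show "mode k x = 0" by (auto simp: mode_def)
  have "sine' (k j) (x $ j) * (\<Prod>l\<in>UNIV - {j}. sine (k l) (x $ l)) = 0" for j
    using s by (cases "j = i") auto
  then show "mode_gradient k x = 0" unfolding mode_gradient_def vec_eq_iff by (simp only: vec_lambda_beta of_real_0 zero_index) simp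
qed

lemma prod_sine_bound: "\<bar>\<Prod>j\<in>S. sine (k j) (x $ j)\<bar> \<le> sqrt (2 / L) ^ card S" for x :: "real^'d" and S :: "'d set"
proof -
  have "\<bar>\<Prod>j\<in>S. sine (k j) (x $ j)\<bar> \<le> (\<Prod>j\<in>S. sqrt (2 / L))"
    unfolding abs_prod by (intro prod_mono) (auto simp: sine_bound)
  then show ?thesis by simp
qed

lemma mode_shift:
  fixes x :: "real^'d"
  shows "mode k (x + h *\<^sub>R axis i 1) = of_real (sine (k i) (x $ i + h) * (\<Prod>j\<in>UNIV - {i}. sine (k j) (x $ j)))"
proof -
  have "(\<Prod>j\<in>UNIV. sine (k j) ((x + h *\<^sub>R axis i 1) $ j))
      = sine (k i) ((x + h *\<^sub>R axis i 1) $ i) * (\<Prod>j\<in>UNIV - {i}. sine (k j) ((x + h *\<^sub>R axis i 1) $ j))"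
    by (rule prod.remove) auto
  also have "(\<Prod>j\<in>UNIV - {i}. sine (k j) ((x + h *\<^sub>R axis i 1) $ j)) = (\<Prod>j\<in>UNIV - {i}. sine (k j) (x $ j))"
    by (intro prod.cong) (auto simp: axis_def)
  finally show ?thesis unfolding mode_def by (simp add: axis_def)
qed

text \<open>Extended by zero, a mode is a product of bounded Lipschitz functions with compact
  support, and its derivative in direction \<open>i\<close> exists away from the two hyperplanes
  where \<open>x $ i\<close> is 0 or \<open>L\<close>, which are null. The zero boundary values are
  what excludes a jump at the faces.\<close>

lemma mode_grad_pair:
  fixes k :: "'d::finite \<Rightarrow> nat"
  shows "grad_pair (mode k) (mode_gradient k)"
proof -
  define A where "A = sqrt (2 / L)"
  have A: "A > 0" using L by (simp add: A_def)
  define C where "C = (\<Sum>i\<in>UNIV. A * (pi * real (k i) / L) * A ^ (CARD('d) - 1))"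
  have C: "A * (pi * real (k i) / L) * A ^ (CARD('d) - 1) \<le> C" for i
    unfolding C_def using A L by (intro member_le_sum[of i UNIV "\<lambda>i. A * (pi * real (k i) / L) * A ^ (CARD('d) - 1)"]) auto
  have pb: "\<bar>\<Prod>j\<in>UNIV - {i}. sine (k j) (x $ j)\<bar> \<le> A ^ (CARD('d) - 1)" for i and x :: "real^'d"
    using prod_sine_bound[where k=k and x=x and S="UNIV - {i}"] by (simp add: A_def card_Diff_subset)
  have mb: "norm (mode k x) \<le> A ^ CARD('d)" for x :: "real^'d"
    unfolding mode_def norm_of_real A_def using prod_sine_bound[where k=k and x=x and S=UNIV] by simp
  show ?thesis
  proof (rule grad_pair_lipschitz[of _ _ C])
    show "L2_fun (mode k)" by (rule L2_fun_bounded_cbox_support[OF mode_measurable mb mode_support(1)])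
    show "integrable lborel (mode k)" by (rule integrable_bounded_cbox_support[OF mode_measurable mb mode_support(1)])
    have gb: "norm (mode_gradient k x) \<le> real CARD('d) * C" for x :: "real^'d"
    proof -
      have "norm (mode_gradient k x) \<le> (\<Sum>i\<in>(UNIV::'d set). norm (mode_gradient k x $ i))"
        using L2_set_le_sum[of UNIV "\<lambda>i. norm (mode_gradient k x $ i)"] by (simp add: norm_vec_def)
      also have "\<dots> \<le> (\<Sum>i\<in>(UNIV::'d set). C)"
      proof (rule sum_mono)
        fix i
        have "norm (mode_gradient k x $ i) = \<bar>sine' (k i) (x $ i)\<bar> * \<bar>\<Prod>j\<in>UNIV - {i}. sine (k j) (x $ j)\<bar>"
          by (simp only: mode_gradient_def vec_lambda_beta norm_of_real abs_mult)
        also have "\<dots> \<le> (A * (pi * real (k i) / L)) * A ^ (CARD('d) - 1)"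
          using sine'_bound[of "k i" "x $ i"] pb[of x i] A L unfolding A_def[symmetric] by (intro mult_mono) auto
        finally show "norm (mode_gradient k x $ i) \<le> C" using C[of i] by linarith
      qed
      finally show ?thesis by simp
    qed
    have gm: "mode_gradient k \<in> borel_measurable borel"
      unfolding mode_gradient_def[abs_def] by (intro borel_measurable_vec_lambda) measurable
    show "L2_fun (mode_gradient k)" by (rule L2_fun_bounded_cbox_support[OF gm gb mode_support(2)])
    fix i and x :: "real^'d" and h :: real
    have "mode k (x + h *\<^sub>R axis i 1) - mode k (x + 0 *\<^sub>R axis i 1)
        = of_real ((sine (k i) (x $ i + h) - sine (k i) (x $ i)) * (\<Prod>j\<in>UNIV - {i}. sine (k j) (x $ j)))"
      unfolding mode_shift by (simp add: left_diff_distrib)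
    then have "norm (mode k (x + h *\<^sub>R axis i 1) - mode k x)
        = \<bar>sine (k i) (x $ i + h) - sine (k i) (x $ i)\<bar> * \<bar>\<Prod>j\<in>UNIV - {i}. sine (k j) (x $ j)\<bar>"
      by (simp only: scaleR_zero_left add_0_right norm_of_real abs_mult)
    also have "\<dots> \<le> (A * (pi * real (k i) / L) * \<bar>h\<bar>) * A ^ (CARD('d) - 1)"
      using sine_lipschitz[of "k i" "x $ i + h" "x $ i"] pb[of x i] A L unfolding A_def[symmetric] by (intro mult_mono) auto
    also have "\<dots> = (A * (pi * real (k i) / L) * A ^ (CARD('d) - 1)) * \<bar>h\<bar>" by (simp add: mult_ac)
    also have "\<dots> \<le> C * \<bar>h\<bar>" by (intro mult_right_mono C) simp
    finally show "norm (mode k (x + h *\<^sub>R axis i 1) - mode k x) \<le> C * \<bar>h\<bar>" .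
  next
    fix i :: 'd
    have n: "AE x in lborel. x \<notin> {x::real^'d. x $ i = c}" for c
      using AE_component_neq[of i c] by simp
    show "AE x in lborel. ((\<lambda>h. (mode k (x + h *\<^sub>R axis i 1) - mode k x) /\<^sub>R h) \<longlongrightarrow> mode_gradient k x $ i) (at 0)"
    proof (rule AE_mp[OF n[of 0]], rule AE_mp[OF n[of L]], intro AE_I2 impI)
      fix x :: "real^'d" assume x: "x \<notin> {x. x $ i = L}" "x \<notin> {x. x $ i = 0}"
      let ?P = "\<Prod>j\<in>UNIV - {i}. sine (k j) (x $ j)"
      have "((\<lambda>h. (sine (k i) (x $ i + h) - sine (k i) (x $ i)) / h) \<longlongrightarrow> sine' (k i) (x $ i)) (at 0)"
        using sine_deriv[of "x $ i" "k i"] x by (simp add: DERIV_def)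
      then have "((\<lambda>h. complex_of_real ((sine (k i) (x $ i + h) - sine (k i) (x $ i)) / h * ?P)) \<longlongrightarrow> of_real (sine' (k i) (x $ i) * ?P)) (at 0)"
        by (intro tendsto_of_real tendsto_mult tendsto_const)
      moreover have "complex_of_real ((sine (k i) (x $ i + h) - sine (k i) (x $ i)) / h * ?P) = (mode k (x + h *\<^sub>R axis i 1) - mode k x) /\<^sub>R h" for h
      proof -
        have "mode k x = of_real (sine (k i) (x $ i) * ?P)" using mode_shift[where k=k and x=x and h=0 and i=i] by simp
        then show ?thesis unfolding mode_shift by (simp add: scaleR_conv_of_real divide_inverse algebra_simps)
      qed
      ultimately show "((\<lambda>h. (mode k (x + h *\<^sub>R axis i 1) - mode k x) /\<^sub>R h) \<longlongrightarrow> mode_gradient k x $ i) (at 0)"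
        by (simp only: mode_gradient_def vec_lambda_beta)
    qed
  qed
qed

lemma mode_orthonormal:
  fixes k l :: "'d::finite \<Rightarrow> nat"
  assumes "\<And>i. k i \<ge> 1" "\<And>i. l i \<ge> 1"
  shows "L2_inner (mode k) (mode l) = (if k = l then 1 else 0)"
proof -
  have "L2_inner (mode k) (mode l) = (LINT x::real^'d|lborel. of_real (\<Prod>i\<in>UNIV. sine (k i) (x $ i) * sine (l i) (x $ i)))"
    unfolding L2_inner_def mode_def by (simp add: prod.distrib)
  also have "\<dots> = of_real (LINT x::real^'d|lborel. (\<Prod>i\<in>UNIV. sine (k i) (x $ i) * sine (l i) (x $ i)))"
    using integral_prod_components(1)[of "\<lambda>i t. sine (k i) t * sine (l i) t"] sine_orthonormal(1)[OF assms]
    by (intro integral_of_real) simp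
  also have "(LINT x::real^'d|lborel. (\<Prod>i\<in>UNIV. sine (k i) (x $ i) * sine (l i) (x $ i))) = (\<Prod>i\<in>UNIV. if k i = l i then 1 else 0)"
    using integral_prod_components(2)[of "\<lambda>i t. sine (k i) t * sine (l i) t"] sine_orthonormal[OF assms] by simp
  also have "\<dots> = (if k = l then 1 else 0)"
    by (cases "k = l") (auto simp: fun_eq_iff)
  finally show ?thesis by simp
qed

lemma mode_kinetic:
  fixes k :: "'d::finite \<Rightarrow> nat"
  assumes k: "\<And>i. k i \<ge> 1"
  shows "kinetic (mode k) = pi\<^sup>2 / L\<^sup>2 * (\<Sum>i\<in>UNIV. (real (k i))\<^sup>2)"
proof -
  \<comment> \<open>The square of the partial derivative in direction \<open>i\<close> factorizes
    over the coordinates, and \<open>q i j\<close> is its factor in coordinate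
    \<open>j\<close>.\<close>
  define q where "q i j t = (if j = i then (sine' (k j) t)\<^sup>2 else sine (k j) t * sine (k j) t)" for i j t
  have iq: "integrable lborel (q i j)" for i j
    unfolding q_def using sine_orthonormal(1)[OF k k] sine'_norm(1)[OF k] by (cases "j = i") auto
  have Iq: "(LINT t|lborel. q i j t) = (if j = i then (pi * real (k j) / L)\<^sup>2 else 1)" for i j
    unfolding q_def using sine_orthonormal(2)[OF k k] sine'_norm(2)[OF k] by (cases "j = i") auto
  have gq: "(norm (mode_gradient k x))\<^sup>2 = (\<Sum>i\<in>UNIV. \<Prod>j\<in>UNIV. q i j (x $ j))" for x :: "real^'d"
  proof -
    have "(norm (mode_gradient k x))\<^sup>2 = (\<Sum>i\<in>UNIV. (sine' (k i) (x $ i) * (\<Prod>j\<in>UNIV - {i}. sine (k j) (x $ j)))\<^sup>2)"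
      unfolding norm_vec_def L2_set_def mode_gradient_def vec_lambda_beta norm_of_real by (simp add: sum_nonneg)
    also have "\<dots> = (\<Sum>i\<in>UNIV. \<Prod>j\<in>UNIV. q i j (x $ j))"
    proof (rule sum.cong[OF refl])
      fix i
      have "(\<Prod>j\<in>UNIV. q i j (x $ j)) = q i i (x $ i) * (\<Prod>j\<in>UNIV - {i}. q i j (x $ j))" by (rule prod.remove) auto
      also have "(\<Prod>j\<in>UNIV - {i}. q i j (x $ j)) = (\<Prod>j\<in>UNIV - {i}. (sine (k j) (x $ j))\<^sup>2)"
        by (intro prod.cong) (auto simp: q_def power2_eq_square)
      finally show "(sine' (k i) (x $ i) * (\<Prod>j\<in>UNIV - {i}. sine (k j) (x $ j)))\<^sup>2 = (\<Prod>j\<in>UNIV. q i j (x $ j))"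
        by (simp add: q_def power_mult_distrib prod_power_distrib)
    qed
    finally show ?thesis .
  qed
  have "kinetic (mode k) = (LINT x::real^'d|lborel. (\<Sum>i\<in>UNIV. \<Prod>j\<in>UNIV. q i j (x $ j)))"
    unfolding kinetic_eq[OF mode_grad_pair] gq ..
  also have "\<dots> = (\<Sum>i\<in>UNIV. LINT x::real^'d|lborel. (\<Prod>j\<in>UNIV. q i j (x $ j)))"
    by (intro Bochner_Integration.integral_sum integral_prod_components iq)
  also have "\<dots> = (\<Sum>i\<in>UNIV. \<Prod>j\<in>UNIV. if j = i then (pi * real (k j) / L)\<^sup>2 else 1)"
    unfolding integral_prod_components(2)[OF iq] Iq ..
  also have "\<dots> = (\<Sum>i\<in>UNIV. (pi * real (k i) / L)\<^sup>2)" by simp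
  finally show ?thesis by (simp add: power_divide power_mult_distrib sum_distrib_left)
qed

text \<open>The tangent of \<open>t powr p\<close> at the mean density \<open>r\<close> lies below
  the power. Integrated over the cube, the terms linear in the deviation from \<open>r\<close>
  cancel since the density has integral \<open>N\<close>, which is Jensen's inequality. The energy
  bound then depends on the modes only through their number and their frequencies.\<close>

lemma J_le_modes:
  fixes K :: "('d::finite \<Rightarrow> nat) set" and T :: "'d itself"
  assumes p: "1 < p" "p < 1 + 2 / real CARD('d)"
    and K: "finite K" "K \<noteq> {}" "\<And>k i. k \<in> K \<Longrightarrow> k i \<ge> 1"
  shows "J T p (card K) \<le> pi\<^sup>2 / L\<^sup>2 * (\<Sum>k\<in>K. \<Sum>i\<in>UNIV. (real (k i))\<^sup>2)
    - 1 / p * (L ^ CARD('d) * (real (card K) / L ^ CARD('d)) powr p)"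
proof -
  define N where "N = card K"
  have N: "N \<ge> 1" using K by (simp add: N_def Suc_leI card_gt_0_iff)
  obtain e where e: "bij_betw e {1..N} K" using ex_bij_betw_nat_finite_1[OF K(1)] unfolding N_def by blast
  define u where "u n = mode (e n)" for n
  have eK: "e n \<in> K" if "n \<in> {1..N}" for n using e that by (auto simp: bij_betw_def)
  have inj: "e m = e n \<longleftrightarrow> m = n" if "m \<in> {1..N}" "n \<in> {1..N}" for m n
    using inj_on_eq_iff[OF bij_betw_imp_inj_on[OF e] that] .
  have on: "orthonormal_H1 N u"
    unfolding orthonormal_H1_def
  proof (intro conjI ballI)
    show "u i \<in> H1" for i unfolding u_def H1_iff by (rule exI) (rule mode_grad_pair)
    show "L2_inner (u j) (u k) = (if j = k then 1 else 0)" if j: "j \<in> {1..N}" and k: "k \<in> {1..N}" for j k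
    proof -
      have "L2_inner (mode (e j)) (mode (e k)) = (if e j = e k then 1 else 0)"
        by (rule mode_orthonormal; rule K(3)[OF eK]) (rule j k)+
      then show ?thesis using inj[OF j k] by (simp only: u_def)
    qed
  qed
  have kin: "(\<Sum>n=1..N. kinetic (u n)) = pi\<^sup>2 / L\<^sup>2 * (\<Sum>k\<in>K. \<Sum>i\<in>UNIV. (real (k i))\<^sup>2)"
  proof -
    have "(\<Sum>n=1..N. kinetic (u n)) = (\<Sum>n=1..N. pi\<^sup>2 / L\<^sup>2 * (\<Sum>i\<in>UNIV. (real (e n i))\<^sup>2))"
      unfolding u_def by (intro sum.cong refl mode_kinetic K(3)[OF eK])
    also have "\<dots> = (\<Sum>k\<in>K. pi\<^sup>2 / L\<^sup>2 * (\<Sum>i\<in>UNIV. (real (k i))\<^sup>2))"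
      using sum.reindex_bij_betw[OF e, of "\<lambda>k. pi\<^sup>2 / L\<^sup>2 * (\<Sum>i\<in>UNIV. (real (k i))\<^sup>2)"] by simp
    finally show ?thesis by (simp add: sum_distrib_left)
  qed
  define V where "V = L ^ CARD('d)"
  have V: "V > 0" using L by (simp add: V_def)
  let ?B = "cbox 0 (vec L) :: (real^'d) set"
  have vol: "measure lborel ?B = V"
  proof -
    have "(0::real^'d) \<in> ?B" using L by (simp add: mem_box_cart)
    then show ?thesis unfolding V_def by (subst content_cbox_cart) auto
  qed
  have ind: "integrable lborel (indicator ?B :: real^'d \<Rightarrow> real)"
    by (intro integrable_real_indicator emeasure_lborel_cbox_finite) simp
  define r where "r = real N / V"
  have r: "r > 0" using N V by (simp add: r_def)
  have d0: "density N u x = 0" if "x \<notin> ?B" for x using mode_support(1)[OF that] by (simp add: density_def u_def)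
  have "(LINT x|lborel. (r powr p - p * r powr p) * indicator ?B x + p * r powr p / r * density N u x) \<le> (LINT x|lborel. density N u x powr p)"
  proof (rule integral_mono)
    show "integrable lborel (\<lambda>x. (r powr p - p * r powr p) * indicator ?B x + p * r powr p / r * density N u x)"
      using ind orthonormal_density(1)[OF on] by simp
    show "integrable lborel (\<lambda>x. density N u x powr p)" using p by (intro density_powr_integrable[OF on]) auto
    fix x :: "real^'d"
    show "(r powr p - p * r powr p) * indicator ?B x + p * r powr p / r * density N u x \<le> density N u x powr p"
    proof (cases "x \<in> ?B")
      case True
      have "r powr p * (1 + p * (density N u x / r - 1)) \<le> r powr p * (density N u x / r) powr p"
        using r p density_nonneg[of N u x] by (intro mult_left_mono powr_ge_tangent) auto
      also have "\<dots> = density N u x powr p" using r density_nonneg[of N u x] by (simp add: powr_mult[symmetric])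
      finally show ?thesis using True by (simp add: algebra_simps)
    next
      case False
      then show ?thesis by (simp add: d0)
    qed
  qed
  also have "(LINT x|lborel. (r powr p - p * r powr p) * indicator ?B x + p * r powr p / r * density N u x)
      = (r powr p - p * r powr p) * V + p * r powr p / r * real N"
    using ind orthonormal_density[OF on] vol by simp
  also have "\<dots> = V * r powr p" using V N by (simp add: r_def field_simps)
  finally have "V * r powr p \<le> (LINT x|lborel. density N u x powr p)" .
  then have "energy p N u \<le> pi\<^sup>2 / L\<^sup>2 * (\<Sum>k\<in>K. \<Sum>i\<in>UNIV. (real (k i))\<^sup>2) - 1 / p * (V * r powr p)"
    unfolding energy_def kin using p by (intro diff_left_mono mult_left_mono) auto
  moreover have "J T p N \<le> energy p N u" by (rule J_le_energy[OF p N on])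
  ultimately show ?thesis unfolding V_def r_def N_def by linarith
qed

end

subsection \<open>Lattice point sums\<close>

lemma continuous_on_nth: "continuous_on UNIV (\<lambda>x::real^'d. x $ j)"
  by (rule continuous_on_component[OF continuous_on_id])

lemma open_component_halfspace: "open {x::real^'d. 0 < x $ j}" "open {x::real^'d. x $ j < 0}"
  by (rule open_Collect_less[OF continuous_on_const continuous_on_nth] open_Collect_less[OF continuous_on_nth continuous_on_const])+

definition reflect :: "'d::finite \<Rightarrow> real^'d \<Rightarrow> real^'d" where
  "reflect i x = (\<chi> j. if j = i then - x $ j else x $ j)"

lemma reflect_measurable [measurable]: "reflect i \<in> borel_measurable borel"
proof -
  have "continuous_on UNIV (\<lambda>x::real^'a. if j = i then - x $ j else x $ j)" for j
    by (cases "j = i") (simp_all add: continuous_on_nth continuous_on_minus)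
  then have "continuous_on UNIV (reflect i)"
    unfolding reflect_def[abs_def] by (intro continuous_on_vec_lambda)
  then show ?thesis by (rule borel_measurable_continuous_onI)
qed

lemma nn_integral_reflect:
  fixes f :: "real^'d \<Rightarrow> ennreal"
  assumes [measurable]: "f \<in> borel_measurable borel"
  shows "(\<integral>\<^sup>+x. f (reflect i x) \<partial>lborel) = (\<integral>\<^sup>+x. f x \<partial>lborel)"
proof -
  define c where "c b = (if b = (axis i 1 :: real^'d) then -1 else 1 :: real)" for b
  have T: "0 + (\<Sum>j\<in>Basis. (c j * (x \<bullet> j)) *\<^sub>R j) = reflect i x" for x :: "real^'d"
  proof -
    have "(\<Sum>j\<in>Basis. (c j * (x \<bullet> j)) *\<^sub>R j) $ m = reflect i x $ m" for m
    proof -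
      have ax: "axis m 1 \<in> (Basis :: (real^'d) set)" by (simp add: axis_in_Basis_iff)
      have "(\<Sum>j\<in>Basis. (c j * (x \<bullet> j)) *\<^sub>R j) $ m = c (axis m 1) * (x \<bullet> axis m 1)"
        unfolding cart_eq_inner_axis[of _ m] using ax by (simp add: inner_sum_left_Basis)
      then show ?thesis by (simp add: c_def reflect_def axis_eq_axis cart_eq_inner_axis[symmetric])
    qed
    then show ?thesis by (simp add: vec_eq_iff)
  qed
  have "(lborel :: (real^'d) measure) = Nonnegative_Lebesgue_Integration.density (distr lborel borel (reflect i)) (\<lambda>_. ennreal (\<Prod>j\<in>Basis. \<bar>c j\<bar>))"
    using lborel_affine_euclidean[of c 0] unfolding T by (auto simp: c_def)
  also have "(\<Prod>j\<in>(Basis :: (real^'d) set). \<bar>c j\<bar>) = 1" by (intro prod.neutral) (simp add: c_def)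
  finally have "(lborel :: (real^'d) measure) = distr lborel borel (reflect i)" by (simp add: density_1)
  then have "(\<integral>\<^sup>+x. f x \<partial>lborel) = (\<integral>\<^sup>+x. f x \<partial>distr lborel borel (reflect i))" by simp
  also have "\<dots> = (\<integral>\<^sup>+x. f (reflect i x) \<partial>lborel)" by (rule nn_integral_distr) auto
  finally show ?thesis by simp
qed

text \<open>Induction on the constrained coordinates: each new constraint splits the integral along
  a null hyperplane, and reflection maps the negative half onto the positive one.\<close>

lemma orthant_nn_integral:
  fixes G :: "real^'d \<Rightarrow> ennreal"
  assumes G [measurable]: "G \<in> borel_measurable borel" and sym: "\<And>i x. G (reflect i x) = G x"
  shows "2 ^ card S * (\<integral>\<^sup>+x. G x * indicator {x. \<forall>i\<in>S. 0 < x $ i} x \<partial>lborel) = (\<integral>\<^sup>+x. G x \<partial>lborel)"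
proof -
  have "finite S" by simp
  then show ?thesis
  proof (induction S rule: finite_induct)
    case empty
    then show ?case by simp
  next
    case (insert i S)
    let ?P = "{x::real^'d. \<forall>j\<in>S. 0 < x $ j}"
    have meas [measurable]: "{x::real^'d. \<forall>j\<in>U. 0 < x $ j} \<in> sets borel" for U
    proof -
      have "{x::real^'d. \<forall>j\<in>U. 0 < x $ j} = (\<Inter>j\<in>U. {x. 0 < x $ j})" by auto
      moreover have "open (\<Inter>j\<in>U. {x::real^'d. 0 < x $ j})"
        by (intro open_INT open_component_halfspace ballI) simp
      ultimately show ?thesis by simp
    qed
    have mi [measurable]: "{x::real^'d. 0 < x $ i} \<in> sets borel" "{x::real^'d. x $ i < 0} \<in> sets borel"
      by (intro borel_open open_component_halfspace)+
    have n: "AE x in (lborel :: (real^'d) measure). x $ i \<noteq> 0" for i :: 'd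
      by (rule AE_component_neq)
    have "(\<integral>\<^sup>+x. G x * indicator ?P x \<partial>lborel)
        = (\<integral>\<^sup>+x. G x * indicator ?P x * indicator {x. 0 < x $ i} x + G x * indicator ?P x * indicator {x. x $ i < 0} x \<partial>lborel)"
      by (rule nn_integral_cong_AE, rule AE_mp[OF n[of i]]) (auto simp: indicator_def)
    also have "\<dots> = (\<integral>\<^sup>+x. G x * indicator ?P x * indicator {x. 0 < x $ i} x \<partial>lborel) + (\<integral>\<^sup>+x. G x * indicator ?P x * indicator {x. x $ i < 0} x \<partial>lborel)"
      by (intro nn_integral_add) measurable
    also have "(\<integral>\<^sup>+x. G x * indicator ?P x * indicator {x. x $ i < 0} x \<partial>lborel) = (\<integral>\<^sup>+x. G (reflect i x) * indicator ?P (reflect i x) * indicator {x. x $ i < 0} (reflect i x) \<partial>lborel)"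
      by (rule nn_integral_reflect[symmetric]) measurable
    also have "\<dots> = (\<integral>\<^sup>+x. G x * indicator ?P x * indicator {x. 0 < x $ i} x \<partial>lborel)"
    proof (rule nn_integral_cong)
      fix x :: "real^'d"
      have "indicator ?P (reflect i x) = (indicator ?P x :: ennreal)"
        using insert.hyps by (auto simp: indicator_def reflect_def)
      then show "G (reflect i x) * indicator ?P (reflect i x) * indicator {x. x $ i < 0} (reflect i x) = G x * indicator ?P x * indicator {x. 0 < x $ i} x"
        by (simp add: sym) (simp add: indicator_def reflect_def)
    qed
    also have "(\<integral>\<^sup>+x. G x * indicator ?P x * indicator {x. 0 < x $ i} x \<partial>lborel) = (\<integral>\<^sup>+x. G x * indicator {x. \<forall>j\<in>insert i S. 0 < x $ j} x \<partial>lborel)"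
      by (intro nn_integral_cong) (auto simp: indicator_def)
    finally have "(\<integral>\<^sup>+x. G x * indicator ?P x \<partial>lborel) = 2 * (\<integral>\<^sup>+x. G x * indicator {x. \<forall>j\<in>insert i S. 0 < x $ j} x \<partial>lborel)"
      by (simp add: mult_2)
    then show ?case using insert by (simp add: mult.assoc mult.left_commute)
  qed
qed

text \<open>The limiting frequency domain. Sine modes are indexed by positive integers, so the
  rescaled frequencies fill only the positive orthant of the ball.\<close>

definition octant_ball :: "(real^'d) set" where
  "octant_ball = {x. (\<forall>i. 0 < x $ i) \<and> norm x < 1}"

definition ball_volume :: "'d::finite itself \<Rightarrow> real" where
  "ball_volume _ = measure lborel (ball (0::real^'d) 1)"

lemma ball_volume_pos: "ball_volume TYPE('d::finite) > 0"
  by (simp add: ball_volume_def content_ball_pos)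

lemma norm_reflect: "norm (reflect i x) = norm x"
  unfolding norm_vec_def L2_set_def by (intro arg_cong[where f=sqrt] sum.cong) (auto simp: reflect_def)

lemma octant_ball_open: "open (octant_ball :: (real^'d) set)"
proof -
  have eq: "(octant_ball :: (real^'d) set) = (\<Inter>i. {x. 0 < x $ i}) \<inter> ball 0 1" by (auto simp: octant_ball_def)
  show ?thesis unfolding eq
    by (intro open_Int open_INT open_component_halfspace open_ball ballI finite)
qed

lemma octant_ball_measurable [measurable]: "(octant_ball :: (real^'d) set) \<in> sets borel"
  by (intro borel_open octant_ball_open)

lemma octant_nn_integral:
  fixes G :: "real^'d \<Rightarrow> ennreal"
  assumes [measurable]: "G \<in> borel_measurable borel" and sym: "\<And>i x. G (reflect i x) = G x"
  shows "2 ^ CARD('d) * (\<integral>\<^sup>+x. G x * indicator octant_ball x \<partial>lborel) = (\<integral>\<^sup>+x. G x * indicator (ball 0 1) x \<partial>lborel)"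
proof -
  have "(\<integral>\<^sup>+x. G x * indicator octant_ball x \<partial>lborel) = (\<integral>\<^sup>+x. (G x * indicator (ball 0 1) x) * indicator {x. \<forall>i\<in>UNIV. 0 < x $ i} x \<partial>lborel)"
    by (intro nn_integral_cong) (auto simp: indicator_def octant_ball_def)
  moreover have "indicator (ball 0 1) (reflect i x) = (indicator (ball 0 1) x :: ennreal)" for i and x :: "real^'d"
    by (simp add: indicator_def norm_reflect)
  moreover have m: "(\<lambda>x. G x * indicator (ball 0 1) x) \<in> borel_measurable borel"
    by (intro borel_measurable_times_ennreal assms borel_measurable_indicator) simp
  ultimately show ?thesis
    using orthant_nn_integral[OF m, of UNIV] sym by simp
qed

lemma octant_volume: "measure lborel (octant_ball :: (real^'d) set) = ball_volume TYPE('d) / 2 ^ CARD('d)"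
proof -
  have fin: "emeasure lborel (octant_ball :: (real^'d) set) < \<infinity>"
    by (intro emeasure_bounded_finite bounded_subset[OF bounded_ball[of 0 1]]) (auto simp: octant_ball_def)
  have "2 ^ CARD('d) * emeasure lborel (octant_ball :: (real^'d) set) = emeasure lborel (ball (0::real^'d) 1)"
    using octant_nn_integral[of "\<lambda>x::real^'d. 1"] by simp
  moreover have "emeasure lborel (ball (0::real^'d) 1) = ennreal (ball_volume TYPE('d))"
    unfolding ball_volume_def using emeasure_bounded_finite[OF bounded_ball, of "0::real^'d" 1]
    by (intro emeasure_eq_ennreal_measure) auto
  moreover have "emeasure lborel (octant_ball :: (real^'d) set) = ennreal (measure lborel (octant_ball :: (real^'d) set))"
    using fin by (intro emeasure_eq_ennreal_measure) auto
  ultimately have "ennreal (2 ^ CARD('d) * measure lborel (octant_ball :: (real^'d) set)) = ennreal (ball_volume TYPE('d))"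
    by (simp add: ennreal_mult ennreal_power[symmetric])
  then have "2 ^ CARD('d) * measure lborel (octant_ball :: (real^'d) set) = ball_volume TYPE('d)"
    using ball_volume_pos[where 'd='d] by (subst (asm) ennreal_inj) auto
  then show ?thesis by (simp add: field_simps)
qed

text \<open>Writing \<open>1 - (norm x)\<^sup>2\<close> as the integral of \<open>2 * s\<close> from
  \<open>norm x\<close> to 1 and exchanging integrals leaves the volumes of balls of radius
  \<open>s\<close>, hence the integral of \<open>2 * V * s ^ (d + 1)\<close> over the unit interval.
  Integrating the complement of \<open>(norm x)\<^sup>2\<close> is what makes these sets balls and
  not shells.\<close>

lemma ball_second_moment:
  "(\<integral>\<^sup>+x. ennreal (1 - (norm x)\<^sup>2) * indicator (ball 0 1) x \<partial>(lborel :: (real^'d) measure))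
    = ennreal (2 * ball_volume TYPE('d) / (real CARD('d) + 2))"
proof -
  let ?V = "ball_volume TYPE('d)"
  have vol: "emeasure lborel {x::real^'d. norm x < s} = ennreal (?V * s ^ CARD('d))" if "s > 0" for s
  proof -
    have "{x::real^'d. norm x < s} = ball 0 s" by auto
    moreover have "emeasure lborel (ball (0::real^'d) s) = ennreal (measure lborel (ball (0::real^'d) s))"
      using emeasure_bounded_finite[OF bounded_ball, of "0::real^'d" s] by (intro emeasure_eq_ennreal_measure) auto
    ultimately show ?thesis using that by (simp add: ball_volume_def content_ball)
  qed
  have layer: "ennreal (1 - (norm x)\<^sup>2) * indicator (ball 0 1) x = (\<integral>\<^sup>+s. (\<lambda>(x, s). if norm x < s \<and> s \<le> 1 then ennreal (2 * s) else 0) (x, s) \<partial>lborel)" for x :: "real^'d"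
  proof (cases "norm x < 1")
    case True
    have "(\<integral>\<^sup>+s. (\<lambda>(x, s). if norm x < s \<and> s \<le> 1 then ennreal (2 * s) else 0) (x, s) \<partial>lborel) = (\<integral>\<^sup>+s. ennreal (2 * s) * indicator {norm x..1} s \<partial>lborel)"
      by (rule nn_integral_cong_AE, rule AE_mp[OF AE_lborel_singleton[of "norm x"]]) (auto simp: indicator_def)
    also have "\<dots> = ennreal (1\<^sup>2 - (norm x)\<^sup>2)"
      by (rule nn_integral_FTC_Icc) (use True in \<open>auto intro!: derivative_eq_intros intro: order_trans[OF norm_ge_zero]\<close>)
    finally show ?thesis using True by simp
  next
    case False
    then have "(\<lambda>(x, s). if norm x < s \<and> s \<le> 1 then ennreal (2 * s) else 0) (x, s) = 0" for s by auto
    then show ?thesis using False by simp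
  qed
  have "(\<integral>\<^sup>+x. ennreal (1 - (norm x)\<^sup>2) * indicator (ball 0 1) x \<partial>(lborel :: (real^'d) measure))
      = (\<integral>\<^sup>+s. (\<integral>\<^sup>+x. (\<lambda>(x::real^'d, s). if norm x < s \<and> s \<le> 1 then ennreal (2 * s) else 0) (x, s) \<partial>lborel) \<partial>lborel)"
    unfolding layer by (rule lborel_pair.Fubini'[symmetric]) measurable
  also have "\<dots> = (\<integral>\<^sup>+s. ennreal (2 * ?V * s ^ (CARD('d) + 1)) * indicator {0..1} s \<partial>lborel)"
  proof (rule nn_integral_cong)
    fix s :: real
    have "(\<integral>\<^sup>+x. (\<lambda>(x::real^'d, s). if norm x < s \<and> s \<le> 1 then ennreal (2 * s) else 0) (x, s) \<partial>lborel)
        = (\<integral>\<^sup>+x. (if s \<le> 1 then ennreal (2 * s) else 0) * indicator {x::real^'d. norm x < s} x \<partial>lborel)"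
      by (intro nn_integral_cong) (auto simp: indicator_def)
    also have "\<dots> = (if s \<le> 1 then ennreal (2 * s) else 0) * emeasure lborel {x::real^'d. norm x < s}"
      by (rule nn_integral_cmult_indicator) measurable
    also have "\<dots> = ennreal (2 * ?V * s ^ (CARD('d) + 1)) * indicator {0..1} s"
    proof (cases "0 < s \<and> s \<le> 1")
      case True
      then show ?thesis using vol[of s] ball_volume_pos[where 'd='d] by (simp add: ennreal_mult[symmetric] mult_ac)
    next
      case False
      show ?thesis
      proof (cases "s > 1")
        case False
        then have "s \<le> 0" using \<open>\<not> (0 < s \<and> s \<le> 1)\<close> by linarith
        then have "{x::real^'d. norm x < s} = {}" by (auto simp: not_less intro: order_trans)
        then show ?thesis using \<open>s \<le> 0\<close> by (auto simp: indicator_def)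
      qed simp
    qed
    finally show "(\<integral>\<^sup>+x. (\<lambda>(x::real^'d, s). if norm x < s \<and> s \<le> 1 then ennreal (2 * s) else 0) (x, s) \<partial>lborel)
        = ennreal (2 * ?V * s ^ (CARD('d) + 1)) * indicator {0..1} s" .
  qed
  also have "\<dots> = ennreal (2 * ?V / (real CARD('d) + 2) * 1 ^ (CARD('d) + 2) - 2 * ?V / (real CARD('d) + 2) * 0 ^ (CARD('d) + 2))"
  proof (rule nn_integral_FTC_Icc[where F="\<lambda>s. 2 * ?V / (real CARD('d) + 2) * s ^ (CARD('d) + 2)"])
    fix s :: real assume s: "s \<in> {0..1}"
    have "DERIV (\<lambda>s. 2 * ?V / (real CARD('d) + 2) * s ^ (CARD('d) + 2)) s :> 2 * ?V / (real CARD('d) + 2) * (real (CARD('d) + 2) * s ^ (CARD('d) + 2 - 1))"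
      by (intro DERIV_cmult DERIV_pow[THEN DERIV_cong]) simp
    moreover have "2 * ?V / (real CARD('d) + 2) * (real (CARD('d) + 2) * s ^ (CARD('d) + 2 - 1)) = 2 * ?V * s ^ (CARD('d) + 1)"
      by (simp add: field_simps)
    ultimately show "DERIV (\<lambda>s. 2 * ?V / (real CARD('d) + 2) * s ^ (CARD('d) + 2)) s :> 2 * ?V * s ^ (CARD('d) + 1)" by simp
    show "0 \<le> 2 * ?V * s ^ (CARD('d) + 1)" using ball_volume_pos[where 'd='d] s by simp
  qed auto
  finally show ?thesis by simp
qed

lemma octant_integrable: "continuous_on UNIV q \<Longrightarrow> integrable lborel (\<lambda>x::real^'d. indicator octant_ball x * q x)" for q :: "real^'d \<Rightarrow> real"
proof -
  assume q: "continuous_on UNIV q"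
  have [measurable]: "q \<in> borel_measurable borel" using q by (rule borel_measurable_continuous_onI)
  have "bounded (q ` cball 0 1)"
    by (meson q compact_cball compact_continuous_image compact_imp_bounded continuous_on_subset top_greatest)
  then obtain B where "\<forall>y\<in>q ` cball 0 1. norm y \<le> B" unfolding bounded_iff by blast
  then have B: "\<And>x. x \<in> cball 0 1 \<Longrightarrow> \<bar>q x\<bar> \<le> B" by auto
  have B0: "0 \<le> B" using B[of 0] by auto
  obtain a where a: "ball (0::real^'d) 1 \<subseteq> cbox (-a) a" using bounded_subset_cbox_symmetric[OF bounded_ball] by metis
  show ?thesis
  proof (rule integrable_bounded_cbox_support[of _ B "-a" a])
    show "norm (indicator octant_ball x * q x) \<le> B" for x
      using B[of x] B0 by (auto simp: indicator_def octant_ball_def)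
    show "indicator octant_ball x * q x = 0" if "x \<notin> cbox (-a) a" for x
    proof -
      have "x \<notin> ball 0 1" using that a by blast
      then show ?thesis by (auto simp: indicator_def octant_ball_def)
    qed
  qed measurable
qed

text \<open>The volume of the octant minus the complementary moment: the ratio of moment to volume
  is \<open>1 - 2 / (d + 2) = d / (d + 2)\<close>, the dimensional factor in
  \<open>c_sc\<close>.\<close>

lemma octant_second_moment:
  "(LINT x::real^'d|lborel. indicator octant_ball x * (norm x)\<^sup>2)
    = real CARD('d) * ball_volume TYPE('d) / ((real CARD('d) + 2) * 2 ^ CARD('d))"
proof -
  let ?V = "ball_volume TYPE('d)" and ?d = "real CARD('d)"
  let ?I = "LINT x::real^'d|lborel. indicator octant_ball x * (1 - (norm x)\<^sup>2)"
  have i: "integrable lborel (\<lambda>x::real^'d. indicator octant_ball x * (1 - (norm x)\<^sup>2))"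
    "integrable lborel (\<lambda>x::real^'d. indicator octant_ball x * (norm x)\<^sup>2)"
    "integrable lborel (\<lambda>x::real^'d. indicator octant_ball x * (1::real))"
    by (intro octant_integrable continuous_intros)+
  have pos: "0 \<le> indicator octant_ball x * (1 - (norm x)\<^sup>2)" for x :: "real^'d"
    by (auto simp: indicator_def octant_ball_def power_le_one less_imp_le)
  have "ennreal ?I = (\<integral>\<^sup>+x. ennreal (indicator octant_ball x * (1 - (norm x)\<^sup>2)) \<partial>(lborel :: (real^'d) measure))"
    by (intro nn_integral_eq_integral[symmetric] i) (simp add: pos)
  also have "\<dots> = (\<integral>\<^sup>+x. ennreal (1 - (norm x)\<^sup>2) * indicator octant_ball x \<partial>(lborel :: (real^'d) measure))"
    by (intro nn_integral_cong) (auto simp: indicator_def)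
  finally have "2 ^ CARD('d) * ennreal ?I = ennreal (2 * ?V / (?d + 2))"
    using octant_nn_integral[of "\<lambda>x::real^'d. ennreal (1 - (norm x)\<^sup>2)"] ball_second_moment[where 'd='d]
    by (simp add: norm_reflect)
  moreover have I0: "?I \<ge> 0" by (intro integral_nonneg_AE AE_I2 pos)
  ultimately have "ennreal (2 ^ CARD('d) * ?I) = ennreal (2 * ?V / (?d + 2))"
    by (simp add: ennreal_mult ennreal_power[symmetric])
  then have I: "2 ^ CARD('d) * ?I = 2 * ?V / (?d + 2)"
    using I0 ball_volume_pos[where 'd='d] by (subst (asm) ennreal_inj) auto
  have "(LINT x::real^'d|lborel. indicator octant_ball x * (norm x)\<^sup>2) = (LINT x::real^'d|lborel. indicator octant_ball x * 1 - indicator octant_ball x * (1 - (norm x)\<^sup>2))"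
    by (intro Bochner_Integration.integral_cong refl) (simp add: algebra_simps)
  also have "\<dots> = measure lborel (octant_ball :: (real^'d) set) - ?I"
    using i by (subst Bochner_Integration.integral_diff) auto
  also have "\<dots> = ?V / 2 ^ CARD('d) - 2 * ?V / (?d + 2) / 2 ^ CARD('d)"
  proof -
    have "?I = 2 * ?V / (?d + 2) / 2 ^ CARD('d)" unfolding I[symmetric] by simp
    then show ?thesis unfolding octant_volume by (rule arg_cong)
  qed
  also have "\<dots> = (?V * ((?d + 2) - 2) / (?d + 2)) / 2 ^ CARD('d)"
  proof -
    have "?d + 2 \<noteq> 0" by linarith
    then have "?V = ?V * (?d + 2) / (?d + 2)" by simp
    then show ?thesis by (metis (no_types) diff_divide_distrib mult.commute right_diff_distrib)
  qed
  also have "\<dots> = ?d * ?V / ((?d + 2) * 2 ^ CARD('d))" by (simp add: mult.commute)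
  finally show ?thesis .
qed

section \<open>Riemann sums over lattice points\<close>

definition lattice_ball :: "nat \<Rightarrow> ('d::finite \<Rightarrow> nat) set" where
  "lattice_ball n = {k. (\<forall>i. k i \<ge> 1) \<and> (\<Sum>i\<in>UNIV. (real (k i))\<^sup>2) \<le> (real n)\<^sup>2}"

lemma finite_lattice_ball: "finite (lattice_ball n :: ('d::finite \<Rightarrow> nat) set)"
proof (rule finite_subset)
  show "(lattice_ball n :: ('d \<Rightarrow> nat) set) \<subseteq> PiE UNIV (\<lambda>_. {..n})"
  proof
    fix k :: "'d \<Rightarrow> nat" assume k: "k \<in> lattice_ball n"
    have "k i \<le> n" for i
    proof -
      have "(real (k i))\<^sup>2 \<le> (\<Sum>i\<in>UNIV. (real (k i))\<^sup>2)" by (rule member_le_sum[of i UNIV "\<lambda>i. (real (k i))\<^sup>2"]) auto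
      also have "\<dots> \<le> (real n)\<^sup>2" using k by (simp add: lattice_ball_def)
      finally have "real (k i) \<le> real n" by (rule power2_le_imp_le) simp
      then show ?thesis by simp
    qed
    then show "k \<in> PiE UNIV (\<lambda>_. {..n})" by auto
  qed
qed (auto intro: finite_PiE)

text \<open>The sum over lattice points is the integral of a step function, to which dominated convergence applies.\<close>

lemma lattice_sum_limit:
  fixes q :: "real^'d \<Rightarrow> real"
  assumes q: "continuous_on UNIV q"
  shows "(\<lambda>n. (\<Sum>k\<in>lattice_ball (Suc n). q (\<chi> i. real (k i) / real (Suc n))) / real (Suc n) ^ CARD('d))
    \<longlonglongrightarrow> (LINT x|lborel. indicator octant_ball x * q x)"
proof -
  \<comment> \<open>Half-open cells tile the line, and the cell of a point is identified by a
    ceiling. Each lattice point is the upper corner of its cell.\<close>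
  define I where "I n m = {(real m - 1) / real (Suc n)<..real m / real (Suc n)}" for n m :: nat
  define F where "F n x = (\<Sum>k\<in>lattice_ball (Suc n). q (\<chi> i. real (k i) / real (Suc n)) * (\<Prod>i\<in>UNIV. indicator (I n (k i)) (x $ i)))" for n and x :: "real^'d"
  define c where "c n x = (\<chi> i. of_int \<lceil>real (Suc n) * x $ i\<rceil> / real (Suc n))" for n and x :: "real^'d"
  have leI: "(real m - 1) / real (Suc n) \<le> real m / real (Suc n)" for n m by (intro divide_right_mono) auto
  have iI: "integrable lborel (indicator (I n m) :: real \<Rightarrow> real)" for n m
    unfolding I_def using leI by (intro integrable_real_indicator) (simp_all del: of_nat_Suc)
  have mI: "(LINT t|lborel. indicator (I n m) t) = 1 / real (Suc n)" for n m
    unfolding I_def using leI by (simp add: diff_divide_distrib del: of_nat_Suc)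
  have int: "(LINT x|lborel. F n x) = (\<Sum>k\<in>lattice_ball (Suc n). q (\<chi> i. real (k i) / real (Suc n))) / real (Suc n) ^ CARD('d)" for n
  proof -
    have "(LINT x|lborel. F n x) = (\<Sum>k\<in>lattice_ball (Suc n). LINT x|lborel. (q (\<chi> i. real (k i) / real (Suc n)) * (\<Prod>i\<in>UNIV. indicator (I n (k i)) (x $ i))))"
      unfolding F_def by (intro Bochner_Integration.integral_sum integrable_mult_right integral_prod_components(1) iI)
    also have "\<dots> = (\<Sum>k\<in>lattice_ball (Suc n). q (\<chi> i. real (k i) / real (Suc n)) * (1 / real (Suc n)) ^ CARD('d))"
    proof -
      have "(LINT x::real^'d|lborel. (\<Prod>i\<in>UNIV. indicator (I n (k i)) (x $ i))) = (1 / real (Suc n)) ^ CARD('d)" for k :: "'d \<Rightarrow> nat"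
        unfolding integral_prod_components(2)[OF iI] mI by (rule prod_constant)
      then show ?thesis by simp
    qed
    also have "\<dots> = (\<Sum>k\<in>lattice_ball (Suc n). q (\<chi> i. real (k i) / real (Suc n))) / real (Suc n) ^ CARD('d)"
      by (simp add: sum_divide_distrib power_divide)
    finally show ?thesis .
  qed
  have memI: "x \<in> I n m \<longleftrightarrow> \<lceil>real (Suc n) * x\<rceil> = int m" for x n m
    by (auto simp: I_def ceiling_eq_iff field_simps)
  \<comment> \<open>The step function evaluates \<open>q\<close> at the upper corner
    \<open>c n x\<close> of the cell containing \<open>x\<close>, provided that this corner belongs
    to the ball.\<close>
  have F_eq: "F n x = (if (\<forall>i. 0 < x $ i) \<and> norm (c n x) \<le> 1 then q (c n x) else 0)" for n x
  proof -
    define \<kappa> where "\<kappa> i = nat \<lceil>real (Suc n) * x $ i\<rceil>" for i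
    have pr: "(\<Prod>i\<in>UNIV. indicator (I n (k i)) (x $ i)) = (if \<forall>i. \<lceil>real (Suc n) * x $ i\<rceil> = int (k i) then 1 else (0::real))" for k :: "'d \<Rightarrow> nat"
    proof (cases "\<forall>i. \<lceil>real (Suc n) * x $ i\<rceil> = int (k i)")
      case True
      then show ?thesis using memI by (simp add: indicator_def)
    next
      case False
      then obtain j where "x $ j \<notin> I n (k j)" using memI by blast
      then have "(\<Prod>i\<in>UNIV. indicator (I n (k i)) (x $ i)) = (0::real)"
        by (intro prod_zero finite bexI[of _ j]) simp_all
      then show ?thesis unfolding if_not_P[OF False] .
    qed
    have nsq: "(norm (c n x))\<^sup>2 = (\<Sum>i\<in>UNIV. (of_int \<lceil>real (Suc n) * x $ i\<rceil>)\<^sup>2) / (real (Suc n))\<^sup>2"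
      by (simp add: norm_vec_def L2_set_def c_def sum_nonneg power_divide sum_divide_distrib del: of_nat_Suc)
    have posn: "0 < \<lceil>real (Suc n) * x $ i\<rceil> \<longleftrightarrow> 0 < x $ i" for i by (simp add: zero_less_mult_iff del: of_nat_Suc)
    show ?thesis
    proof (cases "\<kappa> \<in> lattice_ball (Suc n) \<and> (\<forall>i. \<lceil>real (Suc n) * x $ i\<rceil> = int (\<kappa> i))")
      case True
      have *: "(\<forall>i. \<lceil>real (Suc n) * x $ i\<rceil> = int (k i)) \<longleftrightarrow> k = \<kappa>" for k using True by (auto simp: fun_eq_iff)
      have "F n x = (\<Sum>k\<in>lattice_ball (Suc n). if k = \<kappa> then q (\<chi> i. real (k i) / real (Suc n)) else 0)"
        unfolding F_def pr * by (intro sum.cong) auto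
      also have "\<dots> = q (\<chi> i. real (\<kappa> i) / real (Suc n))" using True by (subst sum.delta[OF finite_lattice_ball]) simp
      also have "(\<chi> i. real (\<kappa> i) / real (Suc n)) = c n x" using True by (simp add: c_def vec_eq_iff)
      finally have "F n x = q (c n x)" .
      moreover have "0 < x $ i" for i
      proof -
        have "\<kappa> i \<ge> 1" using True by (simp add: lattice_ball_def)
        then have "0 < \<lceil>real (Suc n) * x $ i\<rceil>" unfolding \<kappa>_def by linarith
        then show ?thesis using posn by blast
      qed
      moreover have "norm (c n x) \<le> 1"
      proof -
        have "(\<Sum>i\<in>UNIV. (of_int \<lceil>real (Suc n) * x $ i\<rceil>)\<^sup>2) = (\<Sum>i\<in>UNIV. (real (\<kappa> i))\<^sup>2)" using True by simp
        also have "\<dots> \<le> (real (Suc n))\<^sup>2" using True by (simp add: lattice_ball_def)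
        finally have "(norm (c n x))\<^sup>2 \<le> 1\<^sup>2" unfolding nsq by (simp add: divide_le_eq del: of_nat_Suc)
        then show ?thesis by (rule power2_le_imp_le) simp
      qed
      ultimately show ?thesis by simp
    next
      case False
      have "F n x = 0" unfolding F_def
      proof (rule sum.neutral, rule ballI)
        fix k :: "'d \<Rightarrow> nat" assume k: "k \<in> lattice_ball (Suc n)"
        have nk: "\<not> (\<forall>i. \<lceil>real (Suc n) * x $ i\<rceil> = int (k i))"
        proof
          assume a: "\<forall>i. \<lceil>real (Suc n) * x $ i\<rceil> = int (k i)"
          then have "\<kappa> = k" by (auto simp: \<kappa>_def)
          then show False using False a k by simp
        qed
        then show "q (\<chi> i. real (k i) / real (Suc n)) * (\<Prod>i\<in>UNIV. indicator (I n (k i)) (x $ i)) = 0"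
          unfolding pr if_not_P[OF nk] by simp
      qed
      moreover have "\<not> ((\<forall>i. 0 < x $ i) \<and> norm (c n x) \<le> 1)"
      proof
        assume a: "(\<forall>i. 0 < x $ i) \<and> norm (c n x) \<le> 1"
        have k1: "int (\<kappa> i) = \<lceil>real (Suc n) * x $ i\<rceil>" "\<kappa> i \<ge> 1" for i
        proof -
          have "0 < \<lceil>real (Suc n) * x $ i\<rceil>" using a posn by blast
          then show "int (\<kappa> i) = \<lceil>real (Suc n) * x $ i\<rceil>" "\<kappa> i \<ge> 1" unfolding \<kappa>_def by linarith+
        qed
        have "(norm (c n x))\<^sup>2 \<le> 1\<^sup>2" using a by (intro power_mono) auto
        then have "(\<Sum>i\<in>UNIV. (of_int \<lceil>real (Suc n) * x $ i\<rceil>)\<^sup>2) \<le> (real (Suc n))\<^sup>2"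
          unfolding nsq by (simp add: divide_le_eq del: of_nat_Suc)
        moreover have "(of_int \<lceil>real (Suc n) * x $ i\<rceil> :: real) = real (\<kappa> i)" for i using k1(1)[of i] by (metis of_int_of_nat_eq)
        ultimately have "\<kappa> \<in> lattice_ball (Suc n)" using k1(2) by (simp add: lattice_ball_def del: of_nat_Suc)
        then show False using False k1(1) by simp
      qed
      ultimately show ?thesis by (simp only: if_not_P if_False)
    qed
  qed
  have climit: "(\<lambda>n. c n x) \<longlonglongrightarrow> x" for x :: "real^'d"
  proof (rule vec_tendstoI)
    fix i
    have "(\<lambda>n. of_int \<lceil>real (Suc n) * x $ i\<rceil> / real (Suc n)) \<longlonglongrightarrow> x $ i"
    proof (rule LIM_zero_cancel, rule Lim_null_comparison)
      show "\<forall>\<^sub>F n in sequentially. norm (of_int \<lceil>real (Suc n) * x $ i\<rceil> / real (Suc n) - x $ i) \<le> inverse (real (Suc n))"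
      proof (intro always_eventually allI)
        fix n
        have "\<bar>of_int \<lceil>real (Suc n) * x $ i\<rceil> - real (Suc n) * x $ i\<bar> \<le> 1" using ceiling_correct[of "real (Suc n) * x $ i"] by linarith
        then have "\<bar>of_int \<lceil>real (Suc n) * x $ i\<rceil> - real (Suc n) * x $ i\<bar> / real (Suc n) \<le> 1 / real (Suc n)" by (intro divide_right_mono) auto
        moreover have "of_int \<lceil>real (Suc n) * x $ i\<rceil> / real (Suc n) - x $ i = (of_int \<lceil>real (Suc n) * x $ i\<rceil> - real (Suc n) * x $ i) / real (Suc n)"
          by (simp add: diff_divide_distrib del: of_nat_Suc)
        ultimately show "norm (of_int \<lceil>real (Suc n) * x $ i\<rceil> / real (Suc n) - x $ i) \<le> inverse (real (Suc n))"
          by (simp add: inverse_eq_divide del: of_nat_Suc)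
      qed
      show "(\<lambda>n. inverse (real (Suc n))) \<longlonglongrightarrow> 0" by (rule LIMSEQ_inverse_real_of_nat)
    qed
    then show "(\<lambda>n. c n x $ i) \<longlonglongrightarrow> x $ i" by (simp add: c_def del: of_nat_Suc)
  qed
  have "bounded (q ` cball 0 1)"
    by (meson q compact_cball compact_continuous_image compact_imp_bounded continuous_on_subset top_greatest)
  then obtain B where "\<forall>y\<in>q ` cball 0 1. norm y \<le> B" unfolding bounded_iff by blast
  then have B: "\<And>x. x \<in> cball 0 1 \<Longrightarrow> \<bar>q x\<bar> \<le> B" by auto
  have B0: "0 \<le> B" using B[of 0] by auto
  \<comment> \<open>The corner dominates \<open>x\<close> in every coordinate, so a contributing
    cell lies in the unit cube. This gives a dominating function independent of
    \<open>n\<close>.\<close>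
  have "(\<lambda>n. LINT x|lborel. F n x) \<longlonglongrightarrow> (LINT x|lborel. indicator octant_ball x * q x)"
  proof (rule integral_dominated_convergence[where w="\<lambda>x. B * indicator (cbox 0 (vec 1)) x"])
    show "integrable lborel (\<lambda>x::real^'d. B * indicator (cbox 0 (vec 1)) x)"
      by (intro integrable_mult_right integrable_real_indicator emeasure_lborel_cbox_finite) simp
    show "F n \<in> borel_measurable lborel" for n
      unfolding F_def[abs_def]
      by (intro borel_measurable_sum borel_measurable_times borel_measurable_const borel_measurable_integrable integral_prod_components(1) iI)
    show "(\<lambda>x. indicator octant_ball x * q x) \<in> borel_measurable lborel"
      using borel_measurable_integrable[OF octant_integrable[OF q]] by simp
    show "AE x in lborel. norm (F n x) \<le> B * indicator (cbox 0 (vec 1)) x" for n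
    proof (rule AE_I2)
      fix x
      show "norm (F n x) \<le> B * indicator (cbox 0 (vec 1)) x"
      proof (cases "(\<forall>i. 0 < x $ i) \<and> norm (c n x) \<le> 1")
        case True
        have "x $ i \<le> 1" for i
        proof -
          have "real (Suc n) * x $ i / real (Suc n) \<le> of_int \<lceil>real (Suc n) * x $ i\<rceil> / real (Suc n)" by (intro divide_right_mono) auto
          then have "x $ i \<le> c n x $ i" by (simp add: c_def del: of_nat_Suc)
          also have "\<dots> \<le> norm (c n x)" using component_le_norm_cart[of "c n x" i] by linarith
          finally show ?thesis using True by linarith
        qed
        then have "x \<in> cbox 0 (vec 1)" using True by (auto simp: mem_box_cart less_imp_le)
        then show ?thesis using True B[of "c n x"] unfolding F_eq by simp
      next
        case False
        then show ?thesis using B0 unfolding F_eq by auto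
      qed
    qed
    \<comment> \<open>On the sphere the corners may stay outside the ball or not, so pointwise
      convergence is claimed only off this null set.\<close>
    have "AE x in lborel. x \<notin> sphere (0::real^'d) 1" by (rule negligible_imp_AE) (rule negligible_sphere)
    then show "AE x in lborel. (\<lambda>n. F n x) \<longlonglongrightarrow> indicator octant_ball x * q x"
    proof (rule AE_mp, intro AE_I2 impI)
      fix x :: "real^'d" assume "x \<notin> sphere 0 1"
      then have x1: "norm x \<noteq> 1" by simp
      have nl: "(\<lambda>n. norm (c n x)) \<longlonglongrightarrow> norm x" by (intro tendsto_norm climit)
      show "(\<lambda>n. F n x) \<longlonglongrightarrow> indicator octant_ball x * q x"
      proof (cases "\<forall>i. 0 < x $ i")
        case True
        show ?thesis
        proof (cases "norm x < 1")
          case lt: True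
          have "(\<lambda>n. q (c n x)) \<longlonglongrightarrow> q x" using q climit by (intro continuous_on_tendsto_compose[OF q]) auto
          moreover have "\<forall>\<^sub>F n in sequentially. q (c n x) = F n x"
            using order_tendstoD(2)[OF nl lt] by eventually_elim (use True in \<open>simp add: F_eq\<close>)
          ultimately show ?thesis using True lt by (auto simp: octant_ball_def elim: Lim_transform_eventually)
        next
          case False
          then have gt: "1 < norm x" using x1 by simp
          have "\<forall>\<^sub>F n in sequentially. F n x = 0"
            using order_tendstoD(1)[OF nl gt] by eventually_elim (simp add: F_eq)
          then show ?thesis using False by (simp add: octant_ball_def tendsto_eventually)
        qed
      next
        case False
        then have "F n x = 0" for n unfolding F_eq using False by auto
        then show ?thesis using False by (simp add: octant_ball_def)
      qed
    qed
  qed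
  then show ?thesis unfolding int .
qed

subsection \<open>The semiclassical bound\<close>

text \<open>The cone over the sphere is the punctured closed ball. Through this identity the
  quotient of \<open>d\<close> by the surface measure in \<open>c_sc\<close> becomes the reciprocal
  of the ball volume.\<close>

lemma sphere_measure_unit: "sphere_measure (sphere (0::real^'d) 1) = real CARD('d) * ball_volume TYPE('d)"
proof -
  have "{t *\<^sub>R x | t x. x \<in> sphere (0::real^'d) 1 \<and> 0 < t \<and> t \<le> 1} = cball 0 1 - {0}" (is "?A = ?B")
  proof (intro equalityI subsetI)
    fix y :: "real^'d" assume "y \<in> ?B"
    then have "y = norm y *\<^sub>R (y /\<^sub>R norm y)" "y /\<^sub>R norm y \<in> sphere 0 1" "0 < norm y" "norm y \<le> 1" by auto
    then show "y \<in> ?A" by blast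
  qed auto
  moreover have "measure lborel (cball (0::real^'d) 1 - {0}) = measure lborel (cball (0::real^'d) 1)"
    by (rule measure_Diff_null_set) auto
  ultimately show ?thesis unfolding sphere_measure_def ball_volume_def by (simp add: content_cball content_ball)
qed

lemma c_sc_eq: "c_sc TYPE('d::finite) = 4 * pi\<^sup>2 * real CARD('d) / (real CARD('d) + 2) / ball_volume TYPE('d) powr (2 / real CARD('d))"
proof -
  have "real CARD('d) / (real CARD('d) * ball_volume TYPE('d)) = 1 / ball_volume TYPE('d)" by simp
  then show ?thesis unfolding c_sc_def sphere_measure_unit Let_def
    using ball_volume_pos[where 'd='d] by (simp only: powr_divide powr_one_eq_one times_divide_eq_right mult_1_right)
qed

lemma power_powr: "0 < x \<Longrightarrow> (x ^ n) powr b = x powr (real n * b)" for x :: real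
  by (simp only: powr_realpow[symmetric] powr_powr)

lemma c_sc_pos: "c_sc TYPE('d::finite) > 0"
  using ball_volume_pos[where 'd='d] unfolding c_sc_eq by (intro divide_pos_pos mult_pos_pos) (auto simp: add_pos_pos)

lemma lattice_count_limit:
  "(\<lambda>n. real (card (lattice_ball (Suc n) :: ('d::finite \<Rightarrow> nat) set)) / real (Suc n) ^ CARD('d)) \<longlonglongrightarrow> ball_volume TYPE('d) / 2 ^ CARD('d)"
  using lattice_sum_limit[of "\<lambda>_::real^'d. 1"] octant_volume[where 'd='d] by (simp del: of_nat_Suc)

lemma lattice_moment_limit:
  "(\<lambda>n. (\<Sum>k\<in>(lattice_ball (Suc n) :: ('d::finite \<Rightarrow> nat) set). \<Sum>i\<in>UNIV. (real (k i))\<^sup>2) / real (Suc n) ^ (CARD('d) + 2))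
    \<longlonglongrightarrow> real CARD('d) * ball_volume TYPE('d) / ((real CARD('d) + 2) * 2 ^ CARD('d))"
proof -
  have "(norm (\<chi> i. real (k i) / real (Suc n)))\<^sup>2 = (\<Sum>i\<in>UNIV. (real (k i))\<^sup>2) / (real (Suc n))\<^sup>2" for k :: "'d \<Rightarrow> nat" and n
    by (simp add: norm_vec_def L2_set_def sum_nonneg power_divide sum_divide_distrib del: of_nat_Suc)
  then have "(\<Sum>k\<in>(lattice_ball (Suc n) :: ('d \<Rightarrow> nat) set). (norm (\<chi> i. real (k i) / real (Suc n)))\<^sup>2) / real (Suc n) ^ CARD('d)
      = (\<Sum>k\<in>(lattice_ball (Suc n) :: ('d \<Rightarrow> nat) set). \<Sum>i\<in>UNIV. (real (k i))\<^sup>2) / real (Suc n) ^ (CARD('d) + 2)" for n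
    by (simp only: sum_divide_distrib[symmetric] divide_divide_eq_left power_add mult.commute)
  moreover have "continuous_on UNIV (\<lambda>x::real^'d. (norm x)\<^sup>2)" by (intro continuous_intros)
  ultimately show ?thesis using lattice_sum_limit[of "\<lambda>x::real^'d. (norm x)\<^sup>2"] by (simp only: octant_second_moment)
qed

text \<open>The frequency sum grows like \<open>n ^ (d + 2)\<close> and the count like
  \<open>n ^ d\<close>, so the exponent \<open>1 + 2 / d\<close> balances the powers of
  \<open>n\<close>. The factor 4 in \<open>c_sc\<close> is \<open>(2 ^ d) powr (2 / d)\<close>,
  coming from the number of orthants.\<close>

lemma lattice_ratio_limit:
  defines "a \<equiv> 1 + 2 / real CARD('d::finite)"
  shows "(\<lambda>n. pi\<^sup>2 * (\<Sum>k\<in>(lattice_ball (Suc n) :: ('d::finite \<Rightarrow> nat) set). \<Sum>i\<in>UNIV. (real (k i))\<^sup>2)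
      / real (card (lattice_ball (Suc n) :: ('d \<Rightarrow> nat) set)) powr a) \<longlonglongrightarrow> c_sc TYPE('d)"
proof -
  let ?V = "ball_volume TYPE('d)" and ?d = "real CARD('d)"
  let ?S = "\<lambda>n. \<Sum>k\<in>(lattice_ball (Suc n) :: ('d \<Rightarrow> nat) set). \<Sum>i\<in>UNIV. (real (k i))\<^sup>2"
  let ?N = "\<lambda>n. real (card (lattice_ball (Suc n) :: ('d \<Rightarrow> nat) set))"
  have V: "?V > 0" by (rule ball_volume_pos)
  have A0: "?V / 2 ^ CARD('d) \<noteq> 0" using V by simp
  have "(\<lambda>n. pi\<^sup>2 * (?S n / real (Suc n) ^ (CARD('d) + 2)) / (?N n / real (Suc n) ^ CARD('d)) powr a)
    \<longlonglongrightarrow> pi\<^sup>2 * (?d * ?V / ((?d + 2) * 2 ^ CARD('d))) / (?V / 2 ^ CARD('d)) powr a"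
    using V by (intro tendsto_divide[OF tendsto_mult[OF tendsto_const lattice_moment_limit] tendsto_powr[OF lattice_count_limit tendsto_const A0]]) simp
  moreover have "pi\<^sup>2 * (?S n / real (Suc n) ^ (CARD('d) + 2)) / (?N n / real (Suc n) ^ CARD('d)) powr a = pi\<^sup>2 * ?S n / ?N n powr a" for n
  proof -
    have "?d * a = real (CARD('d) + 2)" by (simp add: a_def field_simps)
    then have "(real (Suc n) ^ CARD('d)) powr a = real (Suc n) ^ (CARD('d) + 2)"
      by (simp only: power_powr of_nat_0_less_iff zero_less_Suc powr_realpow)
    then show ?thesis by (simp add: powr_divide del: of_nat_Suc)
  qed
  moreover have "pi\<^sup>2 * (?d * ?V / ((?d + 2) * 2 ^ CARD('d))) / (?V / 2 ^ CARD('d)) powr a = c_sc TYPE('d)"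
  proof -
    have "(2 ^ CARD('d)) powr (2 / ?d) = (4::real)" by (simp add: power_powr)
    then have q: "(?V / 2 ^ CARD('d)) powr (2 / ?d) = ?V powr (2 / ?d) / 4" using V by (simp add: powr_divide)
    have e: "(?V / 2 ^ CARD('d)) powr a = ?V / 2 ^ CARD('d) * (?V powr (2 / ?d) / 4)" using V unfolding a_def powr_add q by simp
    have "pi\<^sup>2 * (x * v / (y * z)) / (v / z * (w / 4)) = 4 * pi\<^sup>2 * x / y / w" if "v > 0" "y > 0" "z > 0" "w > 0" for v w x y z :: real
      using that by (simp add: field_simps)
    then show ?thesis unfolding e c_sc_eq using V by (simp add: add_pos_pos)
  qed
  ultimately show ?thesis by (simp only:)
qed

text \<open>The side of the cube is a free parameter; it is chosen so that the mean density
  \<open>card K / L ^ CARD('d)\<close> equals the prescribed \<open>r\<close>.\<close>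

lemma J_per_particle_le:
  fixes T :: "'d::finite itself" and K :: "('d \<Rightarrow> nat) set"
  assumes p: "1 < p" "p < 1 + 2 / real CARD('d)" and r: "r > 0"
    and K: "finite K" "K \<noteq> {}" "\<And>k i. k \<in> K \<Longrightarrow> k i \<ge> 1"
  shows "J T p (card K) / real (card K) \<le>
    pi\<^sup>2 * (\<Sum>k\<in>K. \<Sum>i\<in>UNIV. (real (k i))\<^sup>2) / real (card K) powr (1 + 2 / real CARD('d)) * r powr (2 / real CARD('d)) - r powr (p - 1) / p"
proof -
  let ?N = "real (card K)" and ?d = "real CARD('d)" and ?S = "\<Sum>k\<in>K. \<Sum>i\<in>UNIV. (real (k i))\<^sup>2"
  have N: "?N > 0" using K by (simp add: card_gt_0_iff)
  define L where "L = (?N / r) powr (1 / ?d)"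
  have L: "L > 0" using N r by (simp add: L_def)
  have Ld: "L ^ CARD('d) = ?N / r"
  proof -
    have "L ^ CARD('d) = (?N / r) powr (?d * (1 / ?d))" unfolding L_def by (rule powr_power) (use N r in simp)
    then show ?thesis using N r by simp
  qed
  have "L\<^sup>2 = (?N / r) powr (real 2 * (1 / ?d))" unfolding L_def by (rule powr_power) (use N r in simp)
  also have "\<dots> = (?N / r) powr (2 / ?d)" by simp
  also have "\<dots> = ?N powr (2 / ?d) / r powr (2 / ?d)" using N r by (simp add: powr_divide)
  finally have L2: "L\<^sup>2 = ?N powr (2 / ?d) / r powr (2 / ?d)" .
  have "J T p (card K) \<le> pi\<^sup>2 / L\<^sup>2 * ?S - 1 / p * (L ^ CARD('d) * (?N / L ^ CARD('d)) powr p)"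
    by (rule J_le_modes[OF L p K(1,2)]) (rule K(3))
  also have "L ^ CARD('d) * (?N / L ^ CARD('d)) powr p = ?N * r powr (p - 1)"
    unfolding Ld using N r by (simp add: powr_diff)
  also have "pi\<^sup>2 / L\<^sup>2 * ?S = ?N * (pi\<^sup>2 * ?S / ?N powr (1 + 2 / ?d) * r powr (2 / ?d))"
    unfolding L2 using N r by (simp add: powr_add)
  finally have "J T p (card K) \<le> ?N * (pi\<^sup>2 * ?S / ?N powr (1 + 2 / ?d) * r powr (2 / ?d) - r powr (p - 1) / p)"
    by (simp add: right_diff_distrib)
  then show ?thesis using N by (simp add: pos_divide_le_eq mult.commute)
qed

lemma J_one: "J TYPE('d::finite) p 1 = I_one TYPE('d) p"
proof -
  have "{energy p 1 u | u :: nat \<Rightarrow> real^'d \<Rightarrow> complex. orthonormal_H1 1 u}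
    = {kinetic u - 1 / p * (LINT x|lborel. norm (u x) powr (2 * p)) | u :: real^'d \<Rightarrow> complex.
         u \<in> H1 \<and> (LINT x|lborel. (norm (u x))\<^sup>2) = 1}" (is "?A = ?B")
  proof -
    have on: "orthonormal_H1 1 u \<longleftrightarrow> u 1 \<in> H1 \<and> (LINT x|lborel. (norm (u 1 x))\<^sup>2) = 1" for u :: "nat \<Rightarrow> real^'d \<Rightarrow> complex"
      by (simp add: orthonormal_H1_def L2_inner_self del: of_real_power)
    have "((norm z)\<^sup>2) powr p = norm z powr (2 * p)" for z :: complex
      by (cases "z = 0") (simp_all add: power_powr)
    then have en: "energy p 1 u = kinetic (u 1) - 1 / p * (LINT x|lborel. norm (u 1 x) powr (2 * p))" for u :: "nat \<Rightarrow> real^'d \<Rightarrow> complex"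
      by (simp add: energy_def density_def)
    show ?thesis
    proof (intro equalityI subsetI)
      fix e assume "e \<in> ?A"
      then show "e \<in> ?B" using on en by blast
    next
      fix e assume "e \<in> ?B"
      then obtain u :: "real^'d \<Rightarrow> complex" where u: "e = kinetic u - 1 / p * (LINT x|lborel. norm (u x) powr (2 * p))"
        "u \<in> H1" "(LINT x|lborel. (norm (u x))\<^sup>2) = 1" by blast
      then have "e = energy p 1 (\<lambda>_. u)" "orthonormal_H1 1 (\<lambda>_. u)" unfolding en on by simp_all
      then show "e \<in> ?A" by blast
    qed
  qed
  then show ?thesis unfolding J_def I_one_def by simp
qed

theorem theorem10:
  fixes p :: real
  assumes "1 < p" and "p < 1 + 2 / real CARD('d::finite)"
  shows "(\<lambda>N. J TYPE('d) p N / real N) \<longlonglongrightarrow> e_lim TYPE('d) p \<and>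
    e_lim TYPE('d) p = (INF N\<in>{1..}. J TYPE('d) p N / real N) \<and>
    e_LT TYPE('d) p \<le> e_lim TYPE('d) p \<and>
    e_lim TYPE('d) p \<le> min (e_sc TYPE('d) p) (I_one TYPE('d) p) \<and>
    min (e_sc TYPE('d) p) (I_one TYPE('d) p) < 0"
proof -
  let ?J = "J TYPE('d) p" and ?d = "real CARD('d)"
  have low: "e_LT TYPE('d) p * real n \<le> ?J n" if "n \<ge> 1" for n
    by (rule J_lower_bound[OF assms that])
  have lim: "(\<lambda>n. ?J n / real n) \<longlonglongrightarrow> (INF n\<in>{1..}. ?J n / real n)"
    by (rule fekete[OF J_subadditive[OF assms] low])
  then have eq: "e_lim TYPE('d) p = (INF n\<in>{1..}. ?J n / real n)"
    unfolding e_lim_def by (rule limI)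
  have low': "e_LT TYPE('d) p \<le> ?J n / real n" if "n \<in> {1..}" for n
    using low[of n] that by (simp add: pos_le_divide_eq)
  have lower: "e_LT TYPE('d) p \<le> e_lim TYPE('d) p"
    unfolding eq by (intro cINF_greatest low') auto
  have upper: "e_lim TYPE('d) p \<le> ?J n / real n" if "n \<ge> 1" for n
    unfolding eq using that low' by (intro cINF_lower bdd_belowI2[where m="e_LT TYPE('d) p"]) auto
  have "e_lim TYPE('d) p \<le> I_one TYPE('d) p"
    using upper[of 1] J_one[where 'd='d and p=p] by simp
  moreover have "e_lim TYPE('d) p \<le> e_sc TYPE('d) p"
  proof -
    have d: "?d > 0" by simp
    \<comment> \<open>The density at which the energy profile for \<open>c_sc\<close> attains its
      minimum. Since the limit is also an infimum over all particle numbers, trial states for the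
      cardinalities of lattice balls are enough.\<close>
    obtain r where r: "r > 0" "c_sc TYPE('d) * r powr (2 / ?d) - r powr (p - 1) / p = e_sc TYPE('d) p"
      using e_of_constant_attained[OF c_sc_pos d assms] unfolding e_sc_def by blast
    let ?K = "\<lambda>n. lattice_ball (Suc n) :: ('d \<Rightarrow> nat) set"
    let ?B = "\<lambda>n. pi\<^sup>2 * (\<Sum>k\<in>?K n. \<Sum>i\<in>UNIV. (real (k i))\<^sup>2) / real (card (?K n)) powr (1 + 2 / ?d) * r powr (2 / ?d) - r powr (p - 1) / p"
    have "?B \<longlonglongrightarrow> c_sc TYPE('d) * r powr (2 / ?d) - r powr (p - 1) / p"
      by (intro tendsto_diff tendsto_mult tendsto_const lattice_ratio_limit)
    moreover have "\<forall>\<^sub>F n in sequentially. e_lim TYPE('d) p \<le> ?B n"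
    proof -
      \<comment> \<open>Small lattice balls may be empty, and \<open>J\<close> at 0 gives no
        information; the positive limit of the normalized counts makes them nonempty
        eventually.\<close>
      have "0 < ball_volume TYPE('d) / 2 ^ CARD('d)" using ball_volume_pos[where 'd='d] by simp
      from order_tendstoD(1)[OF lattice_count_limit this] show ?thesis
      proof eventually_elim
        case (elim n)
        have ne: "?K n \<noteq> {}" using elim by auto
        then have "card (?K n) \<ge> 1" using finite_lattice_ball[of "Suc n"] by (simp add: Suc_le_eq card_gt_0_iff)
        then have "e_lim TYPE('d) p \<le> ?J (card (?K n)) / real (card (?K n))" by (rule upper)
        also have "\<dots> \<le> ?B n"
          by (rule J_per_particle_le[OF assms r(1) finite_lattice_ball ne]) (simp add: lattice_ball_def)
        finally show ?case .
      qed
    qed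
    ultimately show ?thesis unfolding r(2) by (rule tendsto_lowerbound) simp
  qed
  moreover have "e_sc TYPE('d) p < 0"
    unfolding e_sc_def by (rule e_of_constant_neg[OF c_sc_pos _ assms]) simp
  ultimately show ?thesis using lim eq lower by auto
qed

end
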